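(* Suppose that $(F,\sigma)$ is a KT-nearfield with $\mathrm{char}\,F\neq 2$ such that $F$ has finite dimension over its kernel. Then $F$ is a Dickson nearfield coupled to a commutative field, which we also call $F$ (i.e. there are a commutative field $K$ with the same underlying set, addition, $0$ and $1$ as $F$ and a coupling $\varphi$ on $K$ such that the nearfield $F$ equals $K^\varphi$), and the corresponding sharply triply transitive group $T_3(F)$ is sandwiched between $\mathrm{PSL}_2(K)$ and $\mathrm{P\Gamma L}_2(K)$, i.e. $\mathrm{PSL}_2(K)\leq T_3(F)\leq \mathrm{P\Gamma L}_2(K)$ as permutation groups on $F\,\dot\cup\,\{\infty\}=\mathrm{PG}_1(K)$.
   Context: A (right) nearfield is $(F,+,\cdot,0,1)$ with $0\ne1$ such that $(F,+,0)$ is a group (necessarily abelian), $(F^*,\cdot,1)$ with $F^*=F\setminus\{0\}$ is a group, $(a+b)\cdot c=a\cdot c+b\cdot c$ for all $a,b,c$, and $a\cdot0=0$ for all $a$. The characteristic $\mathrm{char}\,F$ is the additive order of $1$ if this is finite, and $0$ otherwise. The kernel is $\Bbbk(F)=\{a\in F\mid a\cdot(b+c)=a\cdot b+a\cdot c\ \forall b,c\in F\}$; it is a skewfield and $F$ is a left vector space over it. A KT-automorphism of $F$ is an involutory automorphism $\sigma$ ($\sigma^2=\mathrm{id}$) of the group $F^*$ such that $(1+a^\sigma)^\sigma=1-(1+a)^\sigma$ for all $a\in F^*\setminus\{-1\}$; $(F,\sigma)$ is then called a KT-nearfield. $T_3(F)$: maps act on the right. For $a\in F^*$, $b\in F$ let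 $t_{a,b}:F\to F$, $x\mapsto x\cdot a+b$, $\mathrm{Aff}(F)=\{t_{a,b}\mid a\in F^*,b\in F\}$, extended to $X=F\,\dot\cup\,\{\infty\}$ by fixing $\infty$. Let $\tau\in\mathrm{Sym}(X)$ with $\infty\tau=0$, $0\tau=\infty$, $x\tau=-x^\sigma$ for $x\in F^*$. Then $T_3(F)=\langle\tau,\mathrm{Aff}(F)\rangle\le\mathrm{Sym}(X)$, a sharply $3$-transitive group on $X$. Dickson nearfield: let $K$ be a skewfield and $\varphi:K^*\to\mathrm{Aut}(K)$ a coupling, i.e. a map with $\varphi(a^{\varphi(b)}b)=\varphi(a)\varphi(b)$ for all $a,b\in K^*$ (automorphisms written as exponents and composed left to right). Define $a\cdot b=a^{\varphi(b)}b$ if $b\neq0$ and $a\cdot0=0$. Then $K^\varphi=(K,+,\cdot,0,1)$ is a nearfield, called a Dickson nearfield coupled to $K$. $\mathrm{PG}_1(K)$ denotes the projective line over $K$, identified with $K\,\dot\cup\,\{\infty\}$. *)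

theory Defs
  imports "HOL-Algebra.Algebra"
begin

section \<open>Nearfields and KT-nearfields\<close>

text \<open>
  Commutativity of addition is a theorem about nearfields, not an axiom. The record is that of
  rings, but the left distributive law is missing, so the ring locales do not apply.
\<close>

locale nearfield =
  fixes F :: "('a, 'm) ring_scheme" (structure)
  assumes add_group: "group (add_monoid F)"
    and mult_closed: "\<lbrakk>a \<in> carrier F; b \<in> carrier F\<rbrakk> \<Longrightarrow> a \<otimes> b \<in> carrier F"
    and zero_not_one: "\<zero> \<noteq> \<one>"
    and mult_group: "group (mult_of F)"
    and right_distrib: "\<lbrakk>a \<in> carrier F; b \<in> carrier F; c \<in> carrier F\<rbrakk>
          \<Longrightarrow> (a \<oplus> b) \<otimes> c = a \<otimes> c \<oplus> b \<otimes> c"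
    and mult_zero: "a \<in> carrier F \<Longrightarrow> a \<otimes> \<zero> = \<zero>"

text \<open>\<open>group.ord\<close> yields \<open>0\<close> for elements of infinite order.\<close>

definition nearfield_char :: "('a, 'm) ring_scheme \<Rightarrow> nat" where
  "nearfield_char F = group.ord (add_monoid F) \<one>\<^bsub>F\<^esub>"

definition nearfield_kernel :: "('a, 'm) ring_scheme \<Rightarrow> 'a set" where
  "nearfield_kernel F = {a \<in> carrier F. \<forall>b\<in>carrier F. \<forall>c\<in>carrier F.
     a \<otimes>\<^bsub>F\<^esub> (b \<oplus>\<^bsub>F\<^esub> c) = a \<otimes>\<^bsub>F\<^esub> b \<oplus>\<^bsub>F\<^esub> a \<otimes>\<^bsub>F\<^esub> c}"

text \<open>
  A finite basis of \<open>F\<close> as a left vector space over its kernel: every element is a linear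
  combination with unique coefficients. The library notions of dimension presuppose that the
  ambient structure is a ring or that the scalars are commutative, so they cannot be used.
\<close>

definition finite_kernel_basis :: "('a, 'm) ring_scheme \<Rightarrow> 'a set \<Rightarrow> bool" where
  "finite_kernel_basis F B \<longleftrightarrow> finite B \<and> B \<subseteq> carrier F \<and>
     (\<forall>x\<in>carrier F. \<exists>!c. c \<in> B \<rightarrow>\<^sub>E nearfield_kernel F \<and>
        x = (\<Oplus>\<^bsub>F\<^esub>b\<in>B. c b \<otimes>\<^bsub>F\<^esub> b))"

definition finite_dim_over_kernel :: "('a, 'm) ring_scheme \<Rightarrow> bool" where
  "finite_dim_over_kernel F \<longleftrightarrow> (\<exists>B. finite_kernel_basis F B)"

text \<open>
  \<open>\<sigma>\<close> is only relevant on \<open>F - {0}\<close>. It may be the identity: the unique KT-automorphism of the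
  field with three elements is the identity, so involutory just means \<open>\<sigma>\<^sup>2 = id\<close>.
\<close>

locale KT_nearfield = nearfield F
  for F :: "('a, 'm) ring_scheme" (structure) +
  fixes \<sigma> :: "'a \<Rightarrow> 'a"
  assumes automorphism: "\<sigma> \<in> iso (mult_of F) (mult_of F)"
    and involutory: "a \<in> carrier (mult_of F) \<Longrightarrow> \<sigma> (\<sigma> a) = a"
    and KT_identity: "a \<in> carrier (mult_of F) - {\<ominus> \<one>}
          \<Longrightarrow> \<sigma> (\<one> \<oplus> \<sigma> a) = \<one> \<ominus> \<sigma> (\<one> \<oplus> a)"


section \<open>The group \<open>T\<^sub>3(F)\<close>\<close>

text \<open>
  The point \<open>\<infinity>\<close> is \<open>None\<close>. Permutation groups on a set \<open>X\<close> are subgroups of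
  \<open>BijGroup X\<close>, whose elements are made extensional and multiplied by
  \<open>(g f) x = g (f x)\<close>; which permutations a set of permutations generates does not depend on the
  order of composition.
\<close>

definition proj_points :: "('a, 'm) ring_scheme \<Rightarrow> 'a option set" where
  "proj_points F = insert None (Some ` carrier F)"

definition affine_map :: "('a, 'm) ring_scheme \<Rightarrow> 'a \<Rightarrow> 'a \<Rightarrow> 'a option \<Rightarrow> 'a option" where
  "affine_map F a b = (\<lambda>p\<in>proj_points F. case p of
      None \<Rightarrow> None
    | Some x \<Rightarrow> Some (x \<otimes>\<^bsub>F\<^esub> a \<oplus>\<^bsub>F\<^esub> b))"

definition Aff :: "('a, 'm) ring_scheme \<Rightarrow> ('a option \<Rightarrow> 'a option) set" where
  "Aff F = {affine_map F a b | a b. a \<in> carrier (mult_of F) \<and> b \<in> carrier F}"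

definition tau :: "('a, 'm) ring_scheme \<Rightarrow> ('a \<Rightarrow> 'a) \<Rightarrow> 'a option \<Rightarrow> 'a option" where
  "tau F \<sigma> = (\<lambda>p\<in>proj_points F. case p of
      None \<Rightarrow> Some \<zero>\<^bsub>F\<^esub>
    | Some x \<Rightarrow> if x = \<zero>\<^bsub>F\<^esub> then None else Some (\<ominus>\<^bsub>F\<^esub> \<sigma> x))"

definition T3 :: "('a, 'm) ring_scheme \<Rightarrow> ('a \<Rightarrow> 'a) \<Rightarrow> ('a option \<Rightarrow> 'a option) set" where
  "T3 F \<sigma> = generate (BijGroup (proj_points F)) (insert (tau F \<sigma>) (Aff F))"


section \<open>Dickson nearfields\<close>

text \<open>
  \<open>\<phi> b a\<close> is \<open>a\<close> to the exponent \<open>\<phi>(b)\<close>. The second condition is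
  \<open>\<phi>(a\<^bsup>\<phi>(b)\<^esup> b) = \<phi>(a) \<phi>(b)\<close>, evaluated at every element \<open>x\<close>; as automorphisms are composed from
  left to right, \<open>\<phi>(a)\<close> is applied first.
\<close>

definition coupling :: "('a, 'm) ring_scheme \<Rightarrow> ('a \<Rightarrow> 'a \<Rightarrow> 'a) \<Rightarrow> bool" where
  "coupling K \<phi> \<longleftrightarrow>
     (\<forall>a\<in>carrier (mult_of K). \<phi> a \<in> ring_iso K K) \<and>
     (\<forall>a\<in>carrier (mult_of K). \<forall>b\<in>carrier (mult_of K). \<forall>x\<in>carrier K.
        \<phi> (\<phi> b a \<otimes>\<^bsub>K\<^esub> b) x = \<phi> b (\<phi> a x))"

definition dickson :: "('a, 'm) ring_scheme \<Rightarrow> ('a \<Rightarrow> 'a \<Rightarrow> 'a) \<Rightarrow> ('a, 'm) ring_scheme" where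
  "dickson K \<phi> = K\<lparr>mult := \<lambda>a b. if b = \<zero>\<^bsub>K\<^esub> then \<zero>\<^bsub>K\<^esub> else \<phi> b a \<otimes>\<^bsub>K\<^esub> b\<rparr>"

text \<open>
  Record equality would also compare the meaningless values of the operations outside the
  carrier.
\<close>

definition same_structure :: "('a, 'm) ring_scheme \<Rightarrow> ('a, 'n) ring_scheme \<Rightarrow> bool" where
  "same_structure F G \<longleftrightarrow>
     carrier F = carrier G \<and> \<zero>\<^bsub>F\<^esub> = \<zero>\<^bsub>G\<^esub> \<and> \<one>\<^bsub>F\<^esub> = \<one>\<^bsub>G\<^esub> \<and>
     (\<forall>a\<in>carrier F. \<forall>b\<in>carrier F.
        a \<oplus>\<^bsub>F\<^esub> b = a \<oplus>\<^bsub>G\<^esub> b \<and> a \<otimes>\<^bsub>F\<^esub> b = a \<otimes>\<^bsub>G\<^esub> b)"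


section \<open>Projective groups over a commutative field\<close>

text \<open>
  \<open>proj_point K x y\<close> is the point of the projective line with homogeneous coordinates
  \<open>(x : y) \<noteq> (0 : 0)\<close>, under the identification of \<open>(x : 1)\<close> with \<open>x\<close> and of \<open>(1 : 0)\<close> with
  \<open>\<infinity>\<close>. \<open>semilinear_induced K \<alpha> a b c d\<close> is the map induced on points by the semilinear map
  \<open>(x, y) \<mapsto> (a x\<^bsup>\<alpha>\<^esup> + b y\<^bsup>\<alpha>\<^esup>, c x\<^bsup>\<alpha>\<^esup> + d y\<^bsup>\<alpha>\<^esup>)\<close>, computed on the representatives \<open>(1, 0)\<close> and
  \<open>(x, 1)\<close>.
\<close>

definition proj_point :: "('a, 'm) ring_scheme \<Rightarrow> 'a \<Rightarrow> 'a \<Rightarrow> 'a option" where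
  "proj_point K x y = (if y = \<zero>\<^bsub>K\<^esub> then None else Some (x \<otimes>\<^bsub>K\<^esub> inv\<^bsub>K\<^esub> y))"

definition semilinear_induced ::
  "('a, 'm) ring_scheme \<Rightarrow> ('a \<Rightarrow> 'a) \<Rightarrow> 'a \<Rightarrow> 'a \<Rightarrow> 'a \<Rightarrow> 'a \<Rightarrow> 'a option \<Rightarrow> 'a option" where
  "semilinear_induced K \<alpha> a b c d = (\<lambda>p\<in>proj_points K. case p of
      None \<Rightarrow> proj_point K a c
    | Some x \<Rightarrow> proj_point K (a \<otimes>\<^bsub>K\<^esub> \<alpha> x \<oplus>\<^bsub>K\<^esub> b) (c \<otimes>\<^bsub>K\<^esub> \<alpha> x \<oplus>\<^bsub>K\<^esub> d))"

definition PSL2 :: "('a, 'm) ring_scheme \<Rightarrow> ('a option \<Rightarrow> 'a option) set" where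
  "PSL2 K = {semilinear_induced K (\<lambda>x. x) a b c d | a b c d.
     {a, b, c, d} \<subseteq> carrier K \<and> a \<otimes>\<^bsub>K\<^esub> d \<ominus>\<^bsub>K\<^esub> b \<otimes>\<^bsub>K\<^esub> c = \<one>\<^bsub>K\<^esub>}"

definition PGammaL2 :: "('a, 'm) ring_scheme \<Rightarrow> ('a option \<Rightarrow> 'a option) set" where
  "PGammaL2 K = {semilinear_induced K \<alpha> a b c d | \<alpha> a b c d.
     \<alpha> \<in> ring_iso K K \<and> {a, b, c, d} \<subseteq> carrier K \<and>
     a \<otimes>\<^bsub>K\<^esub> d \<ominus>\<^bsub>K\<^esub> b \<otimes>\<^bsub>K\<^esub> c \<noteq> \<zero>\<^bsub>K\<^esub>}"

definition perm_subgroup_of ::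
  "('a, 'm) ring_scheme \<Rightarrow> ('a option \<Rightarrow> 'a option) set \<Rightarrow> ('a option \<Rightarrow> 'a option) set \<Rightarrow> bool" where
  "perm_subgroup_of F H G \<longleftrightarrow>
     subgroup H (BijGroup (proj_points F)) \<and> subgroup G (BijGroup (proj_points F)) \<and> H \<subseteq> G"

end

theory Submission
  imports Defs
begin

text \<open>
  Let \<open>Q x = (x\<^sup>\<sigma>)\<^sup>-\<^sup>1 x\<close>; if \<open>F\<close> is coupled to a field and \<open>\<sigma>\<close> is the inversion of that field,
  then \<open>z Q(x)\<close> is the field product \<open>x\<^sup>2 z\<close>. The identity for \<open>\<sigma>\<close> gives
  \<open>x\<^sup>\<sigma> Q(c + x) = x\<^sup>\<sigma> Q(c) + 2c + x\<close>, which makes the second differences of \<open>Q\<close> in the directions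
  \<open>x, y\<close> constant if \<open>y\<close> is a kernel multiple of \<open>x\<^sup>\<sigma>\<close> or if \<open>x\<close> lies in the kernel. The heart of the
  proof is the case \<open>y = x\<close>, the parallelogram law. If the kernel is infinite, a linear relation
  between the elements \<open>(x + t)\<^sup>\<sigma>\<close>, with \<open>t\<close> in the kernel, shows that they span \<open>1\<close> and \<open>x\<close>. If the
  kernel is finite, so is \<open>F\<close>; higher differences of \<open>Q\<close> then vanish eventually, and the order is
  lowered step by step, since a biadditive \<open>\<gamma>\<close> that vanishes on all pairs \<open>(x, x\<^sup>\<sigma>)\<close> satisfies
  \<open>\<gamma>(x, 1) = \<gamma>(1, x)\<close> and \<open>\<gamma>(x, x) = \<gamma>(Q x, 1)\<close>.

  Now \<open>z Q(x)\<close> is quadratic in \<open>x\<close>, with a triadditive polar form \<open>P(x, y, z)\<close>. Put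
  \<open>x \<star> y = P(x, y, 1) / 2\<close>. The same two arguments show \<open>P(x, y, 1) = P(1, x, y)\<close>. Thus
  \<open>(x\<^sup>\<sigma> \<star> y\<^sup>\<sigma>) Q(x) Q(y) = x \<star> y\<close>, whose symmetry makes all \<open>Q x\<close> commute, so \<open>\<star>\<close> is the
  multiplication of a field with inversion \<open>\<sigma>\<close>. Polarising \<open>Q(x c) = (c\<^sup>\<sigma>)\<^sup>-\<^sup>1 Q(x) c\<close> shows that
  \<open>x \<mapsto> (x c) \<star> c\<^sup>\<sigma>\<close> is an automorphism of this field. On the projective line, \<open>\<tau>\<close> is \<open>x \<mapsto> -1/x\<close>.
\<close>

section \<open>Nearfields with 2 nonzero\<close>

text \<open>As long as the field is unknown, the additive maps at hand are the right multiplications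
  and the left multiplications by kernel elements. Only the right multiplications by elements
  \<open>Q x\<close> are known in advance as future multiplications of the field, so its identities
  must be phrased through squares and \<open>I\<close>. In the final field \<open>P x y z\<close> is
  2xyz. Its symmetry in x and y is built in, but z is the element on which right multiplications
  act; moving an argument across this divide is the task of \<open>P_one_swap\<close>, and
  associativity depends on it. For an infinite kernel, finite dimension provides linear relations,
  because there are more elements \<open>I (e \<oplus> t)\<close> than the dimension. A finite
  kernel may be too small for that, which forces the second, periodic argument. In
  \<open>P_one_swap\<close> the relation needed at a scalar t is that P(c, t, z) is t P(c, 1, z),
  which is not known for all t in the kernel. The deviation is a derivation in t, and derivations
  have enough zeros for the argument to go through.\<close>

locale odd_nearfield = nearfield +
  assumes two_neq_zero: "\<one> \<oplus> \<one> \<noteq> \<zero>"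
begin

sublocale agr: group "add_monoid F"
  rewrites "carrier (add_monoid F) = carrier F"
    and "monoid.mult (add_monoid F) = ring.add F"
    and "monoid.one (add_monoid F) = ring.zero F"
    and "m_inv (add_monoid F) = a_inv F"
  by (rule add_group) (auto simp: m_inv_def a_inv_def)

sublocale mgr: group "mult_of F"
  rewrites "monoid.mult (mult_of F) = monoid.mult F" and "monoid.one (mult_of F) = monoid.one F"
  by (rule mult_group) simp_all

lemma one_carrier [simp]: "\<one> \<in> carrier F"
  using mgr.one_closed by simp

lemma zero_mult [simp]: "a \<in> carrier F \<Longrightarrow> \<zero> \<otimes> a = \<zero>"
  using right_distrib[of \<zero> \<zero> a] mult_closed[of \<zero> a] agr.l_cancel_one agr.one_closed agr.l_one by metis

lemma minus_mult: "a \<in> carrier F \<Longrightarrow> b \<in> carrier F \<Longrightarrow> (\<ominus> a) \<otimes> b = \<ominus> (a \<otimes> b)"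
  using right_distrib[of "\<ominus> a" a b] agr.l_inv[of a] zero_mult[of b] mult_closed agr.inv_closed agr.inv_equality
  by metis

lemma mult_nonzero: "a \<in> carrier F \<Longrightarrow> b \<in> carrier F \<Longrightarrow> a \<noteq> \<zero> \<Longrightarrow> b \<noteq> \<zero> \<Longrightarrow> a \<otimes> b \<noteq> \<zero>"
  using mgr.m_closed by auto

sublocale monoid F
proof
  show "x \<otimes> y \<otimes> z = x \<otimes> (y \<otimes> z)" if "x \<in> carrier F" "y \<in> carrier F" "z \<in> carrier F" for x y z
    using that mgr.m_assoc[of x y z] mult_closed mult_zero zero_mult
    by (cases "x = \<zero> \<or> y = \<zero> \<or> z = \<zero>") auto
  show "\<one> \<otimes> x = x" if "x \<in> carrier F" for x
    using that mgr.l_one[of x] mult_zero[of \<one>] by (cases "x = \<zero>") auto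
  show "x \<otimes> \<one> = x" if "x \<in> carrier F" for x
    using that mgr.r_one[of x] by (cases "x = \<zero>") auto
qed (auto intro: mult_closed)

text \<open>Right multiplication by -1 is an involutory automorphism of the additive group. It has
  no nonzero fixed point, since cancelling one on the left would give -1 = 1. As doubling is
  bijective, such an automorphism is inversion. The order of summands matters here, because
  commutativity is only derived from this lemma.\<close>

lemma mult_minus_one:
  assumes g: "g \<in> carrier F"
  shows "g \<otimes> (\<ominus> \<one>) = \<ominus> g"
proof -
  define e where "e = \<ominus> \<one>"
  have eV: "e \<in> carrier F" by (simp add: e_def)
  have ee: "e \<otimes> e = \<one>" using minus_mult[of \<one> e] eV by (simp add: e_def)
  have e1: "e \<noteq> \<one>"
    using two_neq_zero agr.r_inv[of \<one>] one_carrier unfolding e_def by metis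
  have e0: "e \<noteq> \<zero>" using ee eV zero_not_one by auto
  define h where "h = inv\<^bsub>mult_of F\<^esub> (\<one> \<oplus> \<one>)"
  have hV: "h \<in> carrier F" using mgr.inv_closed[of "\<one> \<oplus> \<one>"] two_neq_zero by (auto simp: h_def)
  have h2: "(\<one> \<oplus> \<one>) \<otimes> h = \<one>" "h \<otimes> (\<one> \<oplus> \<one>) = \<one>"
    using mgr.r_inv[of "\<one> \<oplus> \<one>"] mgr.l_inv[of "\<one> \<oplus> \<one>"] two_neq_zero by (auto simp: h_def)
  \<comment> \<open>By right distributivity, doubling is left multiplication by 1 + 1, hence
    invertible.\<close>
  have dbl: "(\<one> \<oplus> \<one>) \<otimes> a = a \<oplus> a" if "a \<in> carrier F" for a
    using right_distrib[of \<one> \<one> a] that by simp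
  have half: "\<exists>t\<in>carrier F. t \<oplus> t = s" if "s \<in> carrier F" for s
  proof
    have "(\<one> \<oplus> \<one>) \<otimes> (h \<otimes> s) = s" using m_assoc[of "\<one> \<oplus> \<one>" h s] that hV h2 by simp
    then show "h \<otimes> s \<oplus> h \<otimes> s = s" using dbl[of "h \<otimes> s"] that hV by simp
    show "h \<otimes> s \<in> carrier F" using that hV by simp
  qed
  have dinj: "s = t" if "s \<in> carrier F" "t \<in> carrier F" "s \<oplus> s = t \<oplus> t" for s t
  proof -
    have "h \<otimes> ((\<one> \<oplus> \<one>) \<otimes> s) = h \<otimes> ((\<one> \<oplus> \<one>) \<otimes> t)" using dbl that by simp
    then show ?thesis using m_assoc[of h "\<one> \<oplus> \<one>" s] m_assoc[of h "\<one> \<oplus> \<one>" t] that hV h2 by simp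
  qed
    \<comment> \<open>\<open>s\<close> measures how far \<open>g \<otimes> e\<close> is from g;
      adding its half \<open>t\<close> to g produces a fixed point.\<close>
    define s where "s = \<ominus> g \<oplus> g \<otimes> e"
    have sV: "s \<in> carrier F" using g eV by (simp add: s_def)
    have gee: "(g \<otimes> e) \<otimes> e = g" using g eV ee by (simp add: m_assoc)
    have se: "s \<otimes> e = \<ominus> s"
      using g eV gee by (simp add: s_def right_distrib minus_mult agr.inv_mult_group)
    obtain t where t: "t \<in> carrier F" "t \<oplus> t = s" using half sV by blast
    have te: "t \<otimes> e = \<ominus> t"
    proof (rule dinj)
      show "t \<otimes> e \<oplus> t \<otimes> e = \<ominus> t \<oplus> \<ominus> t"
        using se t eV by (metis right_distrib agr.inv_mult_group)
    qed (use t eV in auto)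
    have "(g \<oplus> t) \<otimes> e = g \<otimes> e \<oplus> \<ominus> t" using g t eV te by (simp add: right_distrib)
    also have "g \<otimes> e = g \<oplus> s" using g eV by (simp add: s_def agr.m_assoc[symmetric] agr.r_inv)
    also have "g \<oplus> s \<oplus> \<ominus> t = g \<oplus> t" using g t by (simp flip: t(2) add: agr.m_assoc agr.r_inv)
    finally have fx: "(g \<oplus> t) \<otimes> e = g \<oplus> t" .
    have "g \<oplus> t = \<zero>"
    proof (rule ccontr)
      assume n: "g \<oplus> t \<noteq> \<zero>"
      have "(g \<oplus> t) \<otimes> e = (g \<oplus> t) \<otimes> \<one>" using fx g t by simp
      then have "e = \<one>" using mgr.l_cancel[of "g \<oplus> t" e \<one>] n g t eV e0 zero_not_one by auto
      then show False using e1 by simp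
    qed
    then have "g = \<ominus> t" using agr.inv_equality[of g t] g t by simp
    then show ?thesis using te t eV by (simp add: minus_mult flip: e_def)
qed

text \<open>Inversion is a right multiplication, hence a homomorphism, which forces the additive
  group to be abelian.\<close>

lemma add_commutes:
  assumes x: "x \<in> carrier F" and y: "y \<in> carrier F"
  shows "x \<oplus> y = y \<oplus> x"
proof -
  have "\<ominus> (x \<oplus> y) = \<ominus> x \<oplus> \<ominus> y"
    using right_distrib[of x y "\<ominus> \<one>"] x y by (simp add: mult_minus_one)
  then show ?thesis using x y agr.inv_mult_group[of y x] by (metis agr.inv_closed agr.inv_inv agr.m_closed)
qed

sublocale abelian_group F
proof (rule comm_group_abelian_groupI)
  show "comm_group (add_monoid F)"
    by (rule group.group_comm_groupI[OF add_group]) (simp add: add_commutes)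
qed


lemma mult_eq_zero_iff [simp]: "a \<in> carrier F \<Longrightarrow> b \<in> carrier F \<Longrightarrow> a \<otimes> b = \<zero> \<longleftrightarrow> a = \<zero> \<or> b = \<zero>"
  using mult_nonzero mult_zero zero_mult by blast

lemma mult_minus: "a \<in> carrier F \<Longrightarrow> b \<in> carrier F \<Longrightarrow> a \<otimes> (\<ominus> b) = \<ominus> (a \<otimes> b)"
  using m_assoc[of a b "\<ominus> \<one>"] by (simp add: mult_minus_one)

lemma add_minus_simps:
  "x \<in> carrier F \<Longrightarrow> y \<in> carrier F \<Longrightarrow> z \<in> carrier F \<Longrightarrow> x \<oplus> (y \<ominus> z) = (x \<oplus> y) \<ominus> z"
  "x \<in> carrier F \<Longrightarrow> y \<in> carrier F \<Longrightarrow> z \<in> carrier F \<Longrightarrow> (x \<ominus> y) \<oplus> z = (x \<oplus> z) \<ominus> y"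
  "x \<in> carrier F \<Longrightarrow> y \<in> carrier F \<Longrightarrow> z \<in> carrier F \<Longrightarrow> (x \<ominus> y) \<ominus> z = x \<ominus> (y \<oplus> z)"
  "x \<in> carrier F \<Longrightarrow> y \<in> carrier F \<Longrightarrow> z \<in> carrier F \<Longrightarrow> x \<ominus> (y \<ominus> z) = (x \<oplus> z) \<ominus> y"
  "x \<in> carrier F \<Longrightarrow> y \<in> carrier F \<Longrightarrow> \<ominus> x \<oplus> y = y \<ominus> x"
  "x \<in> carrier F \<Longrightarrow> y \<in> carrier F \<Longrightarrow> x \<oplus> \<ominus> y = x \<ominus> y"
  "x \<in> carrier F \<Longrightarrow> y \<in> carrier F \<Longrightarrow> x \<ominus> (\<ominus> y) = x \<oplus> y"
  "x \<in> carrier F \<Longrightarrow> y \<in> carrier F \<Longrightarrow> \<ominus> (x \<oplus> y) = \<ominus> x \<ominus> y"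
  "x \<in> carrier F \<Longrightarrow> y \<in> carrier F \<Longrightarrow> \<ominus> (x \<ominus> y) = y \<ominus> x"
  "x \<in> carrier F \<Longrightarrow> x \<ominus> \<zero> = x" "x \<in> carrier F \<Longrightarrow> \<zero> \<ominus> x = \<ominus> x" "x \<in> carrier F \<Longrightarrow> x \<ominus> x = \<zero>"
  by (simp_all add: a_minus_def a_ac minus_add r_neg r_neg1 r_neg2)

lemma add_minus_eq_simps:
  "x \<in> carrier F \<Longrightarrow> y \<in> carrier F \<Longrightarrow> z \<in> carrier F \<Longrightarrow> x \<ominus> y = z \<longleftrightarrow> x = z \<oplus> y"
  "x \<in> carrier F \<Longrightarrow> y \<in> carrier F \<Longrightarrow> z \<in> carrier F \<Longrightarrow> z = x \<ominus> y \<longleftrightarrow> z \<oplus> y = x"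
  "x \<in> carrier F \<Longrightarrow> y \<in> carrier F \<Longrightarrow> \<ominus> x = y \<longleftrightarrow> \<zero> = x \<oplus> y"
  "x \<in> carrier F \<Longrightarrow> y \<in> carrier F \<Longrightarrow> y = \<ominus> x \<longleftrightarrow> x \<oplus> y = \<zero>"
  by (simp add: a_minus_def agr.inv_solve_right')
    (metis a_minus_def agr.inv_solve_right,
     metis a_comm l_neg minus_equality r_neg minus_minus a_inv_closed, metis a_comm l_neg minus_equality r_neg minus_minus a_inv_closed)

text \<open>Turns an equation into one between sums without subtraction, which associativity and
  commutativity decide.\<close>

lemmas ag_simps = add_minus_simps add_minus_eq_simps a_ac

declare mult_zero [simp]

lemma minus_right_distrib: "a \<in> carrier F \<Longrightarrow> b \<in> carrier F \<Longrightarrow> c \<in> carrier F \<Longrightarrow> (a \<ominus> b) \<otimes> c = a \<otimes> c \<ominus> b \<otimes> c"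
  by (simp add: a_minus_def right_distrib minus_mult)

lemmas distribs = right_distrib minus_right_distrib minus_mult mult_minus

end

section \<open>Hua identities\<close>

locale odd_KT_nearfield = KT_nearfield + odd_nearfield
begin

text \<open>\<open>I\<close> and \<open>J\<close> are made total by sending 0 to 0, so that
  \<open>I_mult\<close> and \<open>J_mult\<close> need no side conditions.\<close>

definition I :: "'a \<Rightarrow> 'a" where "I x = (if x = \<zero> then \<zero> else \<sigma> x)"
definition J :: "'a \<Rightarrow> 'a" where "J x = (if x = \<zero> then \<zero> else inv\<^bsub>mult_of F\<^esub> x)"
definition Q :: "'a \<Rightarrow> 'a" where "Q x = J (I x) \<otimes> x"

lemma I_zero [simp]: "I \<zero> = \<zero>" by (simp add: I_def)
lemma J_zero [simp]: "J \<zero> = \<zero>" by (simp add: J_def)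
lemma Q_zero [simp]: "Q \<zero> = \<zero>" by (simp add: Q_def)

lemma sigma_closed: "x \<in> carrier F \<Longrightarrow> x \<noteq> \<zero> \<Longrightarrow> \<sigma> x \<in> carrier F \<and> \<sigma> x \<noteq> \<zero>"
  using automorphism by (auto simp: iso_def hom_def)

lemma I_closed [simp]: "x \<in> carrier F \<Longrightarrow> I x \<in> carrier F"
  by (simp add: I_def sigma_closed)

lemma I_eq_zero_iff [simp]: "x \<in> carrier F \<Longrightarrow> I x = \<zero> \<longleftrightarrow> x = \<zero>"
  by (simp add: I_def sigma_closed)

lemma I_I [simp]: "x \<in> carrier F \<Longrightarrow> I (I x) = x"
  using involutory sigma_closed by (auto simp: I_def)

lemma I_mult: "x \<in> carrier F \<Longrightarrow> y \<in> carrier F \<Longrightarrow> I (x \<otimes> y) = I x \<otimes> I y"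
  using automorphism mult_nonzero[of x y] sigma_closed[of x] sigma_closed[of y] by (auto simp: I_def iso_def hom_def)

lemma J_closed [simp]: "x \<in> carrier F \<Longrightarrow> J x \<in> carrier F"
  using mgr.inv_closed[of x] by (simp add: J_def)

lemma J_l: "x \<in> carrier F \<Longrightarrow> x \<noteq> \<zero> \<Longrightarrow> J x \<otimes> x = \<one>"
  using mgr.l_inv[of x] by (simp add: J_def)

lemma J_r: "x \<in> carrier F \<Longrightarrow> x \<noteq> \<zero> \<Longrightarrow> x \<otimes> J x = \<one>"
  using mgr.r_inv[of x] by (simp add: J_def)

lemma J_eq_zero_iff [simp]: "x \<in> carrier F \<Longrightarrow> J x = \<zero> \<longleftrightarrow> x = \<zero>"
  using mgr.inv_closed[of x] by (auto simp: J_def)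

lemma J_l2: "x \<in> carrier F \<Longrightarrow> x \<noteq> \<zero> \<Longrightarrow> y \<in> carrier F \<Longrightarrow> J x \<otimes> (x \<otimes> y) = y"
  using m_assoc[of "J x" x y] by (simp add: J_l)

lemma J_r2: "x \<in> carrier F \<Longrightarrow> x \<noteq> \<zero> \<Longrightarrow> y \<in> carrier F \<Longrightarrow> x \<otimes> (J x \<otimes> y) = y"
  using m_assoc[of x "J x" y] by (simp add: J_r)

lemmas J_simps = J_l J_r J_l2 J_r2

lemma mult_right_cancel: "x \<in> carrier F \<Longrightarrow> y \<in> carrier F \<Longrightarrow> z \<in> carrier F \<Longrightarrow> z \<noteq> \<zero> \<Longrightarrow> x \<otimes> z = y \<otimes> z \<longleftrightarrow> x = y"
  by (metis J_closed J_r m_assoc r_one)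

lemma mult_left_cancel: "x \<in> carrier F \<Longrightarrow> y \<in> carrier F \<Longrightarrow> z \<in> carrier F \<Longrightarrow> z \<noteq> \<zero> \<Longrightarrow> z \<otimes> x = z \<otimes> y \<longleftrightarrow> x = y"
  by (metis J_l2)

lemma J_unique: "x \<in> carrier F \<Longrightarrow> y \<in> carrier F \<Longrightarrow> x \<otimes> y = \<one> \<Longrightarrow> J x = y"
  by (metis J_closed J_l2 mult_zero r_one zero_mult zero_not_one)

lemma J_J [simp]: "x \<in> carrier F \<Longrightarrow> J (J x) = x"
  by (cases "x = \<zero>") (auto intro!: J_unique simp: J_l)

lemma one_neq_zero [simp]: "\<one> \<noteq> \<zero>" using zero_not_one by simp

lemma J_one [simp]: "J \<one> = \<one>" by (rule J_unique) simp_all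

lemma J_mult:
  assumes "x \<in> carrier F" "y \<in> carrier F"
  shows "J (x \<otimes> y) = J y \<otimes> J x"
proof (cases "x = \<zero> \<or> y = \<zero>")
  case True
  then show ?thesis using assms by auto
next
  case False
  then show ?thesis using assms
    by (auto intro!: J_unique simp: m_assoc J_simps)
qed

lemma I_one [simp]: "I \<one> = \<one>"
  by (metis I_closed I_eq_zero_iff I_mult l_one mult_right_cancel one_carrier one_neq_zero)

lemma I_J: "x \<in> carrier F \<Longrightarrow> I (J x) = J (I x)"
  by (cases "x = \<zero>") (auto intro!: J_unique[symmetric] simp: J_simps simp flip: I_mult)

text \<open>Right distributivity gives (1 + x) x = x + 1 = (1 + x) 1, and 1 + x can be cancelled
  unless it is 0.\<close>

lemma square_one: "x \<in> carrier F \<Longrightarrow> x \<otimes> x = \<one> \<Longrightarrow> x = \<one> \<or> x = \<ominus> \<one>"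
proof -
  assume x: "x \<in> carrier F" "x \<otimes> x = \<one>"
  have "(\<one> \<oplus> x) \<otimes> x = (\<one> \<oplus> x) \<otimes> \<one>" using x by (simp add: right_distrib a_comm)
  then have "x = \<one> \<or> \<one> \<oplus> x = \<zero>" using x mult_left_cancel[of x \<one> "\<one> \<oplus> x"] by auto
  then show ?thesis using x by (auto simp: ag_simps)
qed

lemma minus_one_neq_one: "\<ominus> \<one> \<noteq> \<one>"
  using two_neq_zero by (auto simp: ag_simps)

lemma I_minus_one: "I (\<ominus> \<one>) = \<ominus> \<one>"
proof -
  have "I (\<ominus> \<one>) \<otimes> I (\<ominus> \<one>) = \<one>" by (simp add: mult_minus minus_mult flip: I_mult)
  moreover have "I (\<ominus> \<one>) \<noteq> \<one>" using minus_one_neq_one by (metis I_I I_one a_inv_closed one_carrier)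
  ultimately show ?thesis using square_one[of "I (\<ominus> \<one>)"] by simp
qed

lemma I_minus: "x \<in> carrier F \<Longrightarrow> I (\<ominus> x) = \<ominus> I x"
  using I_mult[of "\<ominus> \<one>" x] by (simp add: I_minus_one minus_mult)

lemma J_minus: "x \<in> carrier F \<Longrightarrow> J (\<ominus> x) = \<ominus> J x"
  by (cases "x = \<zero>") (auto intro!: J_unique simp: minus_mult mult_minus J_r)

lemma double_cancel: "x \<in> carrier F \<Longrightarrow> x \<oplus> x = \<zero> \<Longrightarrow> x = \<zero>"
  using right_distrib[of \<one> \<one> x] mult_eq_zero_iff[of "\<one> \<oplus> \<one>" x] two_neq_zero by simp

lemma double_inj: "x \<in> carrier F \<Longrightarrow> y \<in> carrier F \<Longrightarrow> x \<oplus> x = y \<oplus> y \<Longrightarrow> x = y"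
  using double_cancel[of "x \<ominus> y"] by (simp add: ag_simps)

lemma KT: "a \<in> carrier F \<Longrightarrow> a \<noteq> \<zero> \<Longrightarrow> \<one> \<oplus> a \<noteq> \<zero> \<Longrightarrow> I (\<one> \<oplus> I a) = \<one> \<ominus> I (\<one> \<oplus> a)"
proof -
  assume a: "a \<in> carrier F" "a \<noteq> \<zero>" "\<one> \<oplus> a \<noteq> \<zero>"
  then have "a \<noteq> \<ominus> \<one>" by (auto simp: r_neg)
  moreover have "\<one> \<oplus> I a \<noteq> \<zero>"
  proof
    assume "\<one> \<oplus> I a = \<zero>"
    then have "I a = \<ominus> \<one>" using a by (simp add: ag_simps)
    then have "a = \<ominus> \<one>" using a I_I I_minus_one by metis
    then show False using \<open>a \<noteq> \<ominus> \<one>\<close> by simp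
  qed
  ultimately show ?thesis using a KT_identity[of a] by (simp add: I_def)
qed

lemma Q_closed [simp]: "x \<in> carrier F \<Longrightarrow> Q x \<in> carrier F" by (simp add: Q_def)
lemma Q_eq_zero_iff [simp]: "x \<in> carrier F \<Longrightarrow> Q x = \<zero> \<longleftrightarrow> x = \<zero>" by (simp add: Q_def)
lemma Q_one [simp]: "Q \<one> = \<one>" by (simp add: Q_def)
lemma Q_minus: "x \<in> carrier F \<Longrightarrow> Q (\<ominus> x) = Q x"
  by (simp add: Q_def I_minus J_minus minus_mult mult_minus)
lemma Q_mult: "x \<in> carrier F \<Longrightarrow> c \<in> carrier F \<Longrightarrow> Q (x \<otimes> c) = J (I c) \<otimes> (Q x \<otimes> c)"
  by (simp add: Q_def I_mult J_mult m_assoc)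
lemma I_mult_Q: "x \<in> carrier F \<Longrightarrow> I x \<otimes> Q x = x"
  by (cases "x = \<zero>") (simp_all add: Q_def J_r2)
lemma mult_Q_I: "x \<in> carrier F \<Longrightarrow> x \<otimes> Q (I x) = I x"
  using I_mult_Q[of "I x"] by simp
lemma I_Q: "x \<in> carrier F \<Longrightarrow> I (Q x) = J (Q x)"
  by (simp add: Q_def I_mult J_mult I_J)
lemma Q_I: "x \<in> carrier F \<Longrightarrow> Q (I x) = J (Q x)"
  by (simp add: Q_def J_mult I_J)
lemma Q_l: "x \<in> carrier F \<Longrightarrow> x \<noteq> \<zero> \<Longrightarrow> Q x \<otimes> Q (I x) = \<one>"
  by (simp add: Q_I J_simps)
lemma Q_r: "x \<in> carrier F \<Longrightarrow> x \<noteq> \<zero> \<Longrightarrow> Q (I x) \<otimes> Q x = \<one>"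
  by (simp add: Q_I J_simps)
lemma Q_l2: "x \<in> carrier F \<Longrightarrow> x \<noteq> \<zero> \<Longrightarrow> y \<in> carrier F \<Longrightarrow> y \<otimes> Q x \<otimes> Q (I x) = y"
  by (simp add: m_assoc Q_l)
lemma Q_r2: "x \<in> carrier F \<Longrightarrow> x \<noteq> \<zero> \<Longrightarrow> y \<in> carrier F \<Longrightarrow> y \<otimes> Q (I x) \<otimes> Q x = y"
  by (simp add: m_assoc Q_r)

text \<open>The homogeneous form of \<open>KT\<close>: take a = (c b^-1)^\<sigma> and multiply on
  the right by b^\<sigma>.\<close>

lemma Hua:
  assumes b: "b \<in> carrier F" "b \<noteq> \<zero>" and c: "c \<in> carrier F" "c \<noteq> \<zero>" and bc: "b \<oplus> c \<noteq> \<zero>"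
  shows "I (b \<oplus> c) = I b \<ominus> I (I b \<oplus> I c) \<otimes> Q (I b)"
proof -
  define a where "a = I (c \<otimes> J b)"
  have a: "a \<in> carrier F" "a \<noteq> \<zero>" "I a = c \<otimes> J b" using b c by (simp_all add: a_def)
  have e: "(\<one> \<oplus> I a) \<otimes> b = b \<oplus> c" using a b c by (simp add: right_distrib m_assoc J_l)
  have n: "\<one> \<oplus> I a \<noteq> \<zero>" using e bc b zero_mult by metis
  have n2: "\<one> \<oplus> a \<noteq> \<zero>"
  proof
    assume "\<one> \<oplus> a = \<zero>"
    then have "a = \<ominus> \<one>" using a by (simp add: ag_simps)
    then have "I a = \<ominus> \<one>" by (simp add: I_minus_one)
    then show False using n by (simp add: r_neg)
  qed
  have "(\<one> \<oplus> a) \<otimes> I b = I b \<oplus> I c"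
    using a b c by (simp add: right_distrib a_def I_mult I_J m_assoc J_l)
  then have "I (\<one> \<oplus> a) \<otimes> b = I (I b \<oplus> I c)" using a b by (metis I_mult I_I I_closed a_closed one_carrier)
  then have f: "I (\<one> \<oplus> a) = I (I b \<oplus> I c) \<otimes> J b"
    using a b c by (metis J_closed J_r m_assoc r_one I_closed a_closed one_carrier)
  have "I (b \<oplus> c) = I (\<one> \<oplus> I a) \<otimes> I b" using e a b by (metis I_mult I_closed a_closed one_carrier)
  also have "\<dots> = (\<one> \<ominus> I (\<one> \<oplus> a)) \<otimes> I b" using KT[OF a(1,2) n2] by simp
  also have "\<dots> = I b \<ominus> I (\<one> \<oplus> a) \<otimes> I b" using a b by (simp add: distribs)
  also have "I (\<one> \<oplus> a) \<otimes> I b = I (I b \<oplus> I c) \<otimes> Q (I b)"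
    using f b c by (simp add: Q_def m_assoc)
  finally show ?thesis .
qed

lemma I_add_eq_zero: "b \<in> carrier F \<Longrightarrow> c \<in> carrier F \<Longrightarrow> I b \<oplus> I c = \<zero> \<longleftrightarrow> b \<oplus> c = \<zero>"
proof -
  have *: "I b \<oplus> I c = \<zero>" if "b \<in> carrier F" "c \<in> carrier F" "b \<oplus> c = \<zero>" for b c
  proof -
    have "b = \<ominus> c" using that by (simp add: ag_simps)
    then show ?thesis using that by (simp add: I_minus l_neg)
  qed
  show "b \<in> carrier F \<Longrightarrow> c \<in> carrier F \<Longrightarrow> I b \<oplus> I c = \<zero> \<longleftrightarrow> b \<oplus> c = \<zero>"
    using *[of b c] *[of "I b" "I c"] by auto
qed

text \<open>If \<open>I\<close> is inversion in a field, this is Hua's identity for b x^-1 b. It is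
  \<open>Hua\<close> applied to b^\<sigma> and (x - b)^\<sigma>.\<close>

lemma Hua_operator:
  assumes b: "b \<in> carrier F" "b \<noteq> \<zero>" and x: "x \<in> carrier F" "x \<noteq> \<zero>" and xb: "x \<noteq> b"
  shows "I x \<otimes> Q b = b \<ominus> I (I b \<oplus> I (x \<ominus> b))"
proof -
  define c where "c = I (x \<ominus> b)"
  have d: "x \<ominus> b \<in> carrier F" "x \<ominus> b \<noteq> \<zero>" using b x xb by (auto simp: ag_simps)
  have c: "c \<in> carrier F" "c \<noteq> \<zero>" "I c = x \<ominus> b" using d by (auto simp: c_def)
  have s: "b \<oplus> (x \<ominus> b) = x" using b x by (simp add: ag_simps)
  have "I b \<oplus> c \<noteq> \<zero>" using I_add_eq_zero[of b "x \<ominus> b"] b x d s by (simp add: c_def)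
  then have "I (I b \<oplus> c) = b \<ominus> I (b \<oplus> I c) \<otimes> Q b"
    using Hua[of "I b" c] b c by simp
  then have "I (I b \<oplus> c) = b \<ominus> I x \<otimes> Q b" using c s by simp
  then show ?thesis using b x c by (simp add: c_def ag_simps)
qed

text \<open>In \<open>Hua_operator\<close> the term
  \<open>I (I b \<oplus> I (x \<ominus> b))\<close> is unchanged when b is replaced by x - b.
  Subtracting the two instances eliminates it; then put b = -c.\<close>

lemma Q_add_main:
  assumes x: "x \<in> carrier F" "x \<noteq> \<zero>" and c: "c \<in> carrier F"
  shows "I x \<otimes> Q (c \<oplus> x) = I x \<otimes> Q c \<oplus> (c \<oplus> c) \<oplus> x"
proof -
  have *: "I x \<otimes> Q (x \<ominus> b) \<oplus> b \<oplus> b = I x \<otimes> Q b \<oplus> x" if b: "b \<in> carrier F" for b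
  proof (cases "b = \<zero> \<or> b = x")
    case True
    then show ?thesis using x by (auto simp: I_mult_Q ag_simps mult_zero)
  next
    case False
    have d: "x \<ominus> b \<in> carrier F" "x \<ominus> b \<noteq> \<zero>" "x \<noteq> x \<ominus> b" using b x False by (auto simp: ag_simps)
    define w where "w = I (I b \<oplus> I (x \<ominus> b))"
    have w: "w \<in> carrier F" using b x by (simp add: w_def)
    have s: "x \<ominus> (x \<ominus> b) = b" using b x by (simp add: ag_simps)
    have 1: "I x \<otimes> Q b = b \<ominus> w" using Hua_operator b x False by (auto simp: w_def)
    have 2: "I x \<otimes> Q (x \<ominus> b) = x \<ominus> b \<ominus> w"
      using Hua_operator[of "x \<ominus> b" x] x d b s by (simp add: w_def a_comm)
    show ?thesis unfolding 1 2 using b x w by (simp add: ag_simps)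
  qed
  have "x \<ominus> (\<ominus> c) = c \<oplus> x" using x c by (simp add: ag_simps)
  then show ?thesis using *[of "\<ominus> c"] x c by (simp add: Q_minus ag_simps)
qed

lemma Q_add_one: "c \<in> carrier F \<Longrightarrow> Q (c \<oplus> \<one>) = Q c \<oplus> (c \<oplus> c) \<oplus> \<one>"
  using Q_add_main[of \<one> c] by simp

text \<open>The counterpart of (x + y)^2 = y^2 (x^-1 + y^-1)^2 x^2. Applied in turn to
  \<open>I (x \<oplus> y)\<close>, the three factors lead to x + y, just as
  \<open>Q (x \<oplus> y)\<close> does, and the common left factor can be cancelled.\<close>

lemma Q_add_factor:
  assumes x: "x \<in> carrier F" "x \<noteq> \<zero>" and y: "y \<in> carrier F" "y \<noteq> \<zero>" and xy: "x \<oplus> y \<noteq> \<zero>"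
  shows "Q (x \<oplus> y) = Q y \<otimes> Q (I x \<oplus> I y) \<otimes> Q x"
proof -
  define w where "w = I x \<oplus> I y"
  have w: "w \<in> carrier F" "w \<noteq> \<zero>" using I_add_eq_zero[of x y] x y xy by (auto simp: w_def)
  have "I (y \<oplus> x) = I y \<ominus> I (I y \<oplus> I x) \<otimes> Q (I y)" using Hua[of y x] x y xy by (simp add: a_comm)
  then have "I (x \<oplus> y) = I y \<ominus> I w \<otimes> Q (I y)" using x y by (simp add: w_def a_comm)
  then have 1: "I (x \<oplus> y) \<otimes> Q y = y \<ominus> I w"
    using x y w by (simp add: distribs I_mult_Q Q_r2)
  have "y \<otimes> Q w = y \<otimes> Q (I x) \<oplus> (I x \<oplus> I x) \<oplus> I y"
    using Q_add_main[of "I y" "I x"] x y by (simp add: w_def)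
  then have 2: "(y \<ominus> I w) \<otimes> Q w = y \<otimes> Q (I x) \<oplus> I x"
    using x y w by (simp add: distribs I_mult_Q) (simp add: w_def ag_simps)
  have 3: "(y \<otimes> Q (I x) \<oplus> I x) \<otimes> Q x = x \<oplus> y"
    using x y by (simp add: distribs I_mult_Q Q_r2 a_comm)
  have "I (x \<oplus> y) \<otimes> Q (x \<oplus> y) = I (x \<oplus> y) \<otimes> (Q y \<otimes> Q w \<otimes> Q x)"
    using 1 2 3 x y w by (simp add: I_mult_Q m_assoc[symmetric])
  then show ?thesis using mult_left_cancel[of "Q (x \<oplus> y)" "Q y \<otimes> Q w \<otimes> Q x" "I (x \<oplus> y)"] x y w xy
    by (simp add: w_def)
qed

text \<open>Since \<open>Q \<one>\<close> is 1, \<open>Q_add_factor\<close> for y and 1 in both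
  orders puts the same factor \<open>w\<close> on either side of \<open>Q y\<close>.\<close>

lemma Q_commute_add_one:
  assumes y: "y \<in> carrier F"
  shows "Q y \<otimes> Q (y \<oplus> \<one>) = Q (y \<oplus> \<one>) \<otimes> Q y"
proof (cases "y = \<zero> \<or> y \<oplus> \<one> = \<zero>")
  case True
  then show ?thesis using y by (auto simp: mult_zero)
next
  case False
  define w where "w = Q (I y \<oplus> \<one>)"
  have w: "w \<in> carrier F" using y by (simp add: w_def)
  have "Q (y \<oplus> \<one>) = w \<otimes> Q y" using Q_add_factor[of y \<one>] y False by (simp add: w_def)
  moreover have "Q (y \<oplus> \<one>) = Q y \<otimes> w" using Q_add_factor[of \<one> y] y False by (simp add: w_def a_comm)
  ultimately show ?thesis using y w by (metis Q_closed m_assoc)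
qed

text \<open>Expanding Q(1 + x) along the increment x at 1 and along the increment 1 at x gives x Q(1
  + x) = Q(1 + x).\<close>

lemma I_fixed: assumes x: "x \<in> carrier F" "x \<noteq> \<zero>" "I x = x" shows "x = \<one> \<or> x = \<ominus> \<one>"
proof (cases "x \<oplus> \<one> = \<zero>")
  case True
  then show ?thesis using x by (simp add: ag_simps)
next
  case False
  have Qx: "Q x = \<one>" using x by (simp add: Q_def J_l)
  have "x \<otimes> Q (\<one> \<oplus> x) = x \<oplus> (\<one> \<oplus> \<one>) \<oplus> x" using Q_add_main[of x \<one>] x by simp
  moreover have "\<one> \<otimes> Q (\<one> \<oplus> x) = \<one> \<oplus> (x \<oplus> x) \<oplus> \<one>" using Q_add_one[of x] Qx x by (simp add: a_comm)
  ultimately have "x \<otimes> Q (\<one> \<oplus> x) = \<one> \<otimes> Q (\<one> \<oplus> x)" using x by (simp add: ag_simps)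
  then show ?thesis using mult_right_cancel[of x \<one> "Q (\<one> \<oplus> x)"] x False by (simp add: a_comm)
qed

text \<open>If \<open>Q x\<close> and \<open>Q y\<close> agree, then x y^-1 is fixed by
  \<open>I\<close>.\<close>

lemma Q_inj:
  assumes x: "x \<in> carrier F" and y: "y \<in> carrier F" and e: "Q x = Q y"
  shows "x = y \<or> x = \<ominus> y"
proof (cases "x = \<zero> \<or> y = \<zero>")
  case True
  then show ?thesis using e x y by (metis Q_eq_zero_iff zero_closed)
next
  case False
  have "x = I x \<otimes> (J (I y) \<otimes> y)" using I_mult_Q[of x] x y e by (simp add: Q_def)
  then have "x \<otimes> J y = I x \<otimes> (J (I y) \<otimes> y) \<otimes> J y" by simp
  also have "\<dots> = I (x \<otimes> J y)" using x y False by (simp add: m_assoc J_r I_mult I_J)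
  finally have "I (x \<otimes> J y) = x \<otimes> J y" by simp
  then have "x \<otimes> J y = \<one> \<or> x \<otimes> J y = \<ominus> \<one>" using I_fixed[of "x \<otimes> J y"] x y False by simp
  moreover have "x = (x \<otimes> J y) \<otimes> y" using x y False by (simp add: m_assoc J_l)
  ultimately show ?thesis using x y by (auto simp: minus_mult)
qed

section \<open>The kernel\<close>

abbreviation KK where "KK \<equiv> nearfield_kernel F"

lemma KK_carrier [simp]: "k \<in> KK \<Longrightarrow> k \<in> carrier F" by (simp add: nearfield_kernel_def)

lemma left_distrib: "k \<in> KK \<Longrightarrow> a \<in> carrier F \<Longrightarrow> b \<in> carrier F \<Longrightarrow> k \<otimes> (a \<oplus> b) = k \<otimes> a \<oplus> k \<otimes> b"
  unfolding nearfield_kernel_def by blast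

lemma left_distrib_minus: "k \<in> KK \<Longrightarrow> a \<in> carrier F \<Longrightarrow> b \<in> carrier F \<Longrightarrow> k \<otimes> (a \<ominus> b) = k \<otimes> a \<ominus> k \<otimes> b"
  by (simp add: a_minus_def left_distrib mult_minus)

lemma KK_I:
  "k \<in> carrier F \<Longrightarrow> (\<And>a b. a \<in> carrier F \<Longrightarrow> b \<in> carrier F \<Longrightarrow> k \<otimes> (a \<oplus> b) = k \<otimes> a \<oplus> k \<otimes> b) \<Longrightarrow> k \<in> KK"
  unfolding nearfield_kernel_def by blast

lemma KK_zero [simp]: "\<zero> \<in> KK" and KK_one [simp]: "\<one> \<in> KK"
  by (simp_all add: KK_I)

lemma KK_add [simp]: "k \<in> KK \<Longrightarrow> l \<in> KK \<Longrightarrow> k \<oplus> l \<in> KK"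
  by (rule KK_I) (simp_all add: right_distrib left_distrib a_ac)

lemma KK_uminus [simp]: "k \<in> KK \<Longrightarrow> \<ominus> k \<in> KK"
  by (rule KK_I) (simp_all add: minus_mult left_distrib minus_add)

lemma KK_minus [simp]: "k \<in> KK \<Longrightarrow> l \<in> KK \<Longrightarrow> k \<ominus> l \<in> KK"
  by (simp add: a_minus_def)

lemma KK_mult [simp]: "k \<in> KK \<Longrightarrow> l \<in> KK \<Longrightarrow> k \<otimes> l \<in> KK"
  by (rule KK_I) (simp_all add: m_assoc left_distrib)

lemma KK_J [simp]: "k \<in> KK \<Longrightarrow> J k \<in> KK"
proof (cases "k = \<zero>")
  case False
  assume k: "k \<in> KK"
  have "J k \<otimes> (a \<oplus> b) = J k \<otimes> a \<oplus> J k \<otimes> b" if "a \<in> carrier F" "b \<in> carrier F" for a b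
  proof -
    have "k \<otimes> (J k \<otimes> a \<oplus> J k \<otimes> b) = a \<oplus> b" using k False that by (simp add: left_distrib J_simps)
    then show ?thesis using k False that by (metis J_l2 J_closed KK_carrier a_closed m_closed)
  qed
  then show ?thesis using k by (simp add: KK_I)
qed simp

text \<open>Put x = k^\<sigma>. Expand Q(1 + x) along the increment 1 and multiply by k on the left,
  which distributes since k lies in the kernel; comparison with the expansion along x leaves 2kx =
  2.\<close>

lemma I_KK: assumes k: "k \<in> KK" shows "I k = J k"
proof (cases "k = \<zero>")
  case False
  define x where "x = I k"
  have x: "x \<in> carrier F" "x \<noteq> \<zero>" "I x = k" using k False by (simp_all add: x_def)
  have "k \<otimes> Q (\<one> \<oplus> x) = k \<oplus> (\<one> \<oplus> \<one>) \<oplus> x" using Q_add_main[of x \<one>] x k by simp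
  moreover have "Q (\<one> \<oplus> x) = J k \<otimes> x \<oplus> (x \<oplus> x) \<oplus> \<one>"
    using Q_add_one[of x] x by (simp add: Q_def a_comm[of \<one> x])
  ultimately have "k \<otimes> (J k \<otimes> x \<oplus> (x \<oplus> x) \<oplus> \<one>) = k \<oplus> (\<one> \<oplus> \<one>) \<oplus> x" by simp
  then have "k \<otimes> x \<oplus> k \<otimes> x = \<one> \<oplus> \<one>" using x k False by (simp add: left_distrib J_simps ag_simps)
  then have "k \<otimes> x = \<one>" using double_inj[of "k \<otimes> x" \<one>] x k by simp
  then show ?thesis using J_unique[of k x] x k by (simp add: x_def)
qed simp

text \<open>On the kernel, inversion agrees with the multiplicative map \<open>I\<close>, and a
  group whose inversion is multiplicative is commutative.\<close>

lemma KK_commute: assumes "k \<in> KK" "l \<in> KK" shows "k \<otimes> l = l \<otimes> k"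
proof -
  have "J (k \<otimes> l) = J (l \<otimes> k)"
    using assms by (metis I_KK I_mult J_mult KK_mult KK_carrier)
  then show ?thesis using assms by (metis J_J KK_mult KK_carrier)
qed

lemma KK_lcommute: "k \<in> KK \<Longrightarrow> l \<in> KK \<Longrightarrow> x \<in> carrier F \<Longrightarrow> k \<otimes> (l \<otimes> x) = l \<otimes> (k \<otimes> x)"
  using KK_commute[of k l] by (simp flip: m_assoc)

lemma Q_KK: "k \<in> KK \<Longrightarrow> Q k = k \<otimes> k"
  by (simp add: Q_def I_KK)

lemma I_scale: "k \<in> KK \<Longrightarrow> x \<in> carrier F \<Longrightarrow> I (k \<otimes> x) = J k \<otimes> I x"
  by (simp add: I_mult I_KK)

text \<open>\<open>Q_add_main\<close> in the direction \<open>s \<otimes> I y\<close>, cleared of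
  the inverse of s by a left multiplication.\<close>

lemma Q_add_scaled:
  assumes y: "y \<in> carrier F" "y \<noteq> \<zero>" and s: "s \<in> KK" and c: "c \<in> carrier F"
  shows "y \<otimes> Q (c \<oplus> s \<otimes> I y) = y \<otimes> Q c \<oplus> (s \<otimes> c \<oplus> s \<otimes> c) \<oplus> s \<otimes> (s \<otimes> I y)"
proof (cases "s = \<zero>")
  case True
  then show ?thesis using assms by auto
next
  case False
  define x where "x = s \<otimes> I y"
  have x: "x \<in> carrier F" "x \<noteq> \<zero>" "I x = J s \<otimes> y" using y s False by (simp_all add: x_def I_scale)
  have "s \<otimes> (J s \<otimes> y \<otimes> Q (c \<oplus> x)) = s \<otimes> (J s \<otimes> y \<otimes> Q c \<oplus> (c \<oplus> c) \<oplus> x)"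
    using Q_add_main[of x c] x c by simp
  then show ?thesis using x y s c False by (simp add: left_distrib m_assoc J_simps) (simp add: x_def)
qed

lemma Q_add_KK: "s \<in> KK \<Longrightarrow> c \<in> carrier F \<Longrightarrow> Q (c \<oplus> s) = Q c \<oplus> (s \<otimes> c \<oplus> s \<otimes> c) \<oplus> s \<otimes> s"
  using Q_add_scaled[of \<one> s c] by simp

text \<open>Scaling by k turns \<open>Hua_operator\<close> for 1 and x into that for k and kx; the
  comparison identifies the right multiplication by \<open>Q k\<close> with the left multiplication
  by k^2.\<close>

lemma mult_Q_KK: assumes y: "y \<in> carrier F" and k: "k \<in> KK" shows "y \<otimes> Q k = k \<otimes> (k \<otimes> y)"
proof (cases "y = \<zero> \<or> k = \<zero> \<or> y = \<one>")
  case True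
  then show ?thesis using assms by (auto simp: Q_KK)
next
  case False
  define x where "x = I y"
  have x: "x \<in> carrier F" "x \<noteq> \<zero>" "I x = y" using y False by (simp_all add: x_def)
  have x1: "x \<noteq> \<one>" using x False I_one by metis
  define w where "w = \<one> \<oplus> I (x \<ominus> \<one>)"
  have w: "w \<in> carrier F" using x by (simp add: w_def)
  have 1: "y = \<one> \<ominus> I w" using Hua_operator[of \<one> x] x x1 y by (simp add: w_def)
  have kx: "k \<otimes> x \<noteq> k" using x k x1 False mult_left_cancel[of x \<one> k] by auto
  have "J k \<otimes> y \<otimes> Q k = k \<ominus> I (J k \<oplus> I (k \<otimes> x \<ominus> k))"
    using Hua_operator[of k "k \<otimes> x"] x k False kx by (simp add: I_scale I_KK)
  also have "k \<otimes> x \<ominus> k = k \<otimes> (x \<ominus> \<one>)" using x k by (simp add: left_distrib_minus)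
  also have "J k \<oplus> I (k \<otimes> (x \<ominus> \<one>)) = J k \<otimes> w"
    using x k by (simp add: I_scale w_def left_distrib)
  also have "k \<ominus> I (J k \<otimes> w) = k \<otimes> (\<one> \<ominus> I w)" using k w by (simp add: I_scale left_distrib_minus)
  also have "\<dots> = k \<otimes> y" using 1 by simp
  finally have "k \<otimes> (J k \<otimes> y \<otimes> Q k) = k \<otimes> (k \<otimes> y)" by simp
  then show ?thesis using y k False by (simp add: m_assoc J_simps)
qed

section \<open>Second differences of \<open>Q\<close>\<close>

definition D2 :: "'a \<Rightarrow> 'a \<Rightarrow> 'a \<Rightarrow> 'a" where
  "D2 c x y = Q (c \<oplus> x \<oplus> y) \<ominus> Q (c \<oplus> x) \<ominus> (Q (c \<oplus> y) \<ominus> Q c)"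

definition const_diff :: "'a \<Rightarrow> 'a \<Rightarrow> bool" where
  "const_diff x y \<longleftrightarrow> (\<forall>c\<in>carrier F. D2 c x y = D2 \<zero> x y)"

lemma D2_closed [simp]: "c \<in> carrier F \<Longrightarrow> x \<in> carrier F \<Longrightarrow> y \<in> carrier F \<Longrightarrow> D2 c x y \<in> carrier F"
  by (simp add: D2_def)

lemma D2_sym: "c \<in> carrier F \<Longrightarrow> x \<in> carrier F \<Longrightarrow> y \<in> carrier F \<Longrightarrow> D2 c x y = D2 c y x"
  by (simp add: D2_def ag_simps)

lemma D2_add: "c \<in> carrier F \<Longrightarrow> x \<in> carrier F \<Longrightarrow> x' \<in> carrier F \<Longrightarrow> y \<in> carrier F \<Longrightarrow>
    D2 c (x \<oplus> x') y = D2 c x' y \<oplus> D2 (c \<oplus> x') x y"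
  by (simp add: D2_def ag_simps)

lemma const_diffD: "const_diff x y \<Longrightarrow> c \<in> carrier F \<Longrightarrow> D2 c x y = D2 \<zero> x y"
  unfolding const_diff_def by blast

lemma const_diff_sym: "x \<in> carrier F \<Longrightarrow> y \<in> carrier F \<Longrightarrow> const_diff x y \<Longrightarrow> const_diff y x"
  unfolding const_diff_def by (metis D2_sym zero_closed)

lemma const_diffI: "(\<And>c. c \<in> carrier F \<Longrightarrow> D2 c x y = z) \<Longrightarrow> const_diff x y"
  by (simp add: const_diff_def)

lemma const_diff_add:
  assumes "x \<in> carrier F" "x' \<in> carrier F" "y \<in> carrier F" and r: "const_diff x y" "const_diff x' y"
  shows "const_diff (x \<oplus> x') y"
proof (rule const_diffI)
  fix c assume c: "c \<in> carrier F"
  show "D2 c (x \<oplus> x') y = D2 \<zero> x' y \<oplus> D2 \<zero> x y"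
    using const_diffD[OF r(2) c] const_diffD[OF r(1), of "c \<oplus> x'"] assms c by (simp add: D2_add)
qed

lemma const_diff_add_right: "x \<in> carrier F \<Longrightarrow> y' \<in> carrier F \<Longrightarrow> y \<in> carrier F \<Longrightarrow> const_diff x y \<Longrightarrow> const_diff x y' \<Longrightarrow> const_diff x (y \<oplus> y')"
  by (meson const_diff_add const_diff_sym a_closed)

lemma const_diff_zero [simp]: "y \<in> carrier F \<Longrightarrow> const_diff \<zero> y"
  by (rule const_diffI[where z = \<zero>]) (simp add: D2_def ag_simps)

lemma const_diff_uminus: assumes x: "x \<in> carrier F" and y: "y \<in> carrier F" and r: "const_diff x y" shows "const_diff (\<ominus> x) y"
proof (rule const_diffI)
  fix c assume c: "c \<in> carrier F"
  have "D2 c (x \<oplus> \<ominus> x) y = D2 c (\<ominus> x) y \<oplus> D2 (c \<oplus> \<ominus> x) x y" using x y c by (rule_tac D2_add) auto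
  also have "D2 (c \<oplus> \<ominus> x) x y = D2 \<zero> x y" using const_diffD[OF r, of "c \<oplus> \<ominus> x"] x c by simp
  finally have "D2 c \<zero> y = D2 c (\<ominus> x) y \<oplus> D2 \<zero> x y" using x by (simp add: r_neg)
  moreover have "D2 c \<zero> y = \<zero>" using c y by (simp add: D2_def ag_simps)
  ultimately show "D2 c (\<ominus> x) y = \<ominus> D2 \<zero> x y" using x y c by (simp add: ag_simps)
qed

lemma const_diff_KK: assumes k: "k \<in> KK" and y: "y \<in> carrier F" shows "const_diff k y"
proof (rule const_diffI)
  fix c assume c: "c \<in> carrier F"
  have "c \<oplus> k \<oplus> y = (c \<oplus> y) \<oplus> k" using c k y by (simp add: ag_simps)
  then show "D2 c k y = k \<otimes> y \<oplus> k \<otimes> y"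
    using Q_add_KK[of k "c \<oplus> y"] Q_add_KK[of k c] c k y by (simp add: D2_def left_distrib ag_simps)
qed

text \<open>For a = 1 - e and b = 1 - e^\<sigma> the KT identity reads a^\<sigma> + b^\<sigma> = 1.
  This splits Q into two summands; the increments of the first along a and those of the second along
  kb are affine in c, so the mixed second difference is constant. The kernel summands 1 and k of the
  directions are then removed by \<open>const_diff_KK\<close>.\<close>

lemma const_diff_I: assumes e: "e \<in> carrier F" and k: "k \<in> KK" shows "const_diff e (k \<otimes> I e)"
proof (cases "e = \<zero> \<or> e = \<one>")
  case True
  then show ?thesis using assms const_diff_KK[of \<one> k] by auto
next
  case False
  define a where "a = \<one> \<ominus> e"
  define b where "b = \<one> \<ominus> I e"
  have a: "a \<in> carrier F" "a \<noteq> \<zero>" using e False by (auto simp: a_def ag_simps)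
  have "I e \<noteq> \<one>" using e False I_I I_one by metis
  then have b: "b \<in> carrier F" "b \<noteq> \<zero>" using e by (auto simp: b_def ag_simps)
  have n: "\<one> \<oplus> \<ominus> a = e" using e by (simp add: a_def ag_simps)
  have "I (\<one> \<oplus> I (\<ominus> a)) = \<one> \<ominus> I (\<one> \<oplus> \<ominus> a)" by (rule KT) (use a n False in \<open>auto simp: ag_simps\<close>)
  then have bI: "I (\<one> \<ominus> I a) = b" using n a by (simp add: I_minus a_minus_def b_def)
  have yb: "I b = \<one> \<ominus> I a" using bI[symmetric] a by simp
  have rab: "const_diff a (k \<otimes> b)"
  proof (rule const_diffI)
    fix c assume c: "c \<in> carrier F"
    have split: "Q z = I a \<otimes> Q z \<oplus> I b \<otimes> Q z" if "z \<in> carrier F" for z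
    proof -
      have "I a \<oplus> I b = \<one>" using yb a by (simp add: ag_simps)
      then show ?thesis using that a b by (metis I_closed Q_closed l_one right_distrib)
    qed
    have 1: "I a \<otimes> Q (d \<oplus> a) = I a \<otimes> Q d \<oplus> (d \<oplus> d) \<oplus> a" if "d \<in> carrier F" for d
      using Q_add_scaled[of "I a" \<one> d] that a by simp
    have 2: "I b \<otimes> Q (d \<oplus> k \<otimes> b) = I b \<otimes> Q d \<oplus> (k \<otimes> d \<oplus> k \<otimes> d) \<oplus> k \<otimes> (k \<otimes> b)" if "d \<in> carrier F" for d
      using Q_add_scaled[of "I b" k d] that b k by simp
    have 3: "c \<oplus> a \<oplus> k \<otimes> b = (c \<oplus> k \<otimes> b) \<oplus> a" using a b c k by (simp add: ag_simps)
    define A where "A = I a \<otimes> Q (c \<oplus> k \<otimes> b)"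
    define B where "B = I b \<otimes> Q (c \<oplus> a)"
    define A' where "A' = I a \<otimes> Q c"
    define B' where "B' = I b \<otimes> Q c"
    have cl: "A \<in> carrier F" "B \<in> carrier F" "A' \<in> carrier F" "B' \<in> carrier F"
      using a b c k by (simp_all add: A_def B_def A'_def B'_def)
    have e1: "Q (c \<oplus> a \<oplus> k \<otimes> b) = A \<oplus> (c \<oplus> k \<otimes> b \<oplus> (c \<oplus> k \<otimes> b)) \<oplus> a \<oplus> (B \<oplus> (k \<otimes> (c \<oplus> a) \<oplus> k \<otimes> (c \<oplus> a)) \<oplus> k \<otimes> (k \<otimes> b))"
      using split[of "c \<oplus> a \<oplus> k \<otimes> b"] 1[of "c \<oplus> k \<otimes> b"] 2[of "c \<oplus> a"] a b c k unfolding A_def B_def 3[symmetric] by simp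
    have e2: "Q (c \<oplus> a) = A' \<oplus> (c \<oplus> c) \<oplus> a \<oplus> B"
      using split[of "c \<oplus> a"] 1[of c] a c by (simp add: A'_def B_def)
    have e3: "Q (c \<oplus> k \<otimes> b) = A \<oplus> (B' \<oplus> (k \<otimes> c \<oplus> k \<otimes> c) \<oplus> k \<otimes> (k \<otimes> b))"
      using split[of "c \<oplus> k \<otimes> b"] 2[of c] b c k by (simp add: A_def B'_def)
    have e4: "Q c = A' \<oplus> B'" using split[of c] c by (simp add: A'_def B'_def)
    show "D2 c a (k \<otimes> b) = k \<otimes> b \<oplus> k \<otimes> b \<oplus> (k \<otimes> a \<oplus> k \<otimes> a)"
      unfolding D2_def e1 e2 e3 e4 using a b c k cl by (simp add: left_distrib ag_simps)
  qed
  have "const_diff (\<one> \<oplus> \<ominus> a) (k \<otimes> b)"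
    using a b k rab by (intro const_diff_add const_diff_uminus const_diff_KK[of "\<one>"]) auto
  then have "const_diff (k \<otimes> b) e" using n a b k by (auto intro!: const_diff_sym)
  then have "const_diff (k \<oplus> \<ominus> (k \<otimes> b)) e" using e b k by (intro const_diff_add const_diff_uminus const_diff_KK[OF k]) auto
  moreover have "k \<oplus> \<ominus> (k \<otimes> b) = k \<otimes> I e" using e k by (simp add: b_def left_distrib_minus ag_simps)
  ultimately show ?thesis using e k by (auto intro: const_diff_sym)
qed

text \<open>Compare the second differences with both steps y at the base points x - y and
  -y.\<close>

lemma parallelogram_if_const_diff:
  assumes r: "\<And>e. e \<in> carrier F \<Longrightarrow> const_diff e e" and x: "x \<in> carrier F" and y: "y \<in> carrier F"
  shows "Q (x \<oplus> y) \<oplus> Q (x \<ominus> y) = (Q x \<oplus> Q x) \<oplus> (Q y \<oplus> Q y)"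
proof -
  have "D2 (x \<ominus> y) y y = D2 (\<ominus> y) y y"
    using const_diffD[OF r[OF y], of "x \<ominus> y"] const_diffD[OF r[OF y], of "\<ominus> y"] x y by simp
  moreover have "x \<ominus> y \<oplus> y = x" "\<ominus> y \<oplus> y = \<zero>" using x y by (simp_all add: ag_simps)
  ultimately show ?thesis using x y by (simp add: D2_def Q_minus) (simp add: ag_simps)
qed

section \<open>Resolvents over an infinite kernel\<close>

definition lspan :: "'a set \<Rightarrow> 'a set" where
  "lspan B = {finsum F (\<lambda>b. c b \<otimes> b) B | c. c \<in> B \<rightarrow> KK}"

lemma lspan_carrier: "B \<subseteq> carrier F \<Longrightarrow> x \<in> lspan B \<Longrightarrow> x \<in> carrier F"
  unfolding lspan_def by (auto intro!: finsum_closed simp: Pi_iff subset_iff)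

lemma finsum_mult_left:
  assumes "finite A" "f \<in> A \<rightarrow> carrier F" "k \<in> KK"
  shows "k \<otimes> finsum F f A = finsum F (\<lambda>t. k \<otimes> f t) A"
  using assms
proof (induction A rule: finite_induct)
  case (insert a A)
  then show ?case by (simp add: left_distrib Pi_iff)
qed simp

lemma finsum_in_subgroup:
  assumes "finite A" "f \<in> A \<rightarrow> G" "\<zero> \<in> G" "G \<subseteq> carrier F" "\<And>x y. x \<in> G \<Longrightarrow> y \<in> G \<Longrightarrow> x \<oplus> y \<in> G"
  shows "finsum F f A \<in> G"
  using assms(1,2)
proof (induction A rule: finite_induct)
  case (insert a A)
  then have "f \<in> A \<rightarrow> carrier F" "f a \<in> carrier F" using assms(4) by (auto simp: Pi_iff)
  then show ?case using insert assms(5) by (simp add: Pi_iff)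
qed (use assms(3) in simp)

lemma lspan_lincomb:
  assumes B: "B \<subseteq> carrier F" "finite B" and x: "x \<in> lspan B" and y: "y \<in> lspan B" and k: "k \<in> KK"
  shows "x \<oplus> k \<otimes> y \<in> lspan B"
proof -
  obtain c d where c: "c \<in> B \<rightarrow> KK" "x = finsum F (\<lambda>b. c b \<otimes> b) B"
    and d: "d \<in> B \<rightarrow> KK" "y = finsum F (\<lambda>b. d b \<otimes> b) B"
    using x y unfolding lspan_def by blast
  have "k \<otimes> y = finsum F (\<lambda>b. k \<otimes> d b \<otimes> b) B"
    unfolding d(2) using d(1) B k by (subst finsum_mult_left) (auto intro!: finsum_cong' simp: m_assoc Pi_iff subset_iff)
  then have "x \<oplus> k \<otimes> y = finsum F (\<lambda>b. c b \<otimes> b) B \<oplus> finsum F (\<lambda>b. k \<otimes> d b \<otimes> b) B"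
    using c(2) by simp
  also have "\<dots> = finsum F (\<lambda>b. c b \<otimes> b \<oplus> k \<otimes> d b \<otimes> b) B"
    by (rule finsum_addf[symmetric]) (use c(1) d(1) B k in \<open>auto simp: Pi_iff subset_iff\<close>)
  also have "\<dots> = finsum F (\<lambda>b. (c b \<oplus> k \<otimes> d b) \<otimes> b) B"
    using c(1) d(1) B k by (intro finsum_cong') (auto simp: right_distrib Pi_iff subset_iff)
  finally show ?thesis using c(1) d(1) k unfolding lspan_def
    by (auto intro!: exI[of _ "\<lambda>b. c b \<oplus> k \<otimes> d b"] simp: Pi_iff)
qed

lemma finsum_mult_right:
  assumes "finite A" "f \<in> A \<rightarrow> carrier F" "x \<in> carrier F"
  shows "finsum F f A \<otimes> x = finsum F (\<lambda>t. f t \<otimes> x) A"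
  using assms
proof (induction A rule: finite_induct)
  case (insert a A)
  then show ?case by (simp add: right_distrib Pi_iff)
qed simp

text \<open>Gaussian elimination by induction on the generators. The vectors are indexed by
  \<open>D\<close>, so that repeated ones count separately.\<close>

lemma KK_dependent:
  fixes v :: "'t \<Rightarrow> 'a"
  assumes "finite B" "B \<subseteq> carrier F" "finite D" "card B < card D" "\<And>t. t \<in> D \<Longrightarrow> v t \<in> lspan B"
  shows "\<exists>f. f \<in> D \<rightarrow> KK \<and> (\<exists>t\<in>D. f t \<noteq> \<zero>) \<and> finsum F (\<lambda>t. f t \<otimes> v t) D = \<zero>"
  using assms
proof (induction B arbitrary: D v rule: finite_induct)
  case empty
  have "v t = \<zero>" if "t \<in> D" for t using empty.prems that by (auto simp: lspan_def)
  moreover obtain t where "t \<in> D" using empty.prems by fastforce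
  ultimately show ?case
    by (intro exI[of _ "\<lambda>_. \<one>"]) (auto intro!: add.finprod_one_eqI)
next
  case (insert b B)
  have bV: "b \<in> carrier F" "B \<subseteq> carrier F" using insert.prems by auto
  have "\<exists>k w. k \<in> KK \<and> w \<in> lspan B \<and> v t = k \<otimes> b \<oplus> w" if t: "t \<in> D" for t
  proof -
    obtain c where c: "c \<in> insert b B \<rightarrow> KK" "v t = finsum F (\<lambda>b. c b \<otimes> b) (insert b B)"
      using insert.prems(4)[OF t] unfolding lspan_def by blast
    then have "v t = c b \<otimes> b \<oplus> finsum F (\<lambda>b. c b \<otimes> b) B"
      using insert.hyps bV by (subst (asm) finsum_insert) (auto simp: Pi_iff)
    then show ?thesis using c(1) unfolding lspan_def
      by (intro exI[of _ "c b"] exI[of _ "finsum F (\<lambda>b. c b \<otimes> b) B"]) auto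
  qed
  then obtain k w where kw: "\<And>t. t \<in> D \<Longrightarrow> k t \<in> KK \<and> w t \<in> lspan B \<and> v t = k t \<otimes> b \<oplus> w t"
    by metis
  have wV: "w t \<in> carrier F" if "t \<in> D" for t using kw[OF that] lspan_carrier[OF bV(2)] by blast
  have vV: "v t \<in> carrier F" if "t \<in> D" for t using kw[OF that] wV[OF that] bV by simp
  show ?case
  proof (cases "\<forall>t\<in>D. k t = \<zero>")
    case True
    have "v t \<in> lspan B" if "t \<in> D" for t using kw[OF that] True that bV wV by simp
    then show ?thesis using insert.IH[of D v] insert.prems insert.hyps bV by simp
  next
    case False
    \<comment> \<open>\<open>s\<close> is the pivot: subtracting \<open>r t \<otimes> v s\<close>
      from \<open>v t\<close> eliminates the generator b.\<close>
    then obtain s where s: "s \<in> D" "k s \<noteq> \<zero>" by blast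
    define D' where "D' = D - {s}"
    define r where "r t = k t \<otimes> J (k s)" for t
    have D': "finite D'" "s \<notin> D'" "D = insert s D'" "card B < card D'"
      using insert.prems insert.hyps s by (auto simp: D'_def)
    have r: "r t \<in> KK" if "t \<in> D" for t using kw s that by (simp add: r_def)
    define v' where "v' t = v t \<ominus> r t \<otimes> v s" for t
    have v'V: "v' t \<in> carrier F" if "t \<in> D" for t using vV r s that by (simp add: v'_def)
    have v's: "v' t \<in> lspan B" if "t \<in> D" for t
    proof -
      have "r t \<otimes> v s = k t \<otimes> b \<oplus> r t \<otimes> w s"
        using kw[OF that] kw[OF s(1)] r[OF that] wV[OF s(1)] bV s(2)
        by (simp add: left_distrib) (simp add: r_def m_assoc J_simps)
      then have "v' t = w t \<oplus> (\<ominus> r t) \<otimes> w s"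
        using kw[OF that] r[OF that] wV[OF s(1)] wV[OF that] bV by (simp add: v'_def minus_mult ag_simps)
      then show ?thesis using lspan_lincomb[OF bV(2) insert.hyps(1)] kw[OF that] kw[OF s(1)] r[OF that] by simp
    qed
    obtain f where f: "f \<in> D' \<rightarrow> KK" "\<exists>t\<in>D'. f t \<noteq> \<zero>" "finsum F (\<lambda>t. f t \<otimes> v' t) D' = \<zero>"
      using insert.IH[of D' v'] D' v's bV by auto
    \<comment> \<open>The coefficient at the pivot collects the multiples of \<open>v s\<close> that
      were subtracted.\<close>
    define g where "g t = (if t = s then \<ominus> finsum F (\<lambda>t. f t \<otimes> r t) D' else f t)" for t
    have sumKK: "finsum F h A \<in> KK" if "finite A" "h \<in> A \<rightarrow> KK" for h and A :: "'t set"
      using that by (rule finsum_in_subgroup) auto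
    have fr: "(\<lambda>t. f t \<otimes> r t) \<in> D' \<rightarrow> KK" using f(1) r D'(3) by (auto simp: Pi_iff)
    have g: "g \<in> D \<rightarrow> KK" using sumKK[OF D'(1) fr] f(1) D' by (auto simp: g_def)
    have "finsum F (\<lambda>t. f t \<otimes> v t) D' = finsum F (\<lambda>t. f t \<otimes> v' t \<oplus> f t \<otimes> r t \<otimes> v s) D'"
    proof (rule finsum_cong')
      fix t assume t: "t \<in> D'"
      have "v t = v' t \<oplus> r t \<otimes> v s" using vV r s t D'(3) by (simp add: v'_def ag_simps)
      then show "f t \<otimes> v t = f t \<otimes> v' t \<oplus> f t \<otimes> r t \<otimes> v s"
        using f(1) t D'(3) v'V vV[OF s(1)] r by (auto simp: left_distrib m_assoc Pi_iff)
    qed (use f(1) v'V vV s r D'(3) in \<open>auto simp: Pi_iff\<close>)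
    also have "\<dots> = finsum F (\<lambda>t. f t \<otimes> v' t) D' \<oplus> finsum F (\<lambda>t. f t \<otimes> r t \<otimes> v s) D'"
      by (rule finsum_addf) (use f(1) v'V vV s r D'(3) in \<open>auto simp: Pi_iff\<close>)
    also have "finsum F (\<lambda>t. f t \<otimes> r t \<otimes> v s) D' = finsum F (\<lambda>t. f t \<otimes> r t) D' \<otimes> v s"
      by (rule finsum_mult_right[symmetric]) (use D' fr vV s in \<open>auto simp: Pi_iff\<close>)
    finally have e: "finsum F (\<lambda>t. f t \<otimes> v t) D' = finsum F (\<lambda>t. f t \<otimes> r t) D' \<otimes> v s"
      using f(3) sumKK[OF D'(1) fr] vV s by simp
    have "finsum F (\<lambda>t. g t \<otimes> v t) D = g s \<otimes> v s \<oplus> finsum F (\<lambda>t. g t \<otimes> v t) D'"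
      unfolding D'(3) using D' g vV by (intro finsum_insert) (auto simp: Pi_iff)
    also have "finsum F (\<lambda>t. g t \<otimes> v t) D' = finsum F (\<lambda>t. f t \<otimes> v t) D'"
      by (rule finsum_cong') (use f(1) vV D' in \<open>auto simp: Pi_iff g_def\<close>)
    finally have "finsum F (\<lambda>t. g t \<otimes> v t) D = \<zero>"
      using e sumKK[OF D'(1) fr] vV s by (simp add: g_def minus_mult l_neg)
    moreover have "\<exists>t\<in>D. g t \<noteq> \<zero>" using f(2) D' by (auto simp: g_def)
    ultimately show ?thesis using g by blast
  qed
qed

text \<open>Models y |-> 2ey, by a map that is visibly additive and linear over the kernel. It later
  reappears as \<open>P e \<one> y\<close>.\<close>

definition T2 :: "'a \<Rightarrow> 'a \<Rightarrow> 'a" where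
  "T2 e y = y \<otimes> Q (e \<oplus> \<one>) \<ominus> y \<ominus> y \<otimes> Q e"

lemma T2_closed [simp]: "e \<in> carrier F \<Longrightarrow> y \<in> carrier F \<Longrightarrow> T2 e y \<in> carrier F"
  by (simp add: T2_def)

lemma T2_add: "e \<in> carrier F \<Longrightarrow> x \<in> carrier F \<Longrightarrow> y \<in> carrier F \<Longrightarrow> T2 e (x \<oplus> y) = T2 e x \<oplus> T2 e y"
  by (simp add: T2_def right_distrib ag_simps)

lemma T2_scale: "e \<in> carrier F \<Longrightarrow> k \<in> KK \<Longrightarrow> y \<in> carrier F \<Longrightarrow> T2 e (k \<otimes> y) = k \<otimes> T2 e y"
  by (simp add: T2_def left_distrib_minus m_assoc)

lemma T2_one: "e \<in> carrier F \<Longrightarrow> T2 e \<one> = e \<oplus> e"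
  by (simp add: T2_def Q_add_one) (simp add: ag_simps)

text \<open>Models 2e / (e + t) = 2 (1 - t / (e + t)). Both e and e + 1 differ from e + t by kernel
  elements, so \<open>Q_add_main\<close> in the direction e + t together with
  \<open>mult_Q_KK\<close> evaluates both terms of \<open>T2\<close>.\<close>

lemma T2_resolvent:
  assumes e: "e \<in> carrier F" and t: "t \<in> KK" and n: "e \<oplus> t \<noteq> \<zero>"
  shows "T2 e (I (e \<oplus> t)) = (\<one> \<ominus> t \<otimes> I (e \<oplus> t)) \<oplus> (\<one> \<ominus> t \<otimes> I (e \<oplus> t))"
proof -
  define y where "y = I (e \<oplus> t)"
  have y: "y \<in> carrier F" using e t by (simp add: y_def)
  have 1: "\<ominus> t \<oplus> (e \<oplus> t) = e" "\<one> \<ominus> t \<oplus> (e \<oplus> t) = e \<oplus> \<one>" using e t by (simp_all add: ag_simps)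
  have a: "y \<otimes> Q e = t \<otimes> (t \<otimes> y) \<oplus> (\<ominus> t \<oplus> \<ominus> t) \<oplus> (e \<oplus> t)"
    using Q_add_main[of "e \<oplus> t" "\<ominus> t"] mult_Q_KK[of y "\<ominus> t"] e t n 1 y
    by (simp add: y_def[symmetric] minus_mult mult_minus)
  have b: "y \<otimes> Q (e \<oplus> \<one>) = (\<one> \<ominus> t) \<otimes> ((\<one> \<ominus> t) \<otimes> y) \<oplus> (\<one> \<ominus> t \<oplus> (\<one> \<ominus> t)) \<oplus> (e \<oplus> t)"
    using Q_add_main[of "e \<oplus> t" "\<one> \<ominus> t"] mult_Q_KK[of y "\<one> \<ominus> t"] e t n 1 y
    by (simp add: y_def[symmetric])
  show ?thesis unfolding y_def[symmetric] T2_def a b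
    using e t y by (simp add: distribs left_distrib_minus) (simp add: ag_simps)
qed

lemma T2_finsum:
  assumes "finite A" "f \<in> A \<rightarrow> carrier F" "e \<in> carrier F"
  shows "T2 e (finsum F f A) = finsum F (\<lambda>t. T2 e (f t)) A"
  using assms
proof (induction A rule: finite_induct)
  case (insert a A)
  then show ?case by (simp add: T2_add Pi_iff)
qed (simp add: T2_def ag_simps)

lemma finsum_double:
  assumes "f \<in> A \<rightarrow> carrier F"
  shows "finsum F (\<lambda>t. f t \<oplus> f t) A = finsum F f A \<oplus> finsum F f A"
  using finsum_addf[of f A f] assms by simp

text \<open>A minimal linear relation between the resolvents \<open>I (e \<oplus> t)\<close> cannot have coefficient sum
  zero: \<^term>\<open>T2 e\<close> maps it to a relation with one term less after subtracting a multiple.\<close>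

lemma resolvent_span:
  assumes TT: "infinite TT" "TT \<subseteq> KK" and fd: "finite_dim_over_kernel F"
    and e: "e \<in> carrier F" "e \<notin> KK"
    and G: "G \<subseteq> carrier F" "\<And>x y. x \<in> G \<Longrightarrow> y \<in> G \<Longrightarrow> x \<oplus> y \<in> G"
      "\<And>k x. k \<in> KK \<Longrightarrow> x \<in> G \<Longrightarrow> k \<otimes> x \<in> G" "\<And>t. t \<in> TT \<Longrightarrow> I (e \<oplus> t) \<in> G"
  shows "\<one> \<in> G" "e \<in> G"
proof -
  define y where "y t = I (e \<oplus> t)" for t
  have n: "e \<oplus> t \<noteq> \<zero>" if "t \<in> KK" for t
  proof
    assume "e \<oplus> t = \<zero>"
    then have "e = \<ominus> t" using e that by (simp add: ag_simps)
    then show False using e that by simp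
  qed
  have yV [simp]: "y t \<in> carrier F" if "t \<in> KK" for t using e that by (simp add: y_def)
  have y0: "y t \<noteq> \<zero>" if "t \<in> KK" for t using e n that by (simp add: y_def)
  have Ty: "T2 e (k \<otimes> y t) = k \<otimes> (\<one> \<ominus> t \<otimes> y t) \<oplus> k \<otimes> (\<one> \<ominus> t \<otimes> y t)" if "t \<in> KK" "k \<in> KK" for t k
  proof -
    have "T2 e (y t) = (\<one> \<ominus> t \<otimes> y t) \<oplus> (\<one> \<ominus> t \<otimes> y t)"
      using T2_resolvent[OF e(1) that(1) n[OF that(1)]] by (simp add: y_def)
    then show ?thesis using that e by (simp add: T2_scale left_distrib)
  qed
  define P where "P m \<longleftrightarrow> (\<exists>D f. finite D \<and> D \<subseteq> TT \<and> card D = m \<and> f \<in> D \<rightarrow> KK \<and> (\<exists>t\<in>D. f t \<noteq> \<zero>)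
    \<and> finsum F (\<lambda>t. f t \<otimes> y t) D = \<zero>)" for m
  obtain B where B: "finite B" "B \<subseteq> carrier F" "\<And>x. x \<in> carrier F \<Longrightarrow> x \<in> lspan B"
  proof -
    obtain B where B: "finite_kernel_basis F B" using fd unfolding finite_dim_over_kernel_def by blast
    have "x \<in> lspan B" if x: "x \<in> carrier F" for x
    proof -
      obtain c where "c \<in> B \<rightarrow>\<^sub>E KK" "x = (\<Oplus>b\<in>B. c b \<otimes> b)"
        using B x unfolding finite_kernel_basis_def by blast
      then show ?thesis unfolding lspan_def by (auto simp: PiE_iff Pi_iff)
    qed
    then show ?thesis using B that unfolding finite_kernel_basis_def by blast
  qed
  obtain D0 where D0: "finite D0" "card D0 = Suc (card B)" "D0 \<subseteq> TT"
    using infinite_arbitrarily_large[OF TT(1)] by blast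
  have "P (card D0)"
  proof -
    have "y t \<in> lspan B" if "t \<in> D0" for t using that D0(3) TT(2) B(3) yV by blast
    then obtain f where "f \<in> D0 \<rightarrow> KK" "\<exists>t\<in>D0. f t \<noteq> \<zero>" "finsum F (\<lambda>t. f t \<otimes> y t) D0 = \<zero>"
      using KK_dependent[OF B(1,2) D0(1), of y] D0(2) by auto
    then show ?thesis unfolding P_def using D0 by blast
  qed
  then obtain m where m: "P m" "\<And>k. k < m \<Longrightarrow> \<not> P k" using exists_least_iff[of P] by blast
  then obtain D f where D: "finite D" "D \<subseteq> TT" "card D = m" and f: "f \<in> D \<rightarrow> KK" "\<exists>t\<in>D. f t \<noteq> \<zero>"
    "finsum F (\<lambda>t. f t \<otimes> y t) D = \<zero>" unfolding P_def by blast
  have DK: "t \<in> KK" "f t \<in> KK" if "t \<in> D" for t using that D f TT(2) by auto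
  have T_sum: "finsum F (\<lambda>t. g t \<otimes> (\<one> \<ominus> t \<otimes> y t)) D = z"
    if "T2 e (finsum F (\<lambda>t. g t \<otimes> y t) D) = z \<oplus> z" "\<And>t. t \<in> D \<Longrightarrow> g t \<in> KK" "z \<in> carrier F" for g z
  proof -
    have "T2 e (finsum F (\<lambda>t. g t \<otimes> y t) D) = finsum F (\<lambda>t. T2 e (g t \<otimes> y t)) D"
      using D DK that(2) e by (intro T2_finsum) auto
    also have "\<dots> = finsum F (\<lambda>t. g t \<otimes> (\<one> \<ominus> t \<otimes> y t) \<oplus> g t \<otimes> (\<one> \<ominus> t \<otimes> y t)) D"
      using DK that(2) by (intro finsum_cong') (auto simp: Ty)
    also have "\<dots> = finsum F (\<lambda>t. g t \<otimes> (\<one> \<ominus> t \<otimes> y t)) D \<oplus> finsum F (\<lambda>t. g t \<otimes> (\<one> \<ominus> t \<otimes> y t)) D"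
      using DK that(2) by (intro finsum_double) auto
    finally show ?thesis
      using that(1,3) finsum_closed[of "\<lambda>t. g t \<otimes> (\<one> \<ominus> t \<otimes> y t)" D] DK that(2)
        double_inj[of "finsum F (\<lambda>t. g t \<otimes> (\<one> \<ominus> t \<otimes> y t)) D" z] by (auto simp: Pi_iff)
  qed
  \<comment> \<open>Applying \<open>T2 e\<close> to the relation and cancelling 2 gives \<Sum> f t
    (1 - t y t) = 0, so the coefficient sum also equals \<Sum> f t t y t.\<close>
  define \<kappa> where "\<kappa> = finsum F f D"
  have \<kappa>K: "\<kappa> \<in> KK" unfolding \<kappa>_def using D f by (intro finsum_in_subgroup) auto
  have \<kappa>: "\<kappa> = finsum F (\<lambda>t. f t \<otimes> t \<otimes> y t) D"
  proof -
    have "finsum F (\<lambda>t. f t \<otimes> (\<one> \<ominus> t \<otimes> y t)) D = \<zero>"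
      using T_sum[of f \<zero>] f(3) DK e by (simp add: T2_def ag_simps)
    then have "finsum F (\<lambda>t. f t \<otimes> (\<one> \<ominus> t \<otimes> y t)) D \<oplus> finsum F (\<lambda>t. f t \<otimes> t \<otimes> y t) D
      = finsum F (\<lambda>t. f t \<otimes> t \<otimes> y t) D"
      using DK by (simp add: Pi_iff finsum_closed)
    moreover have "finsum F (\<lambda>t. f t \<otimes> (\<one> \<ominus> t \<otimes> y t)) D \<oplus> finsum F (\<lambda>t. f t \<otimes> t \<otimes> y t) D
      = finsum F (\<lambda>t. f t \<otimes> (\<one> \<ominus> t \<otimes> y t) \<oplus> f t \<otimes> t \<otimes> y t) D"
      using DK by (intro finsum_addf[symmetric]) auto
    moreover have "\<dots> = \<kappa>" unfolding \<kappa>_def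
      using DK by (intro finsum_cong') (auto simp: left_distrib_minus m_assoc ag_simps)
    ultimately show ?thesis by simp
  qed
  have \<kappa>0: "\<kappa> \<noteq> \<zero>"
  proof
    assume \<kappa>0: "\<kappa> = \<zero>"
    obtain s where s: "s \<in> D" "f s \<noteq> \<zero>" using f by blast
    have "D \<noteq> {s}" using f(3) s DK y0 by auto
    then obtain t0 where t0: "t0 \<in> D" "t0 \<noteq> s" using s by blast
    \<comment> \<open>Now \<Sum> f t t y t and \<Sum> f t y t are both 0. Subtracting t0 times the
      second from the first removes the term at t0 and keeps the one at s, against the minimality of
      m.\<close>
    define g where "g t = f t \<otimes> (t \<ominus> t0)" for t
    have gK: "g t \<in> KK" if "t \<in> D" for t using that DK t0 by (simp add: g_def)
    have "finsum F (\<lambda>t. g t \<otimes> y t) D \<oplus> finsum F (\<lambda>t. t0 \<otimes> (f t \<otimes> y t)) D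
      = finsum F (\<lambda>t. g t \<otimes> y t \<oplus> t0 \<otimes> (f t \<otimes> y t)) D"
      using DK gK t0 by (intro finsum_addf[symmetric]) auto
    also have "\<dots> = \<kappa>" unfolding \<kappa>
    proof (rule finsum_cong')
      fix t assume t: "t \<in> D"
      show "g t \<otimes> y t \<oplus> t0 \<otimes> (f t \<otimes> y t) = f t \<otimes> t \<otimes> y t"
        using DK[OF t] DK[OF t0(1)] KK_lcommute[of t0 "f t" "y t"]
        by (simp add: g_def distribs left_distrib_minus m_assoc) (simp add: ag_simps)
    qed (use DK in auto)
    also have "finsum F (\<lambda>t. t0 \<otimes> (f t \<otimes> y t)) D = t0 \<otimes> finsum F (\<lambda>t. f t \<otimes> y t) D"
      using D DK t0 by (intro finsum_mult_left[symmetric]) auto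
    finally have g0: "finsum F (\<lambda>t. g t \<otimes> y t) D = \<zero>"
      using f(3) \<kappa>0 DK gK t0 by (simp add: Pi_iff finsum_closed)
    have "finsum F (\<lambda>t. g t \<otimes> y t) (insert t0 (D - {t0})) = g t0 \<otimes> y t0 \<oplus> finsum F (\<lambda>t. g t \<otimes> y t) (D - {t0})"
      using D DK gK t0 by (intro finsum_insert) auto
    moreover have "g t0 = \<zero>" using DK t0 by (simp add: g_def ag_simps)
    ultimately have "finsum F (\<lambda>t. g t \<otimes> y t) (D - {t0}) = \<zero>"
      using g0 DK gK t0 by (simp add: insert_absorb Pi_iff finsum_closed)
    moreover have "g s \<noteq> \<zero>" using s t0 DK by (auto simp: g_def ag_simps)
    ultimately have "P (card (D - {t0}))"
      unfolding P_def using D gK s t0 by (intro exI[of _ "D - {t0}"] exI[of _ g]) auto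
    moreover have "card (D - {t0}) < m" using D t0 by (metis card_Diff1_less)
    ultimately show False using m(2) by blast
  qed
  have yG: "y t \<in> G" if "t \<in> TT" for t using G(4) that by (simp add: y_def)
  obtain t where "t \<in> TT" using TT(1) by fastforce
  then have G0: "\<zero> \<in> G" using G(3)[of \<zero> "y t"] yG TT(2) by auto
  have "\<kappa> \<in> G" unfolding \<kappa>
  proof (rule finsum_in_subgroup[OF D(1) _ G0 G(1,2)])
    have "f t \<otimes> t \<otimes> y t \<in> G" if "t \<in> D" for t
      using G(3)[of "f t \<otimes> t" "y t"] yG[of t] DK[OF that] D(2) that by auto
    then show "(\<lambda>t. f t \<otimes> t \<otimes> y t) \<in> D \<rightarrow> G" by simp
  qed
  then have "J \<kappa> \<otimes> \<kappa> \<in> G" using \<kappa>K G(3) by simp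
  then show one: "\<one> \<in> G" using \<kappa>K \<kappa>0 by (simp add: J_l)
  \<comment> \<open>A second application of \<open>T2 e\<close>, now to \<kappa> = \<Sum> f t t y t,
    expresses \<kappa> e through 1 and the resolvents.\<close>
  have "T2 e \<kappa> = \<kappa> \<otimes> e \<oplus> \<kappa> \<otimes> e"
    using T2_scale[of e \<kappa> \<one>] \<kappa>K e by (simp add: T2_one left_distrib)
  then have "finsum F (\<lambda>t. f t \<otimes> t \<otimes> (\<one> \<ominus> t \<otimes> y t)) D = \<kappa> \<otimes> e"
    using T_sum[of "\<lambda>t. f t \<otimes> t" "\<kappa> \<otimes> e"] DK \<kappa>K e unfolding \<kappa>[symmetric] by simp
  moreover have "finsum F (\<lambda>t. f t \<otimes> t \<otimes> (\<one> \<ominus> t \<otimes> y t)) D \<in> G"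
  proof (rule finsum_in_subgroup[OF D(1) _ G0 G(1,2)])
    have "\<one> \<ominus> t \<otimes> y t \<in> G" if "t \<in> D" for t
      using G(2)[OF one G(3)[of "\<ominus> t" "y t"]] yG[of t] DK[OF that] D(2) that by (auto simp: minus_mult ag_simps)
    then show "(\<lambda>t. f t \<otimes> t \<otimes> (\<one> \<ominus> t \<otimes> y t)) \<in> D \<rightarrow> G" using DK G(3) by auto
  qed
  ultimately have "J \<kappa> \<otimes> (\<kappa> \<otimes> e) \<in> G" using \<kappa>K G(3) by simp
  then show "e \<in> G" using \<kappa>K \<kappa>0 e by (simp add: J_l2)
qed

text \<open>Quantifying over all kernel multiples makes \<open>G\<close> a kernel subspace. It
  contains every resolvent of e, because \<open>const_diff_I\<close> holds at e + t and the summand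
  t is removed by \<open>const_diff_KK\<close>; so \<open>resolvent_span\<close> puts e itself into
  \<open>G\<close>.\<close>

lemma const_diff_self_infinite:
  assumes inf: "infinite KK" and fd: "finite_dim_over_kernel F" and e: "e \<in> carrier F"
  shows "const_diff e e"
proof (cases "e \<in> KK")
  case True
  then show ?thesis using const_diff_KK e by blast
next
  case False
  define G where "G = {y \<in> carrier F. \<forall>k\<in>KK. const_diff e (k \<otimes> y)}"
  have "e \<in> G"
  proof (rule resolvent_span(2)[OF inf subset_refl fd e False])
    show "G \<subseteq> carrier F" by (auto simp: G_def)
    show "x \<oplus> y \<in> G" if "x \<in> G" "y \<in> G" for x y
      using that e by (auto simp: G_def left_distrib intro!: const_diff_add_right)
    show "k \<otimes> x \<in> G" if "k \<in> KK" "x \<in> G" for k x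
      using that by (auto simp: G_def simp flip: m_assoc)
    show "I (e \<oplus> t) \<in> G" if t: "t \<in> KK" for t
    proof -
      have "const_diff e (k \<otimes> I (e \<oplus> t))" if k: "k \<in> KK" for k
      proof -
        have "const_diff (e \<oplus> t \<oplus> \<ominus> t) (k \<otimes> I (e \<oplus> t))"
          using e t k by (intro const_diff_add const_diff_I const_diff_KK) auto
        then show ?thesis using e t by (simp add: ag_simps)
      qed
      then show ?thesis using e t by (simp add: G_def)
    qed
  qed
  then show ?thesis using e unfolding G_def by (auto dest!: bspec[of _ _ \<one>])
qed

end

section \<open>Biadditive forms over a finite nearfield\<close>

context odd_nearfield begin

section \<open>Natural multiples and forms on the exponent lattice\<close>

primrec nmul :: "nat \<Rightarrow> 'a \<Rightarrow> 'a" where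
  "nmul 0 v = \<zero>"
| "nmul (Suc n) v = nmul n v \<oplus> v"

lemma nmul_closed [simp]: "v \<in> carrier F \<Longrightarrow> nmul n v \<in> carrier F"
  by (induction n) simp_all

lemma nmul_zero [simp]: "nmul n \<zero> = \<zero>"
  by (induction n) simp_all

lemma nmul_add: "v \<in> carrier F \<Longrightarrow> nmul (m + n) v = nmul m v \<oplus> nmul n v"
  by (induction n) (simp_all add: a_ac)

lemma nmul_mult: "v \<in> carrier F \<Longrightarrow> nmul (m * n) v = nmul m (nmul n v)"
  by (induction m) (simp_all add: nmul_add a_comm)

lemma nmul_distrib: "v \<in> carrier F \<Longrightarrow> w \<in> carrier F \<Longrightarrow> nmul n (v \<oplus> w) = nmul n v \<oplus> nmul n w"
  by (induction n) (simp_all add: a_ac)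

lemma nmul_uminus: "v \<in> carrier F \<Longrightarrow> nmul n (\<ominus> v) = \<ominus> nmul n v"
  by (induction n) (simp_all add: minus_add)

text \<open>
  Functions on \<open>\<int>\<^sup>4\<close> that behave like \<open>(a, b, c, d) \<mapsto> \<gamma> (e\<^sup>a (e + 1)\<^sup>b) (e\<^sup>c (e + 1)\<^sup>d)\<close> for a
  biadditive \<open>\<gamma>\<close> on a field; \<open>M\<close> is a common period.
\<close>

definition lattice_form :: "int \<Rightarrow> (int \<Rightarrow> int \<Rightarrow> int \<Rightarrow> int \<Rightarrow> 'a) \<Rightarrow> bool" where
  "lattice_form M f \<longleftrightarrow> (\<forall>a b c d. f a b c d \<in> carrier F
     \<and> f a (b + 1) c d = f (a + 1) b c d \<oplus> f a b c d
     \<and> f a b c (d + 1) = f a b (c + 1) d \<oplus> f a b c d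
     \<and> f (a + M) b c d = f a b c d \<and> f a (b + M) c d = f a b c d
     \<and> f a b (c + M) d = f a b c d \<and> f a b c (d + M) = f a b c d)"

text \<open>In the model: \<gamma> x y = 0 whenever x y = e^i for some i \<le> k.\<close>

definition vanishes :: "nat \<Rightarrow> (int \<Rightarrow> int \<Rightarrow> int \<Rightarrow> int \<Rightarrow> 'a) \<Rightarrow> bool" where
  "vanishes k f \<longleftrightarrow> (\<forall>i\<le>k. \<forall>a b. f a b (int i - a) (- b) = \<zero>)"

text \<open>In the model, with r = e / (e + 1), the pair (x, y) is replaced by (x r^i, y r^-i),
  which keeps the product x y.\<close>

definition lshift :: "int \<Rightarrow> (int \<Rightarrow> int \<Rightarrow> int \<Rightarrow> int \<Rightarrow> 'a) \<Rightarrow> int \<Rightarrow> int \<Rightarrow> int \<Rightarrow> int \<Rightarrow> 'a" where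
  "lshift i f a b c d = f (a + i) (b - i) (c - i) (d + i)"

text \<open>A discrete primitive: over a full period M, its second difference under the shift is M
  times the first difference of f.\<close>

primrec weighted_shifts :: "nat \<Rightarrow> (int \<Rightarrow> int \<Rightarrow> int \<Rightarrow> int \<Rightarrow> 'a) \<Rightarrow> int \<Rightarrow> int \<Rightarrow> int \<Rightarrow> int \<Rightarrow> 'a" where
  "weighted_shifts 0 f a b c d = \<zero>"
| "weighted_shifts (Suc m) f a b c d = weighted_shifts m f a b c d \<oplus> nmul m (lshift (int m) f a b c d)"

primrec partial_sum :: "(nat \<Rightarrow> 'a) \<Rightarrow> nat \<Rightarrow> 'a" where
  "partial_sum z 0 = \<zero>"
| "partial_sum z (Suc m) = partial_sum z m \<oplus> z m"

lemma lattice_formD: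
  assumes "lattice_form M f"
  shows "f a b c d \<in> carrier F" "f a (b + 1) c d = f (a + 1) b c d \<oplus> f a b c d"
    "f a b c (d + 1) = f a b (c + 1) d \<oplus> f a b c d"
    "f (a + M) b c d = f a b c d" "f a (b + M) c d = f a b c d"
    "f a b (c + M) d = f a b c d" "f a b c (d + M) = f a b c d"
  using assms unfolding lattice_form_def by blast+

lemma lattice_form_add:
  assumes f: "lattice_form M f" and g: "lattice_form M g"
  shows "lattice_form M (\<lambda>a b c d. f a b c d \<oplus> g a b c d)"
  unfolding lattice_form_def
proof (intro allI conjI)
  fix a b c d
  show "f a (b + 1) c d \<oplus> g a (b + 1) c d = f (a + 1) b c d \<oplus> g (a + 1) b c d \<oplus> (f a b c d \<oplus> g a b c d)"
    using lattice_formD(2)[OF f, of a b c d] lattice_formD(2)[OF g, of a b c d]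
    by (simp add: lattice_formD(1)[OF f] lattice_formD(1)[OF g] a_ac)
  show "f a b c (d + 1) \<oplus> g a b c (d + 1) = f a b (c + 1) d \<oplus> g a b (c + 1) d \<oplus> (f a b c d \<oplus> g a b c d)"
    using lattice_formD(3)[OF f, of a b c d] lattice_formD(3)[OF g, of a b c d]
    by (simp add: lattice_formD(1)[OF f] lattice_formD(1)[OF g] a_ac)
qed (simp_all add: lattice_formD[OF f] lattice_formD[OF g])

lemma lattice_form_uminus:
  assumes f: "lattice_form M f"
  shows "lattice_form M (\<lambda>a b c d. \<ominus> f a b c d)"
  unfolding lattice_form_def
proof (intro allI conjI)
  fix a b c d
  show "\<ominus> f a (b + 1) c d = \<ominus> f (a + 1) b c d \<oplus> \<ominus> f a b c d"
    using lattice_formD(2)[OF f, of a b c d] lattice_formD(1)[OF f] by (simp add: minus_add)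
  show "\<ominus> f a b c (d + 1) = \<ominus> f a b (c + 1) d \<oplus> \<ominus> f a b c d"
    using lattice_formD(3)[OF f, of a b c d] lattice_formD(1)[OF f] by (simp add: minus_add)
qed (simp_all add: lattice_formD[OF f])

lemma lattice_form_zero: "lattice_form M (\<lambda>a b c d. \<zero>)"
  by (simp add: lattice_form_def)

lemma lattice_form_shift:
  assumes f: "lattice_form M f"
  shows "lattice_form M (lshift i f)"
proof -
  have "f (a + x + i) b c d = f (a + i + x) b c d" "f a (b + x - i) c d = f a (b - i + x) c d"
    "f a b (c + x - i) d = f a b (c - i + x) d" "f a b c (d + x + i) = f a b c (d + i + x)" for a b c d x
    by (simp_all add: algebra_simps)
  note r = this
  show ?thesis
    unfolding lattice_form_def lshift_def r by (intro allI conjI lattice_formD[OF f])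
qed

lemma vanishes_add: "vanishes k f \<Longrightarrow> vanishes k g \<Longrightarrow> vanishes k (\<lambda>a b c d. f a b c d \<oplus> g a b c d)"
  by (simp add: vanishes_def)

lemma vanishes_shift:
  assumes "vanishes k f"
  shows "vanishes k (lshift j f)"
proof -
  have "f (a + j) (b - j) (int i - a - j) (- b + j) = \<zero>" if "i \<le> k" for i a b
  proof -
    have "f (a + j) (b - j) (int i - (a + j)) (- (b - j)) = \<zero>" using assms that unfolding vanishes_def by blast
    then show ?thesis by (simp add: algebra_simps)
  qed
  then show ?thesis by (simp add: vanishes_def lshift_def)
qed

definition lat :: "int \<Rightarrow> nat \<Rightarrow> (int \<Rightarrow> int \<Rightarrow> int \<Rightarrow> int \<Rightarrow> 'a) \<Rightarrow> bool" where
  "lat M k f \<longleftrightarrow> lattice_form M f \<and> vanishes k f"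

lemma lat_pow:
  assumes "lat M k f"
  shows "lat M k (\<lambda>a b c d. nmul n (f a b c d))"
proof (induction n)
  case (Suc n)
  have "lattice_form M f" using assms by (simp add: lat_def)
  then show ?case using assms Suc unfolding lat_def
    by (auto intro: lattice_form_add vanishes_add)
qed (simp add: lat_def lattice_form_zero vanishes_def)

lemma lat_weighted_shifts:
  assumes "lat M k f"
  shows "lat M k (weighted_shifts m f)"
proof (induction m)
  case (Suc m)
  have "lat M k (lshift (int m) f)" using assms by (simp add: lat_def lattice_form_shift vanishes_shift)
  then have "lat M k (\<lambda>a b c d. nmul m (lshift (int m) f a b c d))" by (rule lat_pow)
  then have "lat M k (\<lambda>a b c d. weighted_shifts m f a b c d \<oplus> nmul m (lshift (int m) f a b c d))"
    using Suc unfolding lat_def by (auto intro: lattice_form_add vanishes_add)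
  then show ?case by (simp add: fun_eq_iff cong: lattice_form_def) 
qed (simp add: lat_def lattice_form_def vanishes_def)

definition ldiff :: "(int \<Rightarrow> int \<Rightarrow> int \<Rightarrow> int \<Rightarrow> 'a) \<Rightarrow> int \<Rightarrow> int \<Rightarrow> int \<Rightarrow> int \<Rightarrow> 'a" where
  "ldiff f a b c d = lshift 1 f a b c d \<ominus> f a b c d"

lemma lattice_form_ldiff: "lattice_form M f \<Longrightarrow> lattice_form M (ldiff f)"
  using lattice_form_add[OF lattice_form_shift[of M f 1] lattice_form_uminus[of M f]]
  by (simp add: ldiff_def[abs_def] a_minus_def)

text \<open>In the model, \<open>ldiff f\<close> at (x, ey) is f(x, y) - f(x / (e + 1), (e + 1) y).
  The pair on the left has product exy, those on the right have product xy.\<close>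

lemma ldiff_step:
  assumes f: "lattice_form M f"
  shows "ldiff f a b (c + 1) d = f a b c d \<ominus> f a (b - 1) c (d + 1)"
proof -
  have "f a b c (d + 1) = f (a + 1) (b - 1) c (d + 1) \<oplus> f a (b - 1) c (d + 1)"
    using lattice_formD(2)[OF f, of a "b - 1" c "d + 1"] by simp
  then show ?thesis
    using lattice_formD(3)[OF f, of a b c d] lattice_formD(1)[OF f]
    by (simp add: ldiff_def lshift_def ag_simps)
qed

text \<open>By \<open>ldiff_step\<close> a value at product e^(j + 1) is a difference of two values
  of f at product e^j, so taking \<open>ldiff\<close> gains one order.\<close>

lemma lat_ldiff:
  assumes "lat M k f"
  shows "lat M (Suc k) (ldiff f)"
proof -
  have f: "lattice_form M f" and v: "\<And>i a b. i \<le> k \<Longrightarrow> f a b (int i - a) (- b) = \<zero>"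
    using assms by (auto simp: lat_def vanishes_def)
  have "ldiff f a b (int i - a) (- b) = \<zero>" if "i \<le> Suc k" for i a b
  proof (cases i)
    case 0
    then show ?thesis using v[of 0 a b] v[of 0 "a + 1" "b - 1"]
      by (simp add: ldiff_def lshift_def a_minus_def)
  next
    case (Suc j)
    then show ?thesis
      using ldiff_step[OF f, of a b "int j - a" "- b"] v[of j a b] v[of j a "b - 1"] that
      by (simp add: algebra_simps a_minus_def)
  qed
  then show ?thesis using lattice_form_ldiff[OF f] by (simp add: lat_def vanishes_def)
qed

text \<open>Summation by parts, written without subtraction.\<close>

lemma weighted_sum_telescope:
  assumes z: "\<And>i. z i \<in> carrier F"
  shows "partial_sum (\<lambda>i. nmul i (z (Suc i))) m \<oplus> partial_sum z m \<oplus> z m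
    = partial_sum (\<lambda>i. nmul i (z i)) m \<oplus> nmul m (z m) \<oplus> z 0"
proof (induction m)
  case (Suc m)
  have c: "partial_sum y m \<in> carrier F" if "\<And>i. y i \<in> carrier F" for y m
    by (induction m) (use that in auto)
  have "nmul k (z i) \<in> carrier F" for k i using z by simp
  note c1 = c[OF this] c[OF z] z this
  have "partial_sum (\<lambda>i. nmul i (z (Suc i))) (Suc m) \<oplus> partial_sum z (Suc m) \<oplus> z (Suc m)
    = (partial_sum (\<lambda>i. nmul i (z (Suc i))) m \<oplus> partial_sum z m \<oplus> z m) \<oplus> (nmul m (z (Suc m)) \<oplus> z (Suc m))"
    by (simp add: c1 a_ac)
  also have "\<dots> = partial_sum (\<lambda>i. nmul i (z i)) (Suc m) \<oplus> nmul (Suc m) (z (Suc m)) \<oplus> z 0"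
    unfolding Suc by (simp add: c1 a_ac)
  finally show ?case .
qed (use z in simp)

lemma weighted_shifts_eq:
  "weighted_shifts m f a b c d = partial_sum (\<lambda>i. nmul i (lshift (int i) f a b c d)) m"
  by (induction m) simp_all

lemma ldiff_ldiff_weighted_shifts:
  assumes f: "lattice_form (int M) f"
  shows "ldiff (ldiff (weighted_shifts M f)) a b c d = nmul M (ldiff f a b c d)"
proof -
  define z where "z i = lshift (int i) f a b c d" for i
  have z: "z i \<in> carrier F" for i using lattice_formD(1)[OF f] by (simp add: z_def lshift_def)
  have pc: "partial_sum y m \<in> carrier F" if "\<And>i. y i \<in> carrier F" for y m
    by (induction m) (use that in auto)
  have per: "z (i + M) = z i" for i
    using lattice_formD(4)[OF f, of "a + int i"] lattice_formD(5)[OF f, of _ "b - int i - int M"]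
      lattice_formD(6)[OF f, of _ _ "c - int i - int M"] lattice_formD(7)[OF f, of _ _ _ "d + int i"]
    by (simp add: z_def lshift_def algebra_simps)
  have lz: "lshift j (weighted_shifts M f) a b c d = partial_sum (\<lambda>i. nmul i (z (i + nat j))) M" if "j \<ge> 0" for j
    using that unfolding lshift_def weighted_shifts_eq by (simp add: z_def lshift_def algebra_simps)
  define A where "A j = partial_sum (\<lambda>i. nmul i (z (i + j))) M" for j
  define Z where "Z j = partial_sum (\<lambda>i. z (i + j)) M" for j
  have cl: "A j \<in> carrier F" "Z j \<in> carrier F" for j unfolding A_def Z_def using z by (auto intro!: pc)
  \<comment> \<open>Summation by parts over one period. The sum \<open>Z j\<close> over a period
    does not depend on j, so it cancels in the second difference.\<close>
  have step: "A (Suc j) \<oplus> Z j = A j \<oplus> nmul M (z j)" for j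
  proof -
    have "A (Suc j) \<oplus> Z j \<oplus> z j = A j \<oplus> nmul M (z j) \<oplus> z j"
      using weighted_sum_telescope[of "\<lambda>i. z (i + j)" M] z per[of j] by (simp add: A_def Z_def add.commute)
    then show ?thesis using z cl by simp
  qed
  have Zs: "Z (Suc j) = Z j" for j
  proof -
    have "partial_sum (\<lambda>i. y (Suc i)) m \<oplus> y 0 = partial_sum y m \<oplus> y m" if "\<And>i. y i \<in> carrier F" for y m
    proof (induction m)
      case (Suc m)
      have "partial_sum (\<lambda>i. y (Suc i)) (Suc m) \<oplus> y 0 = (partial_sum (\<lambda>i. y (Suc i)) m \<oplus> y 0) \<oplus> y (Suc m)"
        using pc[of "\<lambda>i. y (Suc i)"] that by (simp add: a_ac)
      then show ?case unfolding Suc by simp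
    qed (use that in simp)
    from this[of "\<lambda>i. z (i + j)" M] show ?thesis
      using z per[of j] pc[of "\<lambda>i. z (i + j)" M] pc[of "\<lambda>i. z (Suc (i + j))" M]
      by (simp add: Z_def add.commute[of M])
  qed
  have "ldiff (ldiff (weighted_shifts M f)) a b c d = (A 2 \<ominus> A 1) \<ominus> (A 1 \<ominus> A 0)"
    using lz[of 0] lz[of 1] lz[of 2] by (simp add: ldiff_def lshift_def A_def add.commute[of a 2] add.commute[of d 2])
  also have "\<dots> = nmul M (z 1) \<ominus> nmul M (z 0)"
  proof -
    have a1: "A 1 = A 0 \<oplus> nmul M (z 0) \<ominus> Z 0" using step[of 0] cl z by (simp add: ag_simps)
    have a2: "A 2 = A 1 \<oplus> nmul M (z 1) \<ominus> Z 0"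
      using step[of 1] Zs[of 0] cl z by (simp add: ag_simps numeral_2_eq_2)
    show ?thesis unfolding a2 a1 using cl z by (simp add: ag_simps)
  qed
  also have "\<dots> = nmul M (z 1 \<ominus> z 0)"
    using z by (simp add: a_minus_def nmul_distrib nmul_uminus)
  finally show ?thesis by (simp add: z_def ldiff_def lshift_def)
qed

text \<open>Iterating g |-> \<open>ldiff (weighted_shifts M g)\<close> raises the order of
  vanishing, while \<open>ldiff g\<close> stays a multiple of \<open>ldiff f\<close> by a power of
  M, which can be cancelled. So \<open>ldiff f\<close> vanishes at all products e^k with k \<ge> 0.
  Periodicity reaches the negative exponents and additivity the powers of e + 1. Thus f is invariant
  under moving r = e / (e + 1) between the arguments, by \<open>ldiff_step\<close> also under moving
  e + 1, and hence under moving e.\<close>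

lemma lattice_form_invariant:
  assumes f: "lattice_form (int M) f" and diag: "\<And>a b. f a b (- a) (- b) = \<zero>"
    and M: "M > 0" "\<And>v. v \<in> carrier F \<Longrightarrow> nmul M v = \<zero> \<Longrightarrow> v = \<zero>"
  shows "f (a + 1) b c d = f a b (c + 1) d"
proof -
  have approx: "\<exists>g. lat (int M) k g \<and> (\<forall>a b c d. ldiff g a b c d = nmul (M ^ k) (ldiff f a b c d))" for k
  proof (induction k)
    case 0
    then show ?case using f diag lattice_formD(1)[OF lattice_form_ldiff[OF f]]
      by (intro exI[of _ f]) (simp add: lat_def vanishes_def)
  next
    case (Suc k)
    then obtain g where g: "lat (int M) k g" "\<And>a b c d. ldiff g a b c d = nmul (M ^ k) (ldiff f a b c d)" by blast
    have "lat (int M) (Suc k) (ldiff (weighted_shifts M g))" by (intro lat_ldiff lat_weighted_shifts g)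
    moreover have "ldiff (ldiff (weighted_shifts M g)) a b c d = nmul (M ^ Suc k) (ldiff f a b c d)" for a b c d
      using ldiff_ldiff_weighted_shifts[of M g] g lattice_formD(1)[OF lattice_form_ldiff[OF f]]
      by (simp add: lat_def nmul_mult)
    ultimately show ?case by blast
  qed
  have f': "lattice_form (int M) (ldiff f)" by (rule lattice_form_ldiff[OF f])
  have cancel: "v = \<zero>" if "v \<in> carrier F" "nmul (M ^ k) v = \<zero>" for v k
    using that
  proof (induction k)
    case (Suc k)
    then have "nmul M (nmul (M ^ k) v) = \<zero>" by (simp add: nmul_mult)
    then show ?case using M(2)[of "nmul (M ^ k) v"] Suc by simp
  qed simp
  have z1: "ldiff f a b (int k - a) (- b) = \<zero>" for a b k
  proof -
    obtain g where g: "lat (int M) k g" "\<And>a b c d. ldiff g a b c d = nmul (M ^ k) (ldiff f a b c d)"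
      using approx by blast
    have "vanishes (Suc k) (ldiff g)" using lat_ldiff[OF g(1)] by (simp add: lat_def)
    then have "ldiff g a b (int k - a) (- b) = \<zero>" unfolding vanishes_def by (metis le_SucI order_refl)
    then show ?thesis using g(2) cancel lattice_formD(1)[OF f'] by metis
  qed
  have pc: "ldiff f a b (c + int n * int M) d = ldiff f a b c d" for a b c d n
  proof (induction n)
    case (Suc n)
    then show ?case using lattice_formD(6)[OF f', of a b "c + int n * int M" d] by (simp add: algebra_simps)
  qed simp
  have pd: "ldiff f a b c (d + int n * int M) = ldiff f a b c d" for a b c d n
  proof (induction n)
    case (Suc n)
    then show ?case using lattice_formD(7)[OF f', of a b c "d + int n * int M"] by (simp add: algebra_simps)
  qed simp
  have z2: "ldiff f a b c (- b) = \<zero>" for a b c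
  proof -
    define n where "n = nat \<bar>a + c\<bar>"
    have "a + c + int n * int M \<ge> 0"
    proof -
      have "int n * int M \<ge> int n * 1" using M(1) by (intro mult_left_mono) auto
      then show ?thesis by (simp add: n_def)
    qed
    then have "ldiff f a b (int (nat (a + c + int n * int M)) - a) (- b) = ldiff f a b c (- b)"
      using pc[of a b c n "- b"] by (simp add: algebra_simps)
    then show ?thesis using z1 by metis
  qed
  have z3: "ldiff f a b c (int k - b) = \<zero>" for a b c k
  proof (induction k arbitrary: c)
    case (Suc k)
    then show ?case using lattice_formD(3)[OF f', of a b c "int k - b"] by (simp add: algebra_simps)
  qed (simp add: z2)
  have z4: "ldiff f a b c d = \<zero>" for a b c d
  proof -
    define n where "n = nat \<bar>b + d\<bar>"
    have "b + d + int n * int M \<ge> 0"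
    proof -
      have "int n * int M \<ge> int n * 1" using M(1) by (intro mult_left_mono) auto
      then show ?thesis by (simp add: n_def)
    qed
    then have "ldiff f a b c (int (nat (b + d + int n * int M)) - b) = ldiff f a b c d"
      using pd[of a b c d n] by (simp add: algebra_simps)
    then show ?thesis using z3 by metis
  qed
  have 1: "f a b c d = f a (b - 1) c (d + 1)" for a b c d
    using ldiff_step[OF f, of a b c d] z4 lattice_formD(1)[OF f] by (simp add: ag_simps)
  have 2: "f (a + 1) (b - 1) (c - 1) (d + 1) = f a b c d" for a b c d
    using z4[of a b c d] lattice_formD(1)[OF f] by (simp add: ldiff_def lshift_def ag_simps)
  show ?thesis using 1[of "a + 1" b c d] 2[of a b "c + 1" d] by simp
qed

end

context odd_KT_nearfield begin

section \<open>Powers in the multiplicative group and the elements \<open>epow e a b\<close>\<close>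

definition pw :: "'a \<Rightarrow> int \<Rightarrow> 'a" where "pw x k = x [^]\<^bsub>mult_of F\<^esub> k"

lemma pw_closed: "x \<in> carrier F \<Longrightarrow> x \<noteq> \<zero> \<Longrightarrow> pw x k \<in> carrier F \<and> pw x k \<noteq> \<zero>"
  using mgr.int_pow_closed[of x k] by (simp add: pw_def)

lemma pw_carrier [simp]: "x \<in> carrier F \<Longrightarrow> x \<noteq> \<zero> \<Longrightarrow> pw x k \<in> carrier F"
  using pw_closed by blast

lemma pw_zero [simp]: "pw x 0 = \<one>" by (simp add: pw_def)

lemma pw_one [simp]: "x \<in> carrier F \<Longrightarrow> x \<noteq> \<zero> \<Longrightarrow> pw x 1 = x"
  using mgr.int_pow_1[of x] by (simp add: pw_def)

lemma pw_add: "x \<in> carrier F \<Longrightarrow> x \<noteq> \<zero> \<Longrightarrow> pw x (i + j) = pw x i \<otimes> pw x j"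
  using mgr.int_pow_mult[of x i j] by (simp add: pw_def)

lemma pw_neg: "x \<in> carrier F \<Longrightarrow> x \<noteq> \<zero> \<Longrightarrow> pw x (- i) = J (pw x i)"
  using pw_add[of x i "- i"] pw_closed[of x] by (intro J_unique[symmetric]) auto

lemma J_commute:
  assumes "x \<in> carrier F" "y \<in> carrier F" "x \<otimes> y = y \<otimes> x"
  shows "J x \<otimes> y = y \<otimes> J x"
proof (cases "x = \<zero>")
  case False
  have "J x \<otimes> (x \<otimes> y) \<otimes> J x = J x \<otimes> (y \<otimes> x) \<otimes> J x" using assms(3) by simp
  then show ?thesis using assms(1,2) False by (simp add: J_l2) (simp add: m_assoc J_simps)
qed (use assms in simp)

lemma pw_commute:
  assumes x: "x \<in> carrier F" "x \<noteq> \<zero>" and y: "y \<in> carrier F" "x \<otimes> y = y \<otimes> x"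
  shows "pw x i \<otimes> y = y \<otimes> pw x i"
proof -
  have n: "pw x (int n) \<otimes> y = y \<otimes> pw x (int n)" for n
  proof (induction n)
    case (Suc n)
    have "pw x (int (Suc n)) = pw x (int n) \<otimes> x" using pw_add[of x "int n" 1] x by (simp add: add.commute)
    then show ?case using Suc x y pw_closed[OF x] by (metis m_assoc)
  qed (use y in simp)
  show ?thesis
  proof (cases "i \<ge> 0")
    case True
    then show ?thesis using n[of "nat i"] by simp
  next
    case False
    then obtain k where "i = - int k" using nonpos_int_cases[of i] by auto
    then show ?thesis using J_commute[OF _ y(1) n, of k] pw_neg[of x "int k"] x by simp
  qed
qed

lemma I_pw:
  assumes x: "x \<in> carrier F" "x \<noteq> \<zero>" "I x = J x"
  shows "I (pw x i) = pw x (- i)"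
proof -
  have n: "I (pw x (int n)) = J (pw x (int n))" for n
  proof (induction n)
    case (Suc n)
    have 1: "pw x (int (Suc n)) = pw x (int n) \<otimes> x" "pw x (int (Suc n)) = x \<otimes> pw x (int n)"
      using pw_add[of x "int n" 1] pw_add[of x 1 "int n"] x by (simp_all add: add.commute)
    have "I (x \<otimes> pw x (int n)) = J (pw x (int n) \<otimes> x)" using Suc x by (simp add: I_mult J_mult)
    then show ?case using 1 by metis
  qed simp
  show ?thesis
  proof (cases "i \<ge> 0")
    case True
    then show ?thesis using n[of "nat i"] pw_neg x by simp
  next
    case False
    then obtain k where k: "i = - int k" using nonpos_int_cases[of i] by auto
    have "I (J (pw x (int k))) = pw x (int k)" using n[of k] x(1,2) I_J[of "pw x (int k)"] by simp
    then show ?thesis using k pw_neg[of x "int k"] x by simp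
  qed
qed

lemma pw_period:
  assumes fin: "finite (carrier F)" and x: "x \<in> carrier F" "x \<noteq> \<zero>"
  shows "pw x (i + int (card (carrier F) - 1)) = pw x i"
proof -
  have "order (mult_of F) = card (carrier F) - 1" using fin by (simp add: order_def card_Diff_singleton)
  then have "x [^]\<^bsub>mult_of F\<^esub> (card (carrier F) - 1) = \<one>"
    using mgr.pow_order_eq_1[of x] x by simp
  then have "pw x (int (card (carrier F) - 1)) = \<one>" by (simp add: pw_def int_pow_int)
  then show ?thesis using pw_add x by simp
qed

text \<open>\<^term>\<open>epow e a b\<close> stands for \<open>e\<^sup>a (e + 1)\<^sup>b\<close> in the field that is not yet available. It is built
  from the right multiplications by \<open>Q e\<close> and \<open>Q (e + 1)\<close>, the squares of \<open>e\<close> and \<open>e + 1\<close>, which commute.\<close>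

definition epow :: "'a \<Rightarrow> int \<Rightarrow> int \<Rightarrow> 'a" where
  "epow e a b = (if even a then if even b then \<one> else e \<oplus> \<one> else if even b then e else Q e \<oplus> e)
     \<otimes> (pw (Q e) (a div 2) \<otimes> pw (Q (e \<oplus> \<one>)) (b div 2))"

context
  fixes e assumes e: "e \<in> carrier F" "e \<noteq> \<zero>" "e \<oplus> \<one> \<noteq> \<zero>"
begin

lemma gh_carrier: "(Q e) \<in> carrier F" "(Q e) \<noteq> \<zero>" "(Q (e \<oplus> \<one>)) \<in> carrier F" "(Q (e \<oplus> \<one>)) \<noteq> \<zero>"
  using e by simp_all

lemma epow_carrier: "epow e a b \<in> carrier F"
  using e gh_carrier by (simp add: epow_def)

lemma h_pw_g: "(Q e) \<otimes> pw (Q (e \<oplus> \<one>)) j = pw (Q (e \<oplus> \<one>)) j \<otimes> (Q e)" "(Q (e \<oplus> \<one>)) \<otimes> pw (Q e) j = pw (Q e) j \<otimes> (Q (e \<oplus> \<one>))"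
  using pw_commute[of "Q (e \<oplus> \<one>)" "Q e" j] pw_commute[of "Q e" "Q (e \<oplus> \<one>)" j] gh_carrier Q_commute_add_one[OF e(1)] by simp_all

lemma shift_h: "x \<in> carrier F \<Longrightarrow> x \<otimes> (pw (Q e) (i + 1) \<otimes> pw (Q (e \<oplus> \<one>)) j) = x \<otimes> (Q e) \<otimes> (pw (Q e) i \<otimes> pw (Q (e \<oplus> \<one>)) j)"
  using gh_carrier pw_add[of "Q e" 1 i] by (simp add: m_assoc add.commute)

lemma shift_g: "x \<in> carrier F \<Longrightarrow> x \<otimes> (pw (Q e) i \<otimes> pw (Q (e \<oplus> \<one>)) (j + 1)) = x \<otimes> (Q (e \<oplus> \<one>)) \<otimes> (pw (Q e) i \<otimes> pw (Q (e \<oplus> \<one>)) j)"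
  using gh_carrier pw_add[of "Q (e \<oplus> \<one>)" 1 j] h_pw_g(2)[of i] m_assoc[of "Q (e \<oplus> \<one>)" "pw (Q e) i" "pw (Q (e \<oplus> \<one>)) j"]
  by (simp add: m_assoc add.commute)

lemma g_eq: "(Q (e \<oplus> \<one>)) = (Q e) \<oplus> (e \<oplus> e) \<oplus> \<one>"
  using Q_add_one e by simp

lemma I_e_g: "I e \<otimes> (Q (e \<oplus> \<one>)) = I e \<oplus> (\<one> \<oplus> \<one>) \<oplus> e"
  using Q_add_main[of e \<one>] e by (simp add: a_comm)

text \<open>Models e (e + 1)^2 = e^3 + 2e^2 + e. As e need not distribute from the left, it is
  written as \<open>I e \<otimes> Q e\<close>, and \<open>Q e\<close> is moved past
  \<open>Q (e \<oplus> \<one>)\<close> so that \<open>I_e_g\<close> applies.\<close>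

lemma e_g: "e \<otimes> (Q (e \<oplus> \<one>)) = e \<otimes> (Q e) \<oplus> ((Q e) \<oplus> (Q e)) \<oplus> e"
proof -
  have "e \<otimes> (Q (e \<oplus> \<one>)) = I e \<otimes> (Q e) \<otimes> (Q (e \<oplus> \<one>))" using e by (simp add: I_mult_Q)
  also have "\<dots> = I e \<otimes> (Q (e \<oplus> \<one>)) \<otimes> (Q e)" using e by (simp add: m_assoc Q_commute_add_one)
  also have "\<dots> = e \<otimes> (Q e) \<oplus> ((Q e) \<oplus> (Q e)) \<oplus> e"
    unfolding I_e_g using e by (simp add: right_distrib I_mult_Q a_ac)
  finally show ?thesis .
qed

lemma epow_add: "epow e a (b + 1) = epow e (a + 1) b \<oplus> epow e a b"
proof -
  define p where "p = pw (Q e) (a div 2) \<otimes> pw (Q (e \<oplus> \<one>)) (b div 2)"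
  have p: "p \<in> carrier F" using gh_carrier by (simp add: p_def)
  have sa: "(a + 1) div 2 = a div 2 + 1" if "odd a" for a :: int using that by presburger
  have sb: "(a + 1) div 2 = a div 2" if "even a" for a :: int using that by presburger
  consider "even a" "even b" | "even a" "odd b" | "odd a" "even b" | "odd a" "odd b" by blast
  then show ?thesis
  proof cases
    case 1
    then have "epow e a (b + 1) = (e \<oplus> \<one>) \<otimes> p" "epow e (a + 1) b = e \<otimes> p" "epow e a b = \<one> \<otimes> p"
      by (simp_all add: epow_def sb p_def)
    then show ?thesis using e p by (simp add: right_distrib)
  next
    case 2
    then have "epow e a (b + 1) = (Q (e \<oplus> \<one>)) \<otimes> p" "epow e (a + 1) b = ((Q e) \<oplus> e) \<otimes> p" "epow e a b = (e \<oplus> \<one>) \<otimes> p"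
      using shift_g[of \<one> "a div 2" "b div 2"] gh_carrier by (simp_all add: epow_def sa sb p_def)
    then show ?thesis using e p g_eq by (simp add: right_distrib a_ac)
  next
    case 3
    then have "epow e a (b + 1) = ((Q e) \<oplus> e) \<otimes> p" "epow e (a + 1) b = (Q e) \<otimes> p" "epow e a b = e \<otimes> p"
      using shift_h[of \<one> "a div 2" "b div 2"] gh_carrier by (simp_all add: epow_def sa sb p_def)
    then show ?thesis using e p by (simp add: right_distrib)
  next
    case 4
    then have "epow e a (b + 1) = e \<otimes> (Q (e \<oplus> \<one>)) \<otimes> p" "epow e (a + 1) b = (e \<oplus> \<one>) \<otimes> (Q e) \<otimes> p" "epow e a b = ((Q e) \<oplus> e) \<otimes> p"
      using shift_g[of e "a div 2" "b div 2"] shift_h[of "e \<oplus> \<one>" "a div 2" "b div 2"] gh_carrier e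
      by (simp_all add: epow_def sa sb p_def)
    then show ?thesis using e p e_g by (simp add: right_distrib a_ac)
  qed
qed

text \<open>For this prefactor of \<open>epow\<close> the rule \<open>mult_Q_I\<close> is not
  enough, because \<open>Q (Q e \<oplus> e)\<close> has not been factored. Instead
  \<open>Hua\<close> for e and 1 provides the partial fractions 1 / (e (e + 1)) = 1 / e - 1 / (e +
  1), which are multiplied by \<open>Q (e \<oplus> \<one>)\<close>.\<close>

lemma I_h_plus_e: "I ((Q e) \<oplus> e) = ((Q e) \<oplus> e) \<otimes> (J (Q e) \<otimes> J (Q (e \<oplus> \<one>)))"
proof -
  have n: "I e \<oplus> \<one> \<noteq> \<zero>" using I_add_eq_zero[of e \<one>] e by simp
  have 0: "e \<otimes> J (Q e) = I e" using mult_Q_I[of e] e by (simp add: Q_I)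
  have Ie1: "I (e \<oplus> \<one>) = (e \<oplus> \<one>) \<otimes> J (Q (e \<oplus> \<one>))" using mult_Q_I[of "e \<oplus> \<one>"] e by (simp add: Q_I)
  have s: "(I e \<oplus> \<one>) \<otimes> (Q e) = (Q e) \<oplus> e" using e by (simp add: right_distrib I_mult_Q a_comm)
  have "I (e \<oplus> \<one>) = I e \<ominus> I (I e \<oplus> \<one>) \<otimes> J (Q e)" using Hua[of e \<one>] e by (simp add: Q_I)
  moreover have "I ((Q e) \<oplus> e) = I (I e \<oplus> \<one>) \<otimes> J (Q e)"
    using I_mult[of "I e \<oplus> \<one>" "Q e"] e by (simp add: s I_Q)
  ultimately have "I ((Q e) \<oplus> e) = I e \<ominus> I (e \<oplus> \<one>)" using e by (simp add: ag_simps)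
  then have "I ((Q e) \<oplus> e) \<otimes> (Q (e \<oplus> \<one>)) = I e \<otimes> (Q (e \<oplus> \<one>)) \<ominus> (e \<oplus> \<one>) \<otimes> J (Q (e \<oplus> \<one>)) \<otimes> (Q (e \<oplus> \<one>))" using e Ie1 by (simp add: minus_right_distrib)
  also have "(e \<oplus> \<one>) \<otimes> J (Q (e \<oplus> \<one>)) \<otimes> (Q (e \<oplus> \<one>)) = e \<oplus> \<one>" using e by (simp add: m_assoc J_l)
  also have "I e \<otimes> (Q (e \<oplus> \<one>)) \<ominus> (e \<oplus> \<one>) = \<one> \<oplus> I e" unfolding I_e_g using e by (simp add: ag_simps)
  also have "\<dots> = ((Q e) \<oplus> e) \<otimes> J (Q e)" using e 0 by (simp add: right_distrib J_r)
  finally have "I ((Q e) \<oplus> e) \<otimes> (Q (e \<oplus> \<one>)) \<otimes> J (Q (e \<oplus> \<one>)) = ((Q e) \<oplus> e) \<otimes> J (Q e) \<otimes> J (Q (e \<oplus> \<one>))" by simp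
  then show ?thesis using e by (simp add: m_assoc J_r)
qed

lemma I_epow: "I (epow e a b) = epow e (- a) (- b)"
proof -
  have 0: "I e = e \<otimes> J (Q e)" using mult_Q_I[of e] e by (simp add: Q_I)
  have 1: "I (e \<oplus> \<one>) = (e \<oplus> \<one>) \<otimes> J (Q (e \<oplus> \<one>))" using mult_Q_I[of "e \<oplus> \<one>"] e by (simp add: Q_I)
  have Ip: "I (pw (Q e) i) = pw (Q e) (- i)" "I (pw (Q (e \<oplus> \<one>)) i) = pw (Q (e \<oplus> \<one>)) (- i)" for i
    using I_pw gh_carrier e by (simp_all add: I_Q)
  have m: "pw (Q e) (- i) = J (Q e) \<otimes> pw (Q e) (- i + 1)" "pw (Q (e \<oplus> \<one>)) (- i) = J (Q (e \<oplus> \<one>)) \<otimes> pw (Q (e \<oplus> \<one>)) (- i + 1)" for i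
    using pw_add[of "Q e" "- 1" "- i + 1"] pw_add[of "Q (e \<oplus> \<one>)" "- 1" "- i + 1"] gh_carrier
      pw_neg[of "Q e" 1] pw_neg[of "Q (e \<oplus> \<one>)" 1] by simp_all
  have sh: "x \<otimes> J (Q e) \<otimes> (pw (Q e) (- i) \<otimes> pw (Q (e \<oplus> \<one>)) j) = x \<otimes> (pw (Q e) (- i - 1) \<otimes> pw (Q (e \<oplus> \<one>)) j)" if "x \<in> carrier F" for x i j
    using m(1)[of "i + 1"] gh_carrier that by (simp add: m_assoc)
  have sg: "x \<otimes> J (Q (e \<oplus> \<one>)) \<otimes> (pw (Q e) i \<otimes> pw (Q (e \<oplus> \<one>)) (- j)) = x \<otimes> (pw (Q e) i \<otimes> pw (Q (e \<oplus> \<one>)) (- j - 1))" if "x \<in> carrier F" for x i j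
  proof -
    have "J (Q (e \<oplus> \<one>)) \<otimes> pw (Q e) i = pw (Q e) i \<otimes> J (Q (e \<oplus> \<one>))" using J_commute[of "Q (e \<oplus> \<one>)" "pw (Q e) i"] h_pw_g(2) gh_carrier by simp
    then have "J (Q (e \<oplus> \<one>)) \<otimes> (pw (Q e) i \<otimes> pw (Q (e \<oplus> \<one>)) (- j)) = pw (Q e) i \<otimes> (J (Q (e \<oplus> \<one>)) \<otimes> pw (Q (e \<oplus> \<one>)) (- j))"
      using gh_carrier by (metis J_closed m_assoc pw_carrier)
    then show ?thesis using m(2)[of "j + 1"] gh_carrier that by (simp add: m_assoc)
  qed
  have ev: "(- a) div 2 = - (a div 2)" if "even a" for a :: int using that by presburger
  \<comment> \<open>For odd exponents negation lowers the half by one more; this absorbs the factors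
    \<open>J (Q e)\<close> and \<open>J (Q (e \<oplus> \<one>))\<close>.\<close>
  have od: "(- a) div 2 = - (a div 2) - 1" if "odd a" for a :: int using that by presburger
  define p where "p = pw (Q e) (- (a div 2)) \<otimes> pw (Q (e \<oplus> \<one>)) (- (b div 2))"
  have p: "p \<in> carrier F" using gh_carrier by (simp add: p_def)
  have I: "I (x \<otimes> (pw (Q e) (a div 2) \<otimes> pw (Q (e \<oplus> \<one>)) (b div 2))) = I x \<otimes> p" if "x \<in> carrier F" for x
    using that gh_carrier by (simp add: I_mult Ip p_def)
  consider "even a" "even b" | "even a" "odd b" | "odd a" "even b" | "odd a" "odd b" by blast
  then show ?thesis
  proof cases
    case 1
    then show ?thesis using I[of \<one>] by (simp add: epow_def ev p_def)
  next
    case 2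
    then show ?thesis using I[of "e \<oplus> \<one>"] e sg[of "e \<oplus> \<one>" "- (a div 2)" "b div 2"]
      by (simp add: epow_def ev od p_def 1)
  next
    case 3
    then show ?thesis using I[of e] e sh[of e "a div 2" "- (b div 2)"]
      by (simp add: epow_def ev od p_def 0)
  next
    case 4
    have "I ((Q e) \<oplus> e) \<otimes> p = ((Q e) \<oplus> e) \<otimes> J (Q e) \<otimes> J (Q (e \<oplus> \<one>)) \<otimes> p"
      using e by (simp add: I_h_plus_e m_assoc)
    also have "\<dots> = ((Q e) \<oplus> e) \<otimes> J (Q e) \<otimes> (pw (Q e) (- (a div 2)) \<otimes> pw (Q (e \<oplus> \<one>)) (- (b div 2) - 1))"
      unfolding p_def using sg[of "((Q e) \<oplus> e) \<otimes> J (Q e)"] e by simp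
    also have "\<dots> = ((Q e) \<oplus> e) \<otimes> (pw (Q e) (- (a div 2) - 1) \<otimes> pw (Q (e \<oplus> \<one>)) (- (b div 2) - 1))"
      using sh[of "(Q e) \<oplus> e" "a div 2" "- (b div 2) - 1"] e by simp
    finally show ?thesis using 4 I[of "(Q e) \<oplus> e"] e by (simp add: epow_def od)
  qed
qed

text \<open>\<open>epow\<close> halves its exponents, so the period is twice the order of the
  multiplicative group.\<close>

lemma epow_period:
  assumes fin: "finite (carrier F)"
  shows "epow e (a + int (2 * (card (carrier F) - 1))) b = epow e a b"
    and "epow e a (b + int (2 * (card (carrier F) - 1))) = epow e a b"
proof -
  have d: "(a + int (2 * n)) div 2 = a div 2 + int n" "even (a + int (2 * n)) = even a" for a n by simp_all
  show "epow e (a + int (2 * (card (carrier F) - 1))) b = epow e a b"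
    "epow e a (b + int (2 * (card (carrier F) - 1))) = epow e a b"
    unfolding epow_def d using pw_period[OF fin] gh_carrier by simp_all
qed

lemma epow_simps: "epow e 0 0 = \<one>" "epow e 1 0 = e" "epow e 2 0 = Q e"
  using e gh_carrier by (simp_all add: epow_def)

end

lemma nmul_card:
  assumes fin: "finite (carrier F)" and v: "v \<in> carrier F"
  shows "nmul (card (carrier F)) v = \<zero>"
proof -
  have "v [^]\<^bsub>add_monoid F\<^esub> n = nmul n v" for n :: nat
    using v by (induction n) simp_all
  moreover have "v [^]\<^bsub>add_monoid F\<^esub> order (add_monoid F) = \<zero>"
    using group.pow_order_eq_1[OF add_group, of v] v by simp
  ultimately show ?thesis by (simp add: order_def)
qed

text \<open>On elements \<open>epow\<close>, \<gamma> becomes a lattice form that vanishes on the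
  diagonal by \<open>I_epow\<close>. Its invariance moves a factor e between the arguments, from (e,
  1) to (1, e) and from (e^2, 1) to (e, e). For e = 0 and e = -1, where the powers degenerate,
  additivity suffices.\<close>

lemma biadditive_inversion_form:
  assumes fin: "finite (carrier F)"
    and cl: "\<And>x y. x \<in> carrier F \<Longrightarrow> y \<in> carrier F \<Longrightarrow> \<gamma> x y \<in> carrier F"
    and add1: "\<And>x x' y. x \<in> carrier F \<Longrightarrow> x' \<in> carrier F \<Longrightarrow> y \<in> carrier F \<Longrightarrow> \<gamma> (x \<oplus> x') y = \<gamma> x y \<oplus> \<gamma> x' y"
    and add2: "\<And>x y y'. x \<in> carrier F \<Longrightarrow> y \<in> carrier F \<Longrightarrow> y' \<in> carrier F \<Longrightarrow> \<gamma> x (y \<oplus> y') = \<gamma> x y \<oplus> \<gamma> x y'"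
    and inversion: "\<And>x. x \<in> carrier F \<Longrightarrow> \<gamma> x (I x) = \<zero>"
    and e: "e \<in> carrier F"
  shows "\<gamma> e \<one> = \<gamma> \<one> e" "\<gamma> e e = \<gamma> (Q e) \<one>"
proof -
  have "\<gamma> e \<one> = \<gamma> \<one> e \<and> \<gamma> e e = \<gamma> (Q e) \<one>"
  proof (cases "e = \<zero> \<or> e \<oplus> \<one> = \<zero>")
    case True
    have z: "\<gamma> \<zero> y = \<zero>" "\<gamma> y \<zero> = \<zero>" if "y \<in> carrier F" for y
      using add1[of \<zero> \<zero> y] add2[of y \<zero> \<zero>] cl[of \<zero> y] cl[of y \<zero>] that by simp_all
    have m1: "\<gamma> (\<ominus> \<one>) y = \<ominus> \<gamma> \<one> y" "\<gamma> y (\<ominus> \<one>) = \<ominus> \<gamma> y \<one>" if "y \<in> carrier F" for y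
      using add1[of "\<ominus> \<one>" \<one> y] add2[of y "\<ominus> \<one>" \<one>] cl[of "\<ominus> \<one>" y] cl[of y "\<ominus> \<one>"] cl[of \<one> y] cl[of y \<one>] z[of y] that
      by (simp_all add: l_neg ag_simps)
    show ?thesis
    proof (cases "e = \<zero>")
      case False
      then have "e = \<ominus> \<one>" using True e by (simp add: ag_simps)
      then show ?thesis using m1[of \<one>] m1[of "\<ominus> \<one>"] cl[of \<one> \<one>] by (simp add: Q_minus)
    qed (use z in simp)
  next
    case False
    then have e': "e \<in> carrier F" "e \<noteq> \<zero>" "e \<oplus> \<one> \<noteq> \<zero>" using e by auto
    define f where "f a b c d = \<gamma> (epow e a b) (epow e c d)" for a b c d
    define N where "N = card (carrier F) - 1"
    define M where "M = 2 * N"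
    have N: "card (carrier F) = Suc N" "N > 0"
    proof -
      have "card {\<zero>, \<one>} \<le> card (carrier F)" by (rule card_mono) (use fin in auto)
      then show "card (carrier F) = Suc N" "N > 0" using zero_not_one by (simp_all add: N_def)
    qed
    note mc = epow_carrier[OF e']
    have lf: "lattice_form (int M) f"
      unfolding lattice_form_def f_def
      using epow_period[OF e' fin] mc cl
      by (simp add: epow_add[OF e'] add1 add2 M_def N_def)
    have diag: "f a b (- a) (- b) = \<zero>" for a b
      using inversion[OF mc, of a b] by (simp add: f_def I_epow[OF e'])
    \<comment> \<open>Multiplying by |F| annihilates v, so N v = -v and M v = -2v.\<close>
    have tf: "v = \<zero>" if v: "v \<in> carrier F" "nmul M v = \<zero>" for v
    proof -
      have "nmul N v = \<ominus> v" using nmul_card[OF fin v(1)] v(1) N(1) by (simp add: ag_simps)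
      then have "\<ominus> v \<oplus> \<ominus> v = \<zero>" using nmul_add[OF v(1), of N N] v(2) by (simp add: M_def mult_2)
      then have "v \<oplus> v = \<zero>" using v(1) by (simp add: ag_simps)
      then show ?thesis using double_cancel v(1) by blast
    qed
    have inv: "f (a + 1) b c d = f a b (c + 1) d" for a b c d
    proof (rule lattice_form_invariant[OF lf diag])
      show "M > 0" using N by (simp add: M_def)
    qed (rule tf)
    have "f 1 0 0 0 = f 0 0 1 0" "f 2 0 0 0 = f 1 0 1 0"
      using inv[of 0 0 0 0] inv[of 1 0 0 0] by simp_all
    then show ?thesis by (simp add: f_def epow_simps[OF e'] add.commute)
  qed
  then show "\<gamma> e \<one> = \<gamma> \<one> e" "\<gamma> e e = \<gamma> (Q e) \<one>" by auto
qed

end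

section \<open>Differences of the Hua map\<close>

context odd_KT_nearfield begin

primrec DD :: "'a list \<Rightarrow> ('a \<Rightarrow> 'a) \<Rightarrow> 'a \<Rightarrow> 'a" where
  "DD [] f = f"
| "DD (a # as) f = (\<lambda>c. DD as f (c \<oplus> a) \<ominus> DD as f c)"

lemma D2_DD: "D2 c x y = DD [x, y] Q c"
  by (simp add: D2_def)

lemma DD_append: "DD (as @ bs) f = DD as (DD bs f)"
  by (induction as) simp_all

lemma DD_closed:
  "(\<And>c. c \<in> carrier F \<Longrightarrow> f c \<in> carrier F) \<Longrightarrow> set as \<subseteq> carrier F \<Longrightarrow> c \<in> carrier F \<Longrightarrow> DD as f c \<in> carrier F"
  by (induction as arbitrary: c) auto

lemma DD_cong:
  "(\<And>c. c \<in> carrier F \<Longrightarrow> f c = g c) \<Longrightarrow> set as \<subseteq> carrier F \<Longrightarrow> c \<in> carrier F \<Longrightarrow> DD as f c = DD as g c"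
  by (induction as arbitrary: c) auto

lemma DD_const:
  assumes "\<And>c. c \<in> carrier F \<Longrightarrow> f c = k" "k \<in> carrier F" "set as \<subseteq> carrier F" "as \<noteq> []" "c \<in> carrier F"
  shows "DD as f c = \<zero>"
  using assms(3-5)
proof (induction as arbitrary: c)
  case (Cons a as)
  then show ?case using assms(1,2) by (cases "as = []") (simp_all add: ag_simps)
qed simp

lemma DD_swap:
  assumes f: "\<And>c. c \<in> carrier F \<Longrightarrow> f c \<in> carrier F" and as: "set as \<subseteq> carrier F"
    and ab: "a \<in> carrier F" "b \<in> carrier F" and c: "c \<in> carrier F"
  shows "DD (a # b # as) f c = DD (b # a # as) f c"
proof -
  have g: "DD as f c \<in> carrier F" if "c \<in> carrier F" for c using DD_closed[of f as] f as that by blast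
  have "c \<oplus> a \<oplus> b = c \<oplus> b \<oplus> a" using ab c by (simp add: a_ac)
  then show ?thesis using g ab c by (simp add: ag_simps)
qed

lemma DD_move:
  assumes f: "\<And>c. c \<in> carrier F \<Longrightarrow> f c \<in> carrier F" and "set as \<subseteq> carrier F" "set bs \<subseteq> carrier F"
    and a: "a \<in> carrier F" and "c \<in> carrier F"
  shows "DD (bs @ a # as) f c = DD (a # bs @ as) f c"
  using assms(3,5)
proof (induction bs arbitrary: c)
  case (Cons b bs)
  then have "DD ((b # bs) @ a # as) f c = DD (b # a # bs @ as) f c" using a by simp
  also have "\<dots> = DD (a # b # bs @ as) f c"
    by (rule DD_swap) (use assms Cons.prems in auto)
  finally show ?case by simp
qed simp

lemma DD_mset:
  assumes f: "\<And>c. c \<in> carrier F \<Longrightarrow> f c \<in> carrier F" and "mset as = mset bs" "set as \<subseteq> carrier F" "c \<in> carrier F"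
  shows "DD as f c = DD bs f c"
  using assms(2-4)
proof (induction as arbitrary: bs c)
  case (Cons a as)
  have "a \<in> set bs" using Cons.prems(1) by (metis list.set_intros(1) set_mset_mset)
  then obtain b1 b2 where b: "bs = b1 @ a # b2" by (meson split_list)
  have m: "mset as = mset (b1 @ b2)" using Cons.prems(1) b by simp
  have sb: "set bs \<subseteq> carrier F" using Cons.prems(1,2) by (metis set_mset_mset)
  have IH: "DD as f c = DD (b1 @ b2) f c" if "c \<in> carrier F" for c
    using Cons.IH[OF m _ that] Cons.prems by simp
  have "DD bs f c = DD (a # b1 @ b2) f c"
    unfolding b by (rule DD_move) (use f sb b Cons.prems in auto)
  then show ?case using IH[of c] IH[of "c \<oplus> a"] Cons.prems by simp
qed simp

section \<open>Forward differences in characteristic p\<close>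

primrec dseq :: "nat \<Rightarrow> (nat \<Rightarrow> 'a) \<Rightarrow> nat \<Rightarrow> 'a" where
  "dseq 0 z i = z i"
| "dseq (Suc k) z i = dseq k z (Suc i) \<ominus> dseq k z i"

lemma dseq_closed: "(\<And>i. z i \<in> carrier F) \<Longrightarrow> dseq k z i \<in> carrier F"
  by (induction k arbitrary: i) simp_all

lemma partial_sum_closed: "(\<And>i. z i \<in> carrier F) \<Longrightarrow> partial_sum z m \<in> carrier F"
  by (induction m) simp_all

lemma partial_sum_add:
  "(\<And>i. z i \<in> carrier F) \<Longrightarrow> (\<And>i. y i \<in> carrier F) \<Longrightarrow>
    partial_sum (\<lambda>i. z i \<oplus> y i) m = partial_sum z m \<oplus> partial_sum y m"
  by (induction m) (simp_all add: a_ac partial_sum_closed)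

lemma partial_sum_pascal:
  assumes u: "\<And>i. u i \<in> carrier F"
  shows "partial_sum (\<lambda>k. nmul (Suc n choose k) (u k)) (Suc m)
    = partial_sum (\<lambda>k. nmul (n choose k) (u k)) (Suc m) \<oplus> partial_sum (\<lambda>k. nmul (n choose k) (u (Suc k))) m"
proof (induction m)
  case (Suc m)
  have c: "partial_sum (\<lambda>k. nmul (n choose k) (u k)) j \<in> carrier F"
    "partial_sum (\<lambda>k. nmul (n choose k) (u (Suc k))) j \<in> carrier F" for j
    using u by (auto intro!: partial_sum_closed)
  show ?case unfolding partial_sum.simps(2)[of _ "Suc m"] Suc
    using c[of "Suc m"] c[of m] u by (simp add: nmul_add a_ac del: partial_sum.simps) (simp add: a_ac c u)
qed (use u in simp)

lemma newton_forward:
  assumes z: "\<And>i. z i \<in> carrier F"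
  shows "z (i + n) = partial_sum (\<lambda>k. nmul (n choose k) (dseq k z i)) (Suc n)"
proof (induction n arbitrary: i)
  case (Suc n)
  note c = dseq_closed[of z, OF z]
  have "z (i + Suc n) = partial_sum (\<lambda>k. nmul (n choose k) (dseq k z (Suc i))) (Suc n)"
    using Suc[of "Suc i"] by simp
  also have "(\<lambda>k. nmul (n choose k) (dseq k z (Suc i)))
    = (\<lambda>k. nmul (n choose k) (dseq k z i) \<oplus> nmul (n choose k) (dseq (Suc k) z i))"
  proof
    fix k
    have "dseq k z (Suc i) = dseq k z i \<oplus> dseq (Suc k) z i" using c by (simp add: ag_simps)
    then show "nmul (n choose k) (dseq k z (Suc i))
      = nmul (n choose k) (dseq k z i) \<oplus> nmul (n choose k) (dseq (Suc k) z i)"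
      using c by (metis nmul_distrib)
  qed
  also have "partial_sum \<dots> (Suc n) = partial_sum (\<lambda>k. nmul (n choose k) (dseq k z i)) (Suc n)
      \<oplus> partial_sum (\<lambda>k. nmul (n choose k) (dseq (Suc k) z i)) (Suc n)"
    using c by (intro partial_sum_add nmul_closed)
  also have "partial_sum (\<lambda>k. nmul (n choose k) (dseq k z i)) (Suc n)
    = partial_sum (\<lambda>k. nmul (n choose k) (dseq k z i)) (Suc (Suc n))"
    using c partial_sum_closed[of "\<lambda>k. nmul (n choose k) (dseq k z i)" "Suc n"]
    by (simp add: binomial_eq_0 del: dseq.simps)
  also have "partial_sum (\<lambda>k. nmul (n choose k) (dseq k z i)) (Suc (Suc n))
      \<oplus> partial_sum (\<lambda>k. nmul (n choose k) (dseq (Suc k) z i)) (Suc n)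
    = partial_sum (\<lambda>k. nmul (Suc n choose k) (dseq k z i)) (Suc (Suc n))"
    using partial_sum_pascal[of "\<lambda>k. dseq k z i" n "Suc n"] c by simp
  finally show ?case .
qed (use z in simp)

lemma nmul_dvd:
  assumes "\<And>v. v \<in> carrier F \<Longrightarrow> nmul p v = \<zero>" "p dvd m" "v \<in> carrier F"
  shows "nmul m v = \<zero>"
  using assms by (metis dvd_def mult.commute nmul_mult nmul_zero)

text \<open>With S the shift of sequences, (S - 1)^p = S^p - 1 in characteristic p: the inner
  binomial coefficients in \<open>newton_forward\<close> are divisible by p.\<close>

lemma dseq_prime:
  assumes p: "Factorial_Ring.prime p" "\<And>v. v \<in> carrier F \<Longrightarrow> nmul p v = \<zero>"
    and z: "\<And>i. z i \<in> carrier F" and per: "z p = z 0"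
  shows "dseq p z 0 = \<zero>"
proof -
  note c = dseq_closed[of z, OF z]
  have "partial_sum (\<lambda>k. nmul (p choose k) (dseq k z 0)) m = z 0" if "m > 0" "m \<le> p" for m
    using that
  proof (induction m)
    case (Suc m)
    show ?case
    proof (cases "m = 0")
      case False
      have "p dvd (p choose m)" using dvd_choose_prime[of m p] p False Suc.prems by simp
      then have "nmul (p choose m) (dseq m z 0) = \<zero>" using nmul_dvd[OF p(2)] c by blast
      then show ?thesis using Suc False z by simp
    qed (use z in simp)
  qed simp
  then have "z p = z 0 \<oplus> dseq p z 0"
    using newton_forward[of z 0 p] z p(1) c by (simp add: prime_gt_0_nat)
  then show ?thesis using per z[of 0] c by simp
qed

lemma DD_replicate:
  assumes f: "\<And>c. c \<in> carrier F \<Longrightarrow> f c \<in> carrier F" and a: "a \<in> carrier F" and c: "c \<in> carrier F"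
  shows "DD (replicate k a) f (c \<oplus> nmul i a) = dseq k (\<lambda>i. f (c \<oplus> nmul i a)) i"
proof (induction k arbitrary: i)
  case (Suc k)
  have e: "c \<oplus> nmul i a \<oplus> a = c \<oplus> nmul (Suc i) a" using a c by (simp add: a_ac)
  have "DD (replicate (Suc k) a) f (c \<oplus> nmul i a)
    = DD (replicate k a) f (c \<oplus> nmul i a \<oplus> a) \<ominus> DD (replicate k a) f (c \<oplus> nmul i a)" by simp
  then show ?case unfolding e Suc by simp
qed simp

lemma DD_replicate_prime:
  assumes p: "Factorial_Ring.prime p" "\<And>v. v \<in> carrier F \<Longrightarrow> nmul p v = \<zero>"
    and f: "\<And>c. c \<in> carrier F \<Longrightarrow> f c \<in> carrier F" and a: "a \<in> carrier F" and c: "c \<in> carrier F"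
  shows "DD (replicate p a) f c = \<zero>"
  using DD_replicate[of f a c p 0] dseq_prime[OF p, of "\<lambda>i. f (c \<oplus> nmul i a)"] f a c p(2)[OF a] by simp

text \<open>By the pigeonhole principle some direction occurs at least p times, and p differences in
  the same direction vanish because p steps lead back to the start.\<close>

lemma DD_nilpotent:
  assumes p: "Factorial_Ring.prime p" "\<And>v. v \<in> carrier F \<Longrightarrow> nmul p v = \<zero>" and fin: "finite (carrier F)"
    and f: "\<And>c. c \<in> carrier F \<Longrightarrow> f c \<in> carrier F" and as: "set as \<subseteq> carrier F"
    and len: "length as > p * card (carrier F)" and c: "c \<in> carrier F"
  shows "DD as f c = \<zero>"
proof -
  have "\<exists>a\<in>carrier F. p \<le> count_list as a"
  proof (rule ccontr)
    assume "\<not> ?thesis"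
    then have "sum (count_list as) (carrier F) \<le> sum (\<lambda>_. p) (carrier F)" by (intro sum_mono) auto
    then show False using sum_count_set[OF as fin] len by (simp add: mult.commute)
  qed
  then obtain a where a: "a \<in> carrier F" "p \<le> count_list as a" by blast
  have "replicate_mset p a \<subseteq># mset as"
    using a(2) by (simp add: count_le_replicate_mset_subset_eq[symmetric] count_mset)
  then obtain B where B: "mset as = B + replicate_mset p a" by (metis add.commute subset_mset.le_iff_add)
  obtain bs where bs: "mset bs = B" using ex_mset by blast
  have m: "mset as = mset (bs @ replicate p a)" using B bs by simp
  have sbs: "set bs \<subseteq> carrier F" using m as by (metis Un_subset_iff set_append set_mset_mset)
  have "DD as f c = DD bs (DD (replicate p a) f) c"
    using DD_mset[OF f m as c] by (simp add: DD_append)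
  also have "\<dots> = DD bs (\<lambda>_. \<zero>) c"
    by (rule DD_cong) (use DD_replicate_prime[OF p f a(1)] sbs c in auto)
  also have "\<dots> = \<zero>" using DD_const[of "\<lambda>_. \<zero>" \<zero> bs c] sbs c by (cases "bs = []") auto
  finally show ?thesis .
qed

lemma nmul_one: "v \<in> carrier F \<Longrightarrow> nmul n v = nmul n \<one> \<otimes> v"
  by (induction n) (simp_all add: right_distrib)

text \<open>The least positive multiple of 1 that vanishes is prime, as (ab) 1 = (a 1)(b 1) and
  there are no zero divisors.\<close>

lemma ex_characteristic:
  assumes "0 < n" "nmul n \<one> = \<zero>"
  obtains p where "Factorial_Ring.prime p" "\<And>v. v \<in> carrier F \<Longrightarrow> nmul p v = \<zero>"
proof -
  define P where "P n \<longleftrightarrow> n > 0 \<and> nmul n \<one> = \<zero>" for n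
  have "P n" using assms by (simp add: P_def)
  then obtain p where p: "P p" "\<And>n. n < p \<Longrightarrow> \<not> P n" using exists_least_iff[of P] by blast
  have "p \<noteq> 1" using p(1) by (auto simp: P_def)
  moreover have "False" if "p = a * b" "a < p" "b < p" for a b
  proof -
    have "nmul a \<one> \<otimes> nmul b \<one> = \<zero>"
      using p(1) that(1) nmul_mult[of \<one> a b] nmul_one[of "nmul b \<one>" a] by (simp add: P_def)
    then have "nmul a \<one> = \<zero> \<or> nmul b \<one> = \<zero>" by simp
    moreover have "a > 0" "b > 0" using p(1) that(1) by (auto simp: P_def)
    ultimately show False using p(2)[OF that(2)] p(2)[OF that(3)] by (auto simp: P_def)
  qed
  ultimately have "Factorial_Ring.prime p"
    using p(1) unfolding P_def prime_nat_iff
    by (metis One_nat_def Suc_lessI dvd_def dvd_imp_le le_neq_implies_less mult.commute mult.right_neutral nat_mult_eq_cancel1)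
  moreover have "nmul p v = \<zero>" if "v \<in> carrier F" for v
    using p(1) nmul_one[OF that] that by (simp add: P_def)
  ultimately show ?thesis using that by blast
qed

text \<open>
  The top-order differences of a function on the finite group \<open>F\<close> are additive in every direction.
  If the order exceeds two, they give a form to which the lemma
  \<open>biadditive_inversion_form\<close> applies, by the relations \<^term>\<open>const_diff e (I e)\<close> and \<^term>\<open>const_diff \<one> y\<close>.
\<close>

lemma differences_descend:
  assumes fin: "finite (carrier F)"
    and IH: "\<And>as x y c. length as = Suc n \<Longrightarrow> set as \<subseteq> carrier F \<Longrightarrow> x \<in> carrier F \<Longrightarrow> y \<in> carrier F \<Longrightarrow> c \<in> carrier F
      \<Longrightarrow> DD (x # y # as) Q c = \<zero>"
    and as: "length as = n" "set as \<subseteq> carrier F" "as \<noteq> []"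
    and xy: "x \<in> carrier F" "y \<in> carrier F" and c: "c \<in> carrier F"
  shows "DD (x # y # as) Q c = \<zero>"
proof -
  define f where "f = DD as Q"
  have f: "f c \<in> carrier F" if "c \<in> carrier F" for c unfolding f_def using DD_closed[of Q as c] as that by simp
  have D: "DD (x # y # as) Q = DD [x, y] f" for x y by (simp add: f_def)
  define \<gamma> where "\<gamma> x y = DD [x, y] f \<zero>" for x y
  have cl: "DD [x, y] f c \<in> carrier F" if "x \<in> carrier F" "y \<in> carrier F" "c \<in> carrier F" for x y c
    using f that by simp
  have const: "DD [x, y] f c = \<gamma> x y" if "x \<in> carrier F" "y \<in> carrier F" "c \<in> carrier F" for x y c
  proof -
    have "DD (c # x # y # as) Q \<zero> = \<zero>" by (rule IH) (use as that in auto)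
    then have "DD [x, y] f (\<zero> \<oplus> c) \<ominus> DD [x, y] f \<zero> = \<zero>" by (simp add: f_def)
    then show ?thesis using cl that by (simp add: \<gamma>_def ag_simps del: DD.simps)
  qed
  have sym: "\<gamma> x y = \<gamma> y x" if "x \<in> carrier F" "y \<in> carrier F" for x y
    unfolding \<gamma>_def using DD_swap[of f "[]" x y \<zero>] f that by simp
  have add1: "\<gamma> (x \<oplus> x') y = \<gamma> x y \<oplus> \<gamma> x' y" if "x \<in> carrier F" "x' \<in> carrier F" "y \<in> carrier F" for x x' y
  proof -
    have "DD [x \<oplus> x', y] f \<zero> = DD [x', y] f \<zero> \<oplus> DD [x, y] f (\<zero> \<oplus> x')"
      using f that by (simp add: ag_simps)
    then show ?thesis using const[of x y "\<zero> \<oplus> x'"] cl that by (simp add: \<gamma>_def a_comm del: DD.simps)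
  qed
  \<comment> \<open>Move x and y next to Q, where their second difference is constant; the
    differences along the nonempty list \<open>as\<close> then annihilate it.\<close>
  have rel0: "\<gamma> x y = \<zero>" if "const_diff x y" "x \<in> carrier F" "y \<in> carrier F" for x y
  proof -
    have k: "DD [x, y] Q c = D2 \<zero> x y" if "c \<in> carrier F" for c
      unfolding D2_DD[symmetric] using \<open>const_diff x y\<close> that by (rule const_diffD)
    have "DD ([x, y] @ as) Q \<zero> = DD (as @ [x, y]) Q \<zero>"
      by (rule DD_mset) (use as that in auto)
    also have "\<dots> = DD as (DD [x, y] Q) \<zero>" by (rule fun_cong[OF DD_append])
    also have "\<dots> = \<zero>"
      by (rule DD_const[OF k]) (use as that in auto)
    finally show ?thesis by (simp add: \<gamma>_def f_def)
  qed
  have \<gamma>c: "\<gamma> x y \<in> carrier F" if "x \<in> carrier F" "y \<in> carrier F" for x y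
    unfolding \<gamma>_def using cl that zero_closed by blast
  have add2: "\<gamma> x (y \<oplus> y') = \<gamma> x y \<oplus> \<gamma> x y'" if "x \<in> carrier F" "y \<in> carrier F" "y' \<in> carrier F" for x y y'
    using that add1[of y y' x] sym[of x "y \<oplus> y'"] sym[of x y] sym[of x y'] by simp
  have inv: "\<gamma> x (I x) = \<zero>" if "x \<in> carrier F" for x
    using rel0[of x "I x"] const_diff_I[of x \<one>] that by simp
  have diag: "\<gamma> e e = \<zero>" if e: "e \<in> carrier F" for e
  proof -
    have "\<gamma> e e = \<gamma> (Q e) \<one>"
      by (rule biadditive_inversion_form(2)[of \<gamma>]) (use fin \<gamma>c add1 add2 inv e in auto)
    also have "\<dots> = \<gamma> \<one> (Q e)" using sym e by simp
    also have "\<dots> = \<zero>" using rel0[OF const_diff_KK[OF KK_one]] e by simp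
    finally show ?thesis .
  qed
  \<comment> \<open>Polarisation: \<gamma> is symmetric and vanishes on equal arguments, so 2
    \<gamma> x y = 0.\<close>
  have "\<gamma> (x \<oplus> y) (x \<oplus> y) = \<gamma> x x \<oplus> \<gamma> y x \<oplus> (\<gamma> x y \<oplus> \<gamma> y y)"
    using add1 add2 xy by simp
  then have "\<gamma> x y \<oplus> \<gamma> x y = \<zero>" using diag xy \<gamma>c sym[of x y] by simp
  then have "\<gamma> x y = \<zero>" using double_cancel \<gamma>c xy by blast
  then show ?thesis using const xy c unfolding D by simp
qed

text \<open>\<open>P n\<close> concerns differences with n directions beyond two. The descent starts
  where \<open>DD_nilpotent\<close> applies and stops at n = 1, since
  \<open>differences_descend\<close> needs a surplus direction. Vanishing third differences say
  precisely that second differences do not depend on the base point.\<close>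

lemma const_diff_self_finite:
  assumes fin: "finite (carrier F)" and e: "e \<in> carrier F"
  shows "const_diff e e"
proof -
  obtain p where p: "Factorial_Ring.prime p" "\<And>v. v \<in> carrier F \<Longrightarrow> nmul p v = \<zero>" 
    using ex_characteristic[of "card (carrier F)"] nmul_card[OF fin] fin one_carrier by (metis card_gt_0_iff empty_iff)
  define P where "P n \<longleftrightarrow> (\<forall>as x y c. length as = n \<longrightarrow> set as \<subseteq> carrier F \<longrightarrow> x \<in> carrier F \<longrightarrow> y \<in> carrier F
    \<longrightarrow> c \<in> carrier F \<longrightarrow> DD (x # y # as) Q c = \<zero>)" for n
  define N where "N = Suc (p * card (carrier F))"
  have base: "P N"
    unfolding P_def
  proof (intro allI impI)
    fix as x y c assume "length as = N" "set as \<subseteq> carrier F" "x \<in> carrier F" "y \<in> carrier F" "c \<in> carrier F"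
    then show "DD (x # y # as) Q c = \<zero>"
      by (intro DD_nilpotent[OF p fin]) (auto simp: N_def)
  qed
  have step: "P n" if "P (Suc n)" "n > 0" for n
    unfolding P_def
  proof (intro allI impI)
    fix as x y c
    assume h: "length as = n" "set as \<subseteq> carrier F" "x \<in> carrier F" "y \<in> carrier F" "c \<in> carrier F"
    have IH: "DD (x # y # as) Q c = \<zero>" if "length as = Suc n" "set as \<subseteq> carrier F" "x \<in> carrier F" "y \<in> carrier F"
      "c \<in> carrier F" for as x y c
      using \<open>P (Suc n)\<close> that unfolding P_def by blast
    show "DD (x # y # as) Q c = \<zero>"
      by (rule differences_descend[OF fin IH h(1,2) _ h(3-5)]) (use h \<open>n > 0\<close> in auto)
  qed
  have "P (N - k)" if "k < N" for k
    using that
  proof (induction k)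
    case (Suc k)
    then show ?case using step[of "N - Suc k"] by (simp add: Suc_diff_Suc)
  qed (use base in simp)
  from this[of "p * card (carrier F)"] have P1: "P 1" by (simp add: N_def)
  show ?thesis
  proof (rule const_diffI)
    fix c assume c: "c \<in> carrier F"
    have "DD [c, e, e] Q \<zero> = \<zero>" using P1[unfolded P_def, rule_format, of "[e]" c e \<zero>] c e by simp
    then have "DD [e, e] Q (\<zero> \<oplus> c) \<ominus> DD [e, e] Q \<zero> = \<zero>" by simp
    then show "D2 c e e = D2 \<zero> e e" using c e by (simp add: D2_def ag_simps)
  qed
qed

lemma finite_carrier_if_finite_KK:
  assumes "finite KK" "finite_dim_over_kernel F"
  shows "finite (carrier F)"
proof -
  obtain B where B: "finite_kernel_basis F B" using assms(2) unfolding finite_dim_over_kernel_def by blast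
  have "carrier F \<subseteq> (\<lambda>c. finsum F (\<lambda>b. c b \<otimes> b) B) ` (B \<rightarrow>\<^sub>E KK)"
    using B unfolding finite_kernel_basis_def by blast
  moreover have "finite (B \<rightarrow>\<^sub>E KK)" using B assms(1) by (intro finite_PiE) (auto simp: finite_kernel_basis_def)
  ultimately show ?thesis by (meson finite_imageI finite_subset)
qed

lemma const_diff_self: "finite_dim_over_kernel F \<Longrightarrow> e \<in> carrier F \<Longrightarrow> const_diff e e"
  using const_diff_self_finite finite_carrier_if_finite_KK const_diff_self_infinite by blast

end

section \<open>The polar form of the Hua map\<close>

locale finite_dim_KT_nearfield = odd_KT_nearfield +
  assumes fin_dim: "finite_dim_over_kernel F"
begin

lemma parallelogram:
  "x \<in> carrier F \<Longrightarrow> y \<in> carrier F \<Longrightarrow> Q (x \<oplus> y) \<oplus> Q (x \<ominus> y) = (Q x \<oplus> Q x) \<oplus> (Q y \<oplus> Q y)"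
  using parallelogram_if_const_diff[OF const_diff_self[OF fin_dim]] by blast

text \<open>By \<open>Q_mult\<close> the left factor is absorbed: z Q(x) = Q(x c) c^-1, where c is
  chosen with \<open>J (I c)\<close> equal to z.\<close>

lemma operator_parallelogram:
  assumes "x \<in> carrier F" "y \<in> carrier F" "z \<in> carrier F"
  shows "z \<otimes> Q (x \<oplus> y) \<oplus> z \<otimes> Q (x \<ominus> y) = (z \<otimes> Q x \<oplus> z \<otimes> Q x) \<oplus> (z \<otimes> Q y \<oplus> z \<otimes> Q y)"
proof (cases "z = \<zero>")
  case False
  define c where "c = J (I z)"
  have c: "c \<in> carrier F" "c \<noteq> \<zero>" "J (I c) = z" using assms False by (simp_all add: c_def I_J)
  have *: "z \<otimes> Q x = Q (x \<otimes> c) \<otimes> J c" if "x \<in> carrier F" for x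
    using that assms c by (simp add: Q_mult m_assoc J_r)
  show ?thesis
    using parallelogram[of "x \<otimes> c" "y \<otimes> c"] assms c
    by (simp add: * right_distrib[symmetric] minus_right_distrib[symmetric])
qed (use assms in simp)

lemma add_right_imp_eq:
  "a \<oplus> c = b \<oplus> c \<Longrightarrow> a \<in> carrier F \<Longrightarrow> b \<in> carrier F \<Longrightarrow> c \<in> carrier F \<Longrightarrow> a = b"
  by simp

text \<open>The Jordan-von Neumann argument: four instances of the parallelogram law combine to
  twice the claim.\<close>

lemma quadratic_cocycle:
  assumes f: "\<And>x. x \<in> carrier F \<Longrightarrow> f x \<in> carrier F"
    and pl: "\<And>x y. x \<in> carrier F \<Longrightarrow> y \<in> carrier F \<Longrightarrow> f (x \<oplus> y) \<oplus> f (x \<ominus> y) = (f x \<oplus> f x) \<oplus> (f y \<oplus> f y)"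
    and xyz: "x \<in> carrier F" "y \<in> carrier F" "z \<in> carrier F"
  shows "f (x \<oplus> y \<oplus> z) \<oplus> f x \<oplus> f y \<oplus> f z = f (x \<oplus> y) \<oplus> f (x \<oplus> z) \<oplus> f (y \<oplus> z)"
proof -
  define A a b d where "A = f (x \<oplus> y \<oplus> z)" and "a = f (x \<oplus> y \<ominus> z)" and "b = f (x \<oplus> z \<ominus> y)" and "d = f (y \<ominus> z)"
  have c: "A \<in> carrier F" "a \<in> carrier F" "b \<in> carrier F" "d \<in> carrier F"
    using f xyz by (simp_all add: A_def a_def b_def d_def)
  have 1: "a = f (x \<oplus> y) \<oplus> f (x \<oplus> y) \<oplus> (f z \<oplus> f z) \<ominus> A"
    using pl[of "x \<oplus> y" z] xyz f c by (simp add: A_def a_def ag_simps)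
  have "x \<oplus> z \<oplus> y = x \<oplus> y \<oplus> z" using xyz by (simp add: a_ac)
  then have 2: "b = f (x \<oplus> z) \<oplus> f (x \<oplus> z) \<oplus> (f y \<oplus> f y) \<ominus> A"
    using pl[of "x \<oplus> z" y] xyz f c by (simp add: A_def b_def ag_simps)
  have "x \<oplus> (y \<ominus> z) = x \<oplus> y \<ominus> z" "x \<ominus> (y \<ominus> z) = x \<oplus> z \<ominus> y" using xyz by (simp_all add: ag_simps)
  then have 3: "a \<oplus> b = (f x \<oplus> f x) \<oplus> (d \<oplus> d)" using pl[of x "y \<ominus> z"] xyz by (simp add: a_def b_def d_def)
  have 4: "d = (f y \<oplus> f y) \<oplus> (f z \<oplus> f z) \<ominus> f (y \<oplus> z)" using pl[of y z] xyz f c by (simp add: d_def ag_simps)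
  note cl = c f[OF xyz(1)] f[OF xyz(2)] f[OF xyz(3)] f[of "x \<oplus> y"] f[of "x \<oplus> z"] f[of "y \<oplus> z"]
  have "(A \<oplus> f x \<oplus> f y \<oplus> f z) \<oplus> (A \<oplus> f x \<oplus> f y \<oplus> f z)
    = (f (x \<oplus> y) \<oplus> f (x \<oplus> z) \<oplus> f (y \<oplus> z)) \<oplus> (f (x \<oplus> y) \<oplus> f (x \<oplus> z) \<oplus> f (y \<oplus> z))"
    (is "?l = ?r")
  proof (rule add_right_imp_eq)
    show "?l \<oplus> (f y \<oplus> f y \<oplus> (f z \<oplus> f z)) = ?r \<oplus> (f y \<oplus> f y \<oplus> (f z \<oplus> f z))"
      using 3 cl xyz unfolding 1 2 4 by (simp add: ag_simps)
  qed (use cl xyz in auto)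
  then have "A \<oplus> f x \<oplus> f y \<oplus> f z = f (x \<oplus> y) \<oplus> f (x \<oplus> z) \<oplus> f (y \<oplus> z)"
    by (rule double_inj[rotated 2]) (use cl xyz in auto)
  then show ?thesis by (simp add: A_def)
qed

section \<open>The triadditive form \<open>P\<close>\<close>

definition P :: "'a \<Rightarrow> 'a \<Rightarrow> 'a \<Rightarrow> 'a" where
  "P x y z = z \<otimes> Q (x \<oplus> y) \<ominus> z \<otimes> Q x \<ominus> z \<otimes> Q y"

lemma P_closed [simp]: "x \<in> carrier F \<Longrightarrow> y \<in> carrier F \<Longrightarrow> z \<in> carrier F \<Longrightarrow> P x y z \<in> carrier F"
  by (simp add: P_def)

lemma P_sym: "x \<in> carrier F \<Longrightarrow> y \<in> carrier F \<Longrightarrow> z \<in> carrier F \<Longrightarrow> P x y z = P y x z"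
proof -
  assume c: "x \<in> carrier F" "y \<in> carrier F" "z \<in> carrier F"
  then have e: "y \<oplus> x = x \<oplus> y" by (simp add: a_comm)
  show ?thesis unfolding P_def e using c by (simp add: ag_simps)
qed

lemma mult_Q_add:
  "x \<in> carrier F \<Longrightarrow> y \<in> carrier F \<Longrightarrow> z \<in> carrier F \<Longrightarrow> z \<otimes> Q (x \<oplus> y) = P x y z \<oplus> z \<otimes> Q x \<oplus> z \<otimes> Q y"
  by (simp add: P_def ag_simps)

lemma P_add3: "x \<in> carrier F \<Longrightarrow> y \<in> carrier F \<Longrightarrow> z \<in> carrier F \<Longrightarrow> z' \<in> carrier F \<Longrightarrow>
    P x y (z \<oplus> z') = P x y z \<oplus> P x y z'"
  by (simp add: P_def right_distrib ag_simps)

lemma P_add1: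
  assumes "x \<in> carrier F" "x' \<in> carrier F" "y \<in> carrier F" "z \<in> carrier F"
  shows "P (x \<oplus> x') y z = P x y z \<oplus> P x' y z"
proof -
  have "z \<otimes> Q (x \<oplus> x' \<oplus> y) = z \<otimes> Q (x \<oplus> x') \<oplus> z \<otimes> Q (x \<oplus> y) \<oplus> z \<otimes> Q (x' \<oplus> y)
      \<ominus> (z \<otimes> Q x \<oplus> z \<otimes> Q x' \<oplus> z \<otimes> Q y)"
    using quadratic_cocycle[of "\<lambda>x. z \<otimes> Q x" x x' y] operator_parallelogram[of _ _ z] assms
    by (simp add: add_minus_eq_simps a_assoc)
  then have "P (x \<oplus> x') y z \<oplus> (z \<otimes> Q x \<oplus> z \<otimes> Q x' \<oplus> (z \<otimes> Q y \<oplus> z \<otimes> Q y) \<oplus> z \<otimes> Q (x \<oplus> x'))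
     = P x y z \<oplus> P x' y z \<oplus> (z \<otimes> Q x \<oplus> z \<otimes> Q x' \<oplus> (z \<otimes> Q y \<oplus> z \<otimes> Q y) \<oplus> z \<otimes> Q (x \<oplus> x'))"
    unfolding mult_Q_add[OF assms(1,3,4)] mult_Q_add[OF assms(2,3,4)] mult_Q_add[OF a_closed[OF assms(1,2)] assms(3,4)]
    using assms by (simp add: ag_simps)
  then show ?thesis by (rule add_right_imp_eq) (use assms in auto)
qed

lemma P_add2: "x \<in> carrier F \<Longrightarrow> y \<in> carrier F \<Longrightarrow> y' \<in> carrier F \<Longrightarrow> z \<in> carrier F \<Longrightarrow>
    P x (y \<oplus> y') z = P x y z \<oplus> P x y' z"
  using P_add1[of y y' x z] by (simp add: P_sym[of x])

lemma P_zero [simp]: "y \<in> carrier F \<Longrightarrow> z \<in> carrier F \<Longrightarrow> P \<zero> y z = \<zero>"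
    "y \<in> carrier F \<Longrightarrow> z \<in> carrier F \<Longrightarrow> P y \<zero> z = \<zero>" "x \<in> carrier F \<Longrightarrow> y \<in> carrier F \<Longrightarrow> P x y \<zero> = \<zero>"
  by (simp_all add: P_def ag_simps)

lemma P_uminus2: "x \<in> carrier F \<Longrightarrow> y \<in> carrier F \<Longrightarrow> z \<in> carrier F \<Longrightarrow> P x (\<ominus> y) z = \<ominus> P x y z"
  using P_add2[of x y "\<ominus> y" z] by (simp add: r_neg ag_simps)

lemma P_uminus1: "x \<in> carrier F \<Longrightarrow> y \<in> carrier F \<Longrightarrow> z \<in> carrier F \<Longrightarrow> P (\<ominus> x) y z = \<ominus> P x y z"
  by (simp add: P_sym[of _ y] P_uminus2)

lemma P_scale3: "x \<in> carrier F \<Longrightarrow> y \<in> carrier F \<Longrightarrow> z \<in> carrier F \<Longrightarrow> k \<in> KK \<Longrightarrow> P x y (k \<otimes> z) = k \<otimes> P x y z"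
  by (simp add: P_def m_assoc left_distrib_minus)

lemma P_self: "x \<in> carrier F \<Longrightarrow> z \<in> carrier F \<Longrightarrow> P x x z = z \<otimes> Q x \<oplus> z \<otimes> Q x"
  using operator_parallelogram[of x x z] by (simp add: P_def ag_simps)

text \<open>\<open>Q_add_main\<close> in terms of P; it later makes \<open>I x\<close> the inverse
  of x in the field.\<close>

lemma P_I: "x \<in> carrier F \<Longrightarrow> x \<noteq> \<zero> \<Longrightarrow> c \<in> carrier F \<Longrightarrow> P c x (I x) = c \<oplus> c"
  using Q_add_main[of x c] by (simp add: P_def I_mult_Q ag_simps)

lemma P_one: "c \<in> carrier F \<Longrightarrow> P c \<one> \<one> = c \<oplus> c" "c \<in> carrier F \<Longrightarrow> P \<one> c \<one> = c \<oplus> c"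
  using P_I[of \<one> c] by (simp_all add: P_sym[of \<one> c])

text \<open>The polar form of \<open>Q_add_factor\<close>, modelling 2xyz = 2 x^-1 y^-1 (x^2 z) y^2.
  If x + y = 0, \<open>P_self\<close> takes its place.\<close>

lemma P_inversion:
  assumes x: "x \<in> carrier F" "x \<noteq> \<zero>" and y: "y \<in> carrier F" "y \<noteq> \<zero>" and z: "z \<in> carrier F"
  shows "P x y z = P (I x) (I y) (z \<otimes> Q x) \<otimes> Q y"
proof (cases "x \<oplus> y = \<zero>")
  case True
  then have "y = \<ominus> x" using x y by (simp add: ag_simps)
  then show ?thesis
    using x z by (simp add: P_uminus2 I_minus Q_minus P_self minus_mult right_distrib Q_l2)
next
  case False
  have "Q (x \<oplus> y) = Q x \<otimes> Q (I x \<oplus> I y) \<otimes> Q y"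
    using Q_add_factor[of y x] x y False by (simp add: a_comm)
  then have "z \<otimes> Q (x \<oplus> y) = z \<otimes> Q x \<otimes> Q (I x \<oplus> I y) \<otimes> Q y" using x y z by (simp add: m_assoc)
  also have "\<dots> = P (I x) (I y) (z \<otimes> Q x) \<otimes> Q y \<oplus> z \<otimes> Q y \<oplus> z \<otimes> Q x"
    using x y z by (simp add: mult_Q_add right_distrib Q_l2 Q_r2)
  finally show ?thesis unfolding P_def[of x y z] using x y z by (simp add: ag_simps)
qed

lemma P_one_I: "x \<in> carrier F \<Longrightarrow> x \<noteq> \<zero> \<Longrightarrow> z \<in> carrier F \<Longrightarrow> P \<one> (I x) z \<otimes> Q x = P \<one> x z"
  using P_inversion[of \<one> x z] by simp

text \<open>If P vanishes, then Q(a + b) = Q(a - b), and \<open>Q_inj\<close> leaves a + b = a - b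
  or a + b = b - a.\<close>

lemma P_eq_zero:
  assumes a: "a \<in> carrier F" and b: "b \<in> carrier F" and z: "z \<in> carrier F" "z \<noteq> \<zero>" and p: "P a b z = \<zero>"
  shows "a = \<zero> \<or> b = \<zero>"
proof -
  have "P a (\<ominus> b) z = \<zero>" using p a b z by (simp add: P_uminus2)
  then have "z \<otimes> Q (a \<oplus> b) = z \<otimes> Q (a \<oplus> \<ominus> b)"
    using p mult_Q_add[of a b z] mult_Q_add[of a "\<ominus> b" z] a b z by (simp add: Q_minus)
  then have "Q (a \<oplus> b) = Q (a \<oplus> \<ominus> b)" using a b z mult_left_cancel by simp
  then have "a \<oplus> b = a \<oplus> \<ominus> b \<or> a \<oplus> b = \<ominus> (a \<oplus> \<ominus> b)" using Q_inj[of "a \<oplus> b" "a \<oplus> \<ominus> b"] a b by blast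
  then have "b \<oplus> b = \<zero> \<or> a \<oplus> a = \<zero>"
  proof
    assume "a \<oplus> b = a \<oplus> \<ominus> b"
    then have "b = \<ominus> b" using a b by simp
    then show ?thesis using b by (metis r_neg)
  next
    assume "a \<oplus> b = \<ominus> (a \<oplus> \<ominus> b)"
    then have "a \<oplus> a \<oplus> b = \<zero> \<oplus> b" using a b by (simp add: ag_simps)
    then show ?thesis using a b add_right_imp_eq[of "a \<oplus> a" b \<zero>] by simp
  qed
  then show ?thesis using double_cancel a b by blast
qed

text \<open>\<open>defect c z\<close> is a derivation on the kernel, so \<open>TT\<close> contains all \<open>p\<close>-th powers of the kernel in
  characteristic \<open>p\<close>, and the prime field in characteristic zero. Hence it is infinite if the kernel is.\<close>

definition TT :: "'a set" where
  "TT = {t \<in> KK. \<forall>c\<in>carrier F. \<forall>z\<in>carrier F. P c t z = t \<otimes> P c \<one> z}"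

definition defect :: "'a \<Rightarrow> 'a \<Rightarrow> 'a \<Rightarrow> 'a" where
  "defect c z k = P c k z \<ominus> k \<otimes> P c \<one> z"

text \<open>Combines \<open>P_inversion\<close> with \<open>mult_Q_KK\<close>, which converts the
  right factor \<open>Q k\<close> into k^2 on the left. The parameters change to c^\<sigma> and z
  Q(c), so \<open>defect_square\<close> has to work with two different additive maps.\<close>

lemma defect_inversion:
  assumes k: "k \<in> KK" "k \<noteq> \<zero>" and c: "c \<in> carrier F" "c \<noteq> \<zero>" and z: "z \<in> carrier F"
  shows "defect c z k = k \<otimes> (k \<otimes> defect (I c) (z \<otimes> Q c) (J k))"
proof -
  have "P c k z = k \<otimes> (k \<otimes> P (I c) (J k) (z \<otimes> Q c))"
    using P_inversion[of c k z] mult_Q_KK[of "P (I c) (J k) (z \<otimes> Q c)" k] k c z by (simp add: I_KK)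
  moreover have "P c \<one> z = P (I c) \<one> (z \<otimes> Q c)" using P_inversion[of c \<one> z] c z by simp
  ultimately show ?thesis using k c z by (simp add: defect_def left_distrib_minus J_simps)
qed

lemma defect_add: "c \<in> carrier F \<Longrightarrow> z \<in> carrier F \<Longrightarrow> k \<in> KK \<Longrightarrow> l \<in> KK \<Longrightarrow>
    defect c z (k \<oplus> l) = defect c z k \<oplus> defect c z l"
  by (simp add: defect_def P_add2 right_distrib ag_simps)

lemma defect_closed [simp]: "c \<in> carrier F \<Longrightarrow> z \<in> carrier F \<Longrightarrow> k \<in> KK \<Longrightarrow> defect c z k \<in> carrier F"
  by (simp add: defect_def)

lemma defect_one [simp]: "c \<in> carrier F \<Longrightarrow> z \<in> carrier F \<Longrightarrow> defect c z \<one> = \<zero>"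
  by (simp add: defect_def ag_simps)

text \<open>An additive map with \<open>\<phi> k = k\<^sup>2 \<psi> (k\<^sup>-\<^sup>1)\<close> is a derivation: expand \<open>\<psi>\<close> on both sides of
  \<open>k\<^sup>-\<^sup>1 - (k + 1)\<^sup>-\<^sup>1 = (k (k + 1))\<^sup>-\<^sup>1\<close>.\<close>

lemma defect_square:
  assumes k: "k \<in> KK" and c: "c \<in> carrier F" and z: "z \<in> carrier F"
  shows "defect c z (k \<otimes> k) = k \<otimes> defect c z k \<oplus> k \<otimes> defect c z k"
proof (cases "c = \<zero> \<or> k = \<zero> \<or> k \<oplus> \<one> = \<zero>")
  case True
  have z0: "defect c z \<zero> = \<zero>" if "c \<in> carrier F" using that z by (simp add: defect_def ag_simps)
  have z1: "defect c z (\<ominus> \<one>) = \<zero>" using defect_add[of c z \<one> "\<ominus> \<one>"] c z z0 by (simp add: r_neg)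
  from True consider "c = \<zero>" | "k = \<zero>" | "k = \<ominus> \<one>" using k by (auto simp: ag_simps)
  then show ?thesis
  proof cases
    case 3
    then show ?thesis using z1 c z by (simp add: minus_mult mult_minus)
  qed (use z0 c z k in \<open>auto simp: defect_def ag_simps\<close>)
next
  case False
  define \<phi> where "\<phi> = defect c z"
  define \<psi> where "\<psi> = defect (I c) (z \<otimes> Q c)"
  define l where "l = k \<oplus> \<one>"
  have l: "l \<in> KK" "l \<noteq> \<zero>" using k False by (simp_all add: l_def)
  have k0: "k \<noteq> \<zero>" "c \<noteq> \<zero>" using False by auto
  have inv: "\<phi> m = m \<otimes> (m \<otimes> \<psi> (J m))" if "m \<in> KK" "m \<noteq> \<zero>" for m
    unfolding \<phi>_def \<psi>_def by (rule defect_inversion) (use that c k0 z in auto)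
  have cl: "\<psi> m \<in> carrier F" "\<phi> m \<in> carrier F" if "m \<in> KK" for m
    using that c z by (simp_all add: \<phi>_def \<psi>_def)
  have "J k = J l \<oplus> J (l \<otimes> k)"
  proof -
    have "l \<otimes> k \<otimes> (J l \<oplus> J (l \<otimes> k)) = l \<otimes> (k \<otimes> J l) \<oplus> \<one>"
      using k l k0 by (simp add: left_distrib J_r m_assoc)
    also have "l \<otimes> (k \<otimes> J l) = k" using KK_lcommute[of l k "J l"] k l by (simp add: J_r)
    also have "k \<oplus> \<one> = l \<otimes> k \<otimes> J k" using k l k0 by (simp add: m_assoc J_r) (simp add: l_def)
    finally show ?thesis using mult_left_cancel[of "J l \<oplus> J (l \<otimes> k)" "J k" "l \<otimes> k"] k l k0 by simp
  qed
  then have "\<psi> (J k) = \<psi> (J l) \<oplus> \<psi> (J (l \<otimes> k))"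
    using defect_add k l c z by (simp add: \<psi>_def)
  then have 1: "l \<otimes> (l \<otimes> (k \<otimes> (k \<otimes> \<psi> (J k)))) = l \<otimes> (l \<otimes> (k \<otimes> (k \<otimes> \<psi> (J l)))) \<oplus> l \<otimes> (l \<otimes> (k \<otimes> (k \<otimes> \<psi> (J (l \<otimes> k)))))"
    using k l cl by (simp add: left_distrib)
  have "l \<otimes> (l \<otimes> (k \<otimes> (k \<otimes> \<psi> (J l)))) = k \<otimes> (k \<otimes> \<phi> l)"
  proof -
    define w where "w = \<psi> (J l)"
    have w: "w \<in> carrier F" using cl l by (simp add: w_def)
    have "l \<otimes> (l \<otimes> (k \<otimes> (k \<otimes> w))) = l \<otimes> (k \<otimes> (l \<otimes> (k \<otimes> w)))"
      using KK_lcommute[of l k "k \<otimes> w"] k l w by simp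
    also have "\<dots> = l \<otimes> (k \<otimes> (k \<otimes> (l \<otimes> w)))" using KK_lcommute[of l k w] k l w by simp
    also have "\<dots> = k \<otimes> (l \<otimes> (k \<otimes> (l \<otimes> w)))" using KK_lcommute[of l k "k \<otimes> (l \<otimes> w)"] k l w by simp
    also have "\<dots> = k \<otimes> (k \<otimes> (l \<otimes> (l \<otimes> w)))" using KK_lcommute[of l k "l \<otimes> w"] k l w by simp
    finally show ?thesis using inv[OF l] by (simp add: w_def)
  qed
  moreover have "l \<otimes> (l \<otimes> (k \<otimes> (k \<otimes> \<psi> (J (l \<otimes> k))))) = \<phi> (l \<otimes> k)"
    using inv[of "l \<otimes> k"] KK_lcommute[of k l "k \<otimes> \<psi> (J (l \<otimes> k))"] k l k0 cl by (simp add: m_assoc)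
  moreover have "l \<otimes> (l \<otimes> (k \<otimes> (k \<otimes> \<psi> (J k)))) = l \<otimes> (l \<otimes> \<phi> k)" using inv[OF k k0(1)] by simp
  ultimately have 2: "l \<otimes> (l \<otimes> \<phi> k) = k \<otimes> (k \<otimes> \<phi> l) \<oplus> \<phi> (l \<otimes> k)" using 1 by simp
  have "\<phi> l = \<phi> k" using defect_add[of c z k \<one>] k c z by (simp add: \<phi>_def l_def)
  moreover have "l \<otimes> k = k \<otimes> k \<oplus> k" using k by (simp add: l_def right_distrib)
  moreover have "\<phi> (k \<otimes> k \<oplus> k) = \<phi> (k \<otimes> k) \<oplus> \<phi> k" using defect_add k c z by (simp add: \<phi>_def)
  ultimately have 3: "l \<otimes> (l \<otimes> \<phi> k) = k \<otimes> (k \<otimes> \<phi> k) \<oplus> (\<phi> (k \<otimes> k) \<oplus> \<phi> k)" using 2 by simp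
  have "l \<otimes> (l \<otimes> \<phi> k) = k \<otimes> (k \<otimes> \<phi> k) \<oplus> (k \<otimes> \<phi> k \<oplus> k \<otimes> \<phi> k) \<oplus> \<phi> k"
    using k cl by (simp add: l_def right_distrib left_distrib a_ac)
  then have "\<phi> (k \<otimes> k) \<oplus> (k \<otimes> (k \<otimes> \<phi> k) \<oplus> \<phi> k) = (k \<otimes> \<phi> k \<oplus> k \<otimes> \<phi> k) \<oplus> (k \<otimes> (k \<otimes> \<phi> k) \<oplus> \<phi> k)"
    using 3 k cl by (simp add: a_ac)
  then have "\<phi> (k \<otimes> k) = k \<otimes> \<phi> k \<oplus> k \<otimes> \<phi> k" by (rule add_right_imp_eq) (use k cl in auto)
  then show ?thesis by (simp add: \<phi>_def)
qed

text \<open>Polarise \<open>defect_square\<close> at k + l and cancel 2.\<close>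

lemma defect_mult:
  assumes k: "k \<in> KK" and l: "l \<in> KK" and c: "c \<in> carrier F" and z: "z \<in> carrier F"
  shows "defect c z (k \<otimes> l) = k \<otimes> defect c z l \<oplus> l \<otimes> defect c z k"
proof -
  define \<phi> where "\<phi> = defect c z"
  have cl: "\<phi> m \<in> carrier F" if "m \<in> KK" for m using that c z by (simp add: \<phi>_def)
  have add: "\<phi> (a \<oplus> b) = \<phi> a \<oplus> \<phi> b" if "a \<in> KK" "b \<in> KK" for a b using that c z defect_add by (simp add: \<phi>_def)
  have sq: "\<phi> (a \<otimes> a) = a \<otimes> \<phi> a \<oplus> a \<otimes> \<phi> a" if "a \<in> KK" for a using that c z defect_square by (simp add: \<phi>_def)
  have "(k \<oplus> l) \<otimes> (k \<oplus> l) = k \<otimes> k \<oplus> k \<otimes> l \<oplus> (k \<otimes> l \<oplus> l \<otimes> l)"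
    using k l KK_commute[of l k] by (simp add: right_distrib left_distrib)
  then have "\<phi> (k \<otimes> k) \<oplus> \<phi> (k \<otimes> l) \<oplus> (\<phi> (k \<otimes> l) \<oplus> \<phi> (l \<otimes> l)) = \<phi> ((k \<oplus> l) \<otimes> (k \<oplus> l))"
    using k l by (simp add: add)
  also have "\<dots> = (k \<oplus> l) \<otimes> (\<phi> k \<oplus> \<phi> l) \<oplus> (k \<oplus> l) \<otimes> (\<phi> k \<oplus> \<phi> l)" using k l sq[of "k \<oplus> l"] by (simp add: add)
  finally have "(\<phi> (k \<otimes> l) \<oplus> \<phi> (k \<otimes> l)) \<oplus> (\<phi> (k \<otimes> k) \<oplus> \<phi> (l \<otimes> l))
      = ((k \<otimes> \<phi> l \<oplus> l \<otimes> \<phi> k) \<oplus> (k \<otimes> \<phi> l \<oplus> l \<otimes> \<phi> k)) \<oplus> (\<phi> (k \<otimes> k) \<oplus> \<phi> (l \<otimes> l))"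
    using k l cl by (simp add: sq right_distrib left_distrib a_ac)
  then have "\<phi> (k \<otimes> l) \<oplus> \<phi> (k \<otimes> l) = (k \<otimes> \<phi> l \<oplus> l \<otimes> \<phi> k) \<oplus> (k \<otimes> \<phi> l \<oplus> l \<otimes> \<phi> k)"
    by (rule add_right_imp_eq) (use k l cl in auto)
  then have "\<phi> (k \<otimes> l) = k \<otimes> \<phi> l \<oplus> l \<otimes> \<phi> k" by (rule double_inj[rotated 2]) (use k l cl in auto)
  then show ?thesis by (simp add: \<phi>_def)
qed

section \<open>Powers in the kernel and the Frobenius map\<close>

primrec kpow :: "'a \<Rightarrow> nat \<Rightarrow> 'a" where
  "kpow k 0 = \<one>"
| "kpow k (Suc n) = k \<otimes> kpow k n"

lemma kpow_KK [simp]: "k \<in> KK \<Longrightarrow> kpow k n \<in> KK"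
  by (induction n) simp_all

lemma kpow_mult: "k \<in> KK \<Longrightarrow> l \<in> KK \<Longrightarrow> kpow (k \<otimes> l) n = kpow k n \<otimes> kpow l n"
proof (induction n)
  case (Suc n)
  then show ?case using KK_lcommute[of l "kpow k n" "kpow l n"] by (simp add: m_assoc)
qed simp

lemma kpow_eq_zero: "k \<in> KK \<Longrightarrow> kpow k n = \<zero> \<Longrightarrow> k = \<zero>"
  by (induction n) auto

text \<open>The power rule for derivations, multiplied by k so that the exponent n - 1 does not
  occur.\<close>

lemma defect_kpow:
  assumes k: "k \<in> KK" and c: "c \<in> carrier F" and z: "z \<in> carrier F"
  shows "k \<otimes> defect c z (kpow k n) = nmul n (kpow k n \<otimes> defect c z k)"
proof (induction n)
  case (Suc n)
  define d where "d = defect c z k"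
  have d: "d \<in> carrier F" using k c z by (simp add: d_def)
  have sc: "k \<otimes> nmul m v = nmul m (k \<otimes> v)" if "v \<in> carrier F" for m v
    using that k by (induction m) (simp_all add: left_distrib)
  have "k \<otimes> defect c z (kpow k (Suc n)) = k \<otimes> (k \<otimes> defect c z (kpow k n) \<oplus> kpow k n \<otimes> d)"
    using defect_mult[of k "kpow k n" c z] k c z by (simp add: d_def)
  also have "\<dots> = k \<otimes> nmul n (kpow k n \<otimes> d) \<oplus> k \<otimes> (kpow k n \<otimes> d)"
    unfolding Suc d_def[symmetric] using k d by (simp add: left_distrib)
  also have "\<dots> = nmul (Suc n) (kpow k (Suc n) \<otimes> d)" using k d sc by (simp add: m_assoc)
  finally show ?case by (simp add: d_def)
qed (use k c z in simp)

lemma kpow_TT: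
  assumes p: "\<And>v. v \<in> carrier F \<Longrightarrow> nmul p v = \<zero>" and k: "k \<in> KK" "k \<noteq> \<zero>"
  shows "kpow k p \<in> TT"
proof -
  have "defect c z (kpow k p) = \<zero>" if "c \<in> carrier F" "z \<in> carrier F" for c z
    using defect_kpow[of k c z p] p k that by simp
  then have "P c (kpow k p) z = kpow k p \<otimes> P c \<one> z" if "c \<in> carrier F" "z \<in> carrier F" for c z
    using that k by (simp add: defect_def ag_simps)
  then show ?thesis using k by (simp add: TT_def)
qed

text \<open>The n-th forward difference of i |-> r^i is (r - 1)^n r^i. If r^p = 1, the sequence
  returns to its start after p steps, and \<open>dseq_prime\<close> gives (r - 1)^p = 0.\<close>

lemma frobenius_inj:
  assumes p: "Factorial_Ring.prime p" "\<And>v. v \<in> carrier F \<Longrightarrow> nmul p v = \<zero>"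
    and r: "r \<in> KK" "kpow r p = \<one>"
  shows "r = \<one>"
proof -
  have d: "dseq n (kpow r) i = kpow (r \<ominus> \<one>) n \<otimes> kpow r i" for n i
  proof (induction n arbitrary: i)
    case (Suc n)
    have "kpow (r \<ominus> \<one>) (Suc n) \<otimes> kpow r i = kpow (r \<ominus> \<one>) n \<otimes> ((r \<ominus> \<one>) \<otimes> kpow r i)"
      using KK_lcommute[of "r \<ominus> \<one>" "kpow (r \<ominus> \<one>) n" "kpow r i"] r by (simp add: m_assoc)
    also have "\<dots> = kpow (r \<ominus> \<one>) n \<otimes> kpow r (Suc i) \<ominus> kpow (r \<ominus> \<one>) n \<otimes> kpow r i"
      using r by (simp add: minus_right_distrib left_distrib_minus)
    finally show ?case unfolding dseq.simps Suc by simp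
  qed (use r in simp)
  have "dseq p (kpow r) 0 = \<zero>" by (rule dseq_prime[OF p]) (use r in auto)
  then have "kpow (r \<ominus> \<one>) p = \<zero>" using d r by simp
  then have "r \<ominus> \<one> = \<zero>" using kpow_eq_zero[of "r \<ominus> \<one>" p] r by simp
  then show ?thesis using r by (simp add: ag_simps)
qed

lemma nmul_TT: "nmul n \<one> \<in> TT"
proof -
  have K: "nmul n \<one> \<in> KK" by (induction n) simp_all
  have "P c (nmul n \<one>) z = nmul n (P c \<one> z)" if "c \<in> carrier F" "z \<in> carrier F" for c z
    using that by (induction n) (simp_all add: P_add2)
  then show ?thesis using K by (simp add: TT_def nmul_one[symmetric])
qed

lemma infinite_TT:
  assumes inf: "infinite KK"
  shows "infinite TT"
proof (cases "\<exists>n>0. nmul n \<one> = \<zero>")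
  case True
  then obtain p where p: "Factorial_Ring.prime p" "\<And>v. v \<in> carrier F \<Longrightarrow> nmul p v = \<zero>"
    using ex_characteristic by blast
  have "inj_on (\<lambda>k. kpow k p) (KK - {\<zero>})"
  proof (rule inj_onI)
    fix k l assume kl: "k \<in> KK - {\<zero>}" "l \<in> KK - {\<zero>}" "kpow k p = kpow l p"
    have "kpow (k \<otimes> J l) p = kpow (l \<otimes> J l) p" using kl by (simp add: kpow_mult)
    also have "\<dots> = \<one>"
    proof -
      have "kpow \<one> p = \<one>" by (induction p) simp_all
      then show ?thesis using kl by (simp add: J_r)
    qed
    finally have "k \<otimes> J l = \<one>" using frobenius_inj[OF p, of "k \<otimes> J l"] kl by simp
    then have "k \<otimes> J l \<otimes> l = l" using kl by simp
    then show "k = l" using kl by (simp add: m_assoc J_l)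
  qed
  moreover have "infinite (KK - {\<zero>})" using inf by simp
  ultimately have "infinite ((\<lambda>k. kpow k p) ` (KK - {\<zero>}))" using finite_imageD by blast
  moreover have "(\<lambda>k. kpow k p) ` (KK - {\<zero>}) \<subseteq> TT" using kpow_TT p by auto
  ultimately show ?thesis using finite_subset by blast
next
  case False
  have "inj (\<lambda>n. nmul n \<one>)"
  proof (rule linorder_injI)
    fix m n :: nat assume "m < n"
    then have "nmul n \<one> = nmul m \<one> \<oplus> nmul (n - m) \<one>" using nmul_add[of \<one> m "n - m"] by simp
    moreover have "nmul (n - m) \<one> \<noteq> \<zero>" using False \<open>m < n\<close> zero_less_diff by blast
    ultimately show "nmul m \<one> \<noteq> nmul n \<one>" by simp
  qed
  then have "infinite (range (\<lambda>n. nmul n \<one>))" using finite_imageD by blast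
  moreover have "range (\<lambda>n. nmul n \<one>) \<subseteq> TT" using nmul_TT by auto
  ultimately show ?thesis using finite_subset by blast
qed

text \<open>The form \<gamma> models 4cxy - 4cxy. At (x, x^\<sigma>) both terms are 4c by
  \<open>P_I\<close>, so \<gamma> vanishes there, and \<gamma>(e, 1) = 0 is twice the claim. It
  follows from \<open>biadditive_inversion_form\<close> if the kernel is finite and from
  \<open>resolvent_span\<close> otherwise.\<close>

lemma P_one_swap:
  assumes c: "c \<in> carrier F" and e: "e \<in> carrier F"
  shows "P c e \<one> = P \<one> c e"
proof -
  define \<gamma> where "\<gamma> x y = (P c x y \<oplus> P c x y) \<ominus> P \<one> c (P \<one> x y)" for x y
  have cl: "\<gamma> x y \<in> carrier F" if "x \<in> carrier F" "y \<in> carrier F" for x y using that c by (simp add: \<gamma>_def)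
  have add1: "\<gamma> (x \<oplus> x') y = \<gamma> x y \<oplus> \<gamma> x' y" if "x \<in> carrier F" "x' \<in> carrier F" "y \<in> carrier F" for x x' y
    using that c by (simp add: \<gamma>_def P_add2 P_add3 ag_simps)
  have add2: "\<gamma> x (y \<oplus> y') = \<gamma> x y \<oplus> \<gamma> x y'" if "x \<in> carrier F" "y \<in> carrier F" "y' \<in> carrier F" for x y y'
    using that c by (simp add: \<gamma>_def P_add3 ag_simps)
  have inv: "\<gamma> x (I x) = \<zero>" if "x \<in> carrier F" for x
  proof (cases "x = \<zero>")
    case False
    then show ?thesis using that c P_I[of x c] P_I[of x \<one>]
      by (simp add: \<gamma>_def P_add3 P_one ag_simps)
  qed (use c in \<open>simp add: \<gamma>_def ag_simps\<close>)
  \<comment> \<open>Here the scalar must lie in \<open>TT\<close>, so that t can be taken out of the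
    second argument of P.\<close>
  have one: "\<gamma> t y = \<zero>" if t: "t \<in> TT" and y: "y \<in> carrier F" for t y
  proof -
    have tK: "t \<in> KK" and tP: "\<And>c z. c \<in> carrier F \<Longrightarrow> z \<in> carrier F \<Longrightarrow> P c t z = t \<otimes> P c \<one> z"
      using t by (auto simp: TT_def)
    have "P \<one> t y = t \<otimes> (y \<oplus> y)" using tP[of \<one> y] y by (simp add: P_self)
    then show ?thesis
      using tK y c tP[of c y] by (simp add: \<gamma>_def P_scale3 P_add3 P_sym[of \<one> c] left_distrib ag_simps)
  qed
  have "\<gamma> e \<one> = \<zero>"
  proof (cases "finite KK")
    case True
    have "\<gamma> e \<one> = \<gamma> \<one> e"
      by (rule biadditive_inversion_form(1)[of \<gamma>])
        (use finite_carrier_if_finite_KK[OF True fin_dim] cl add1 add2 inv e in auto)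
    also have "\<dots> = \<zero>" using one[of \<one> e] nmul_TT[of 1] e by simp
    finally show ?thesis .
  next
    case inf: False
    show ?thesis
    proof (cases "e \<in> KK")
      \<comment> \<open>\<open>resolvent_span\<close> excludes kernel elements; for these both sides
        are 2ec.\<close>
      case True
      have "P c e \<one> = e \<otimes> c \<oplus> e \<otimes> c" using Q_add_KK[OF True c] c e True by (simp add: P_def Q_KK ag_simps)
      moreover have "P \<one> c e = e \<otimes> c \<oplus> e \<otimes> c"
        using P_scale3[of \<one> c \<one> e] c e True by (simp add: P_one left_distrib)
      ultimately show ?thesis using c e True by (simp add: \<gamma>_def P_one P_add3 ag_simps)
    next
      case False
      have TK: "TT \<subseteq> KK" by (auto simp: TT_def)
      define G where "G = {y \<in> carrier F. \<gamma> e y = \<zero>}"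
      have "\<one> \<in> G"
      proof (rule resolvent_span(1)[OF infinite_TT[OF inf] TK fin_dim e False])
        show "x \<oplus> y \<in> G" if "x \<in> G" "y \<in> G" for x y using that e by (auto simp: G_def add2)
        show "k \<otimes> x \<in> G" if "k \<in> KK" "x \<in> G" for k x
        proof -
          have x: "x \<in> carrier F" "\<gamma> e x = \<zero>" using that by (simp_all add: G_def)
          have "\<gamma> e (k \<otimes> x) = k \<otimes> \<gamma> e x"
            using that(1) x(1) c e by (simp add: \<gamma>_def P_scale3 left_distrib left_distrib_minus)
          then show ?thesis using that x by (simp add: G_def)
        qed
        show "I (e \<oplus> t) \<in> G" if "t \<in> TT" for t
        proof -
          have t: "t \<in> carrier F" using that TK by auto
          then have "\<gamma> (e \<oplus> t) (I (e \<oplus> t)) = \<gamma> e (I (e \<oplus> t)) \<oplus> \<gamma> t (I (e \<oplus> t))" using e add1 by simp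
          then show ?thesis using inv[of "e \<oplus> t"] one[OF that, of "I (e \<oplus> t)"] e t cl by (simp add: G_def)
        qed
      qed (auto simp: G_def)
      then show ?thesis by (simp add: G_def)
    qed
  qed
  then have "P c e \<one> \<oplus> P c e \<one> = P \<one> c e \<oplus> P \<one> c e"
    using c e by (simp add: \<gamma>_def P_one P_add3 ag_simps)
  then show ?thesis by (rule double_inj[rotated 2]) (use c e in auto)
qed

section \<open>The commutative field and its coupling\<close>

definition half :: "'a \<Rightarrow> 'a" where
  "half x = J (\<one> \<oplus> \<one>) \<otimes> x"

lemma half_closed [simp]: "x \<in> carrier F \<Longrightarrow> half x \<in> carrier F"
  by (simp add: half_def)

lemma half_double [simp]: "x \<in> carrier F \<Longrightarrow> half (x \<oplus> x) = x"
proof -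
  assume x: "x \<in> carrier F"
  have "x \<oplus> x = (\<one> \<oplus> \<one>) \<otimes> x" using x by (simp add: right_distrib)
  then show ?thesis using x two_neq_zero by (simp add: half_def J_l2)
qed

lemma half_add: "x \<in> carrier F \<Longrightarrow> y \<in> carrier F \<Longrightarrow> half (x \<oplus> y) = half x \<oplus> half y"
  by (simp add: half_def left_distrib)

lemma half_mult: "x \<in> carrier F \<Longrightarrow> y \<in> carrier F \<Longrightarrow> half (x \<otimes> y) = half x \<otimes> y"
  by (simp add: half_def m_assoc)

text \<open>Half the polarisation of \<open>x \<mapsto> Q x\<close>, which is squaring in the field to be constructed.\<close>

definition star :: "'a \<Rightarrow> 'a \<Rightarrow> 'a" (infixl "\<star>" 70) where
  "x \<star> y = half (P x y \<one>)"

lemma star_closed [simp]: "x \<in> carrier F \<Longrightarrow> y \<in> carrier F \<Longrightarrow> x \<star> y \<in> carrier F"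
  by (simp add: star_def)

lemma star_eq: "x \<in> carrier F \<Longrightarrow> y \<in> carrier F \<Longrightarrow> x \<star> y = half (P \<one> x y)"
  by (simp add: star_def P_one_swap)

lemma star_comm: "x \<in> carrier F \<Longrightarrow> y \<in> carrier F \<Longrightarrow> x \<star> y = y \<star> x"
  using P_sym[of x y \<one>] by (simp add: star_def)

lemma star_distrib:
  "x \<in> carrier F \<Longrightarrow> y \<in> carrier F \<Longrightarrow> z \<in> carrier F \<Longrightarrow> (x \<oplus> y) \<star> z = x \<star> z \<oplus> y \<star> z"
  "x \<in> carrier F \<Longrightarrow> y \<in> carrier F \<Longrightarrow> z \<in> carrier F \<Longrightarrow> z \<star> (x \<oplus> y) = z \<star> x \<oplus> z \<star> y"
  by (simp_all add: star_def P_add1 P_add2 half_add)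

lemma star_zero [simp]: "x \<in> carrier F \<Longrightarrow> x \<star> \<zero> = \<zero>" "x \<in> carrier F \<Longrightarrow> \<zero> \<star> x = \<zero>"
  by (simp_all add: star_def half_def)

lemma star_one [simp]: "x \<in> carrier F \<Longrightarrow> x \<star> \<one> = x" "x \<in> carrier F \<Longrightarrow> \<one> \<star> x = x"
  by (simp_all add: star_def P_one)

lemma star_uminus: "x \<in> carrier F \<Longrightarrow> y \<in> carrier F \<Longrightarrow> (\<ominus> x) \<star> y = \<ominus> (x \<star> y)"
    "x \<in> carrier F \<Longrightarrow> y \<in> carrier F \<Longrightarrow> x \<star> (\<ominus> y) = \<ominus> (x \<star> y)"
  by (simp_all add: star_def P_uminus1 P_uminus2 half_def mult_minus)

lemma star_I: "x \<in> carrier F \<Longrightarrow> x \<noteq> \<zero> \<Longrightarrow> x \<star> I x = \<one>"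
  by (simp add: star_eq P_I)

lemma star_eq_zero: "x \<in> carrier F \<Longrightarrow> y \<in> carrier F \<Longrightarrow> x \<star> y = \<zero> \<longleftrightarrow> x = \<zero> \<or> y = \<zero>"
  using P_eq_zero[of x y \<one>] two_neq_zero by (auto simp: star_def half_def)

text \<open>In the form P(1, x, z) provided by \<open>star_eq\<close>, \<open>P_inversion\<close>
  reduces to a right multiplication by \<open>Q x\<close>.\<close>

lemma I_star_mult_Q:
  "x \<in> carrier F \<Longrightarrow> x \<noteq> \<zero> \<Longrightarrow> z \<in> carrier F \<Longrightarrow> (I x \<star> z) \<otimes> Q x = x \<star> z"
  by (simp add: star_eq P_one_I flip: half_mult)

lemma Q_commute:
  assumes x: "x \<in> carrier F" and y: "y \<in> carrier F"
  shows "Q x \<otimes> Q y = Q y \<otimes> Q x"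
proof (cases "x = \<zero> \<or> y = \<zero>")
  case False
  have *: "(I x \<star> I y) \<otimes> (Q x \<otimes> Q y) = x \<star> y"
    if "x \<in> carrier F" "y \<in> carrier F" "x \<noteq> \<zero>" "y \<noteq> \<zero>" for x y
  proof -
    have "(I x \<star> I y) \<otimes> (Q x \<otimes> Q y) = (x \<star> I y) \<otimes> Q y"
      using that by (simp add: I_star_mult_Q flip: m_assoc)
    also have "\<dots> = (I y \<star> x) \<otimes> Q y" using that star_comm[of x "I y"] by simp
    also have "\<dots> = x \<star> y" using that star_comm[of y x] by (simp add: I_star_mult_Q)
    finally show ?thesis .
  qed
  have "(I x \<star> I y) \<otimes> (Q x \<otimes> Q y) = (I x \<star> I y) \<otimes> (Q y \<otimes> Q x)"
    using *[of x y] *[of y x] x y False star_comm[of x y] star_comm[of "I x" "I y"] by simp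
  then show ?thesis using mult_left_cancel x y False by (simp add: star_eq_zero)
qed (use x y in auto)

text \<open>z |-> P(1, x, z) is a combination of the identity and the right multiplications by Q(1 +
  x) and Q(x), and such combinations commute by \<open>Q_commute\<close>.\<close>

lemma P_one_commute:
  assumes x: "x \<in> carrier F" and y: "y \<in> carrier F" and z: "z \<in> carrier F"
  shows "P \<one> x (P \<one> y z) = P \<one> y (P \<one> x z)"
proof -
  define a b c d where "a = Q (\<one> \<oplus> x)" and "b = Q x" and "c = Q (\<one> \<oplus> y)" and "d = Q y"
  have cl: "a \<in> carrier F" "b \<in> carrier F" "c \<in> carrier F" "d \<in> carrier F"
    using x y by (simp_all add: a_def b_def c_def d_def)
  have cm: "c \<otimes> a = a \<otimes> c" "c \<otimes> b = b \<otimes> c" "d \<otimes> a = a \<otimes> d" "d \<otimes> b = b \<otimes> d"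
    using x y by (simp_all add: a_def b_def c_def d_def Q_commute)
  have x': "P \<one> x w = w \<otimes> a \<ominus> w \<ominus> w \<otimes> b" if "w \<in> carrier F" for w
    using that by (simp add: P_def a_def b_def)
  have y': "P \<one> y w = w \<otimes> c \<ominus> w \<ominus> w \<otimes> d" if "w \<in> carrier F" for w
    using that by (simp add: P_def c_def d_def)
  show ?thesis
    using cl z by (simp add: x' y' minus_right_distrib m_assoc cm) (simp add: ag_simps)
qed

lemma star_left_commute:
  assumes "x \<in> carrier F" "y \<in> carrier F" "z \<in> carrier F"
  shows "x \<star> (y \<star> z) = y \<star> (x \<star> z)"
proof -
  have "P \<one> u (half v) = half (P \<one> u v)" if "u \<in> carrier F" "v \<in> carrier F" for u v
    using that by (simp add: half_def P_scale3)
  then show ?thesis using assms by (simp add: star_eq P_one_commute[of x y])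
qed

lemma star_assoc:
  assumes "x \<in> carrier F" "y \<in> carrier F" "z \<in> carrier F"
  shows "(x \<star> y) \<star> z = x \<star> (y \<star> z)"
  using star_left_commute[of z x y] star_comm[of "x \<star> y" z] star_comm[of y z] assms by simp

lemma star_I_left: "x \<in> carrier F \<Longrightarrow> x \<noteq> \<zero> \<Longrightarrow> I x \<star> x = \<one>"
  using star_comm[of "I x" x] by (simp add: star_I)

lemma star_I_cancel:
  "x \<in> carrier F \<Longrightarrow> x \<noteq> \<zero> \<Longrightarrow> y \<in> carrier F \<Longrightarrow> x \<star> (I x \<star> y) = y"
  "x \<in> carrier F \<Longrightarrow> x \<noteq> \<zero> \<Longrightarrow> y \<in> carrier F \<Longrightarrow> I x \<star> (x \<star> y) = y"
  by (simp_all add: star_I star_I_left flip: star_assoc)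

lemma star_left_cancel:
  "x \<in> carrier F \<Longrightarrow> x \<noteq> \<zero> \<Longrightarrow> y \<in> carrier F \<Longrightarrow> z \<in> carrier F \<Longrightarrow> x \<star> y = x \<star> z \<longleftrightarrow> y = z"
  by (metis star_I_cancel(2))

lemma mult_Q: "x \<in> carrier F \<Longrightarrow> z \<in> carrier F \<Longrightarrow> z \<otimes> Q x = x \<star> (x \<star> z)"
  using I_star_mult_Q[of x "x \<star> z"] by (cases "x = \<zero>") (simp_all add: star_I_cancel)

section \<open>The field \<open>K\<close>\<close>

definition K :: "'a ring" where
  "K = \<lparr>carrier = carrier F, monoid.mult = (\<star>), monoid.one = \<one>, ring.zero = \<zero>, ring.add = (\<oplus>)\<rparr>"

lemma K_simps [simp]:
  "carrier K = carrier F" "monoid.mult K = (\<star>)" "monoid.one K = \<one>" "ring.zero K = \<zero>" "ring.add K = (\<oplus>)"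
  by (simp_all add: K_def)

lemma field_K: "field K"
proof -
  have "cring K"
  proof (rule cringI)
    show "abelian_group K"
    proof (rule abelian_groupI)
      show "\<exists>y\<in>carrier K. y \<oplus>\<^bsub>K\<^esub> x = \<zero>\<^bsub>K\<^esub>" if "x \<in> carrier K" for x
        using that by (auto intro!: bexI[of _ "\<ominus> x"] simp: l_neg)
    qed (simp_all add: a_ac)
    show "comm_monoid K"
      by (rule comm_monoidI) (auto simp: star_assoc intro: star_comm)
  qed (simp add: star_distrib)
  moreover have "Units K = carrier K - {\<zero>\<^bsub>K\<^esub>}"
  proof
    show "Units K \<subseteq> carrier K - {\<zero>\<^bsub>K\<^esub>}" using zero_not_one by (auto simp: Units_def)
    show "carrier K - {\<zero>\<^bsub>K\<^esub>} \<subseteq> Units K"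
      by (auto simp: Units_def intro!: bexI[of _ "I _"] star_I star_I_left)
  qed
  ultimately show ?thesis by (rule cring.cring_fieldI)
qed

sublocale K: field K
  rewrites "carrier K = carrier F" and "monoid.mult K = (\<star>)" and "monoid.one K = \<one>" and "ring.zero K = \<zero>" and "ring.add K = (\<oplus>)"
  by (simp_all add: field_K)

lemma inv_K: "x \<in> carrier F \<Longrightarrow> x \<noteq> \<zero> \<Longrightarrow> inv\<^bsub>K\<^esub> x = I x"
  using K.comm_inv_char[of x "I x"] star_I by simp

lemma uminus_K: "x \<in> carrier F \<Longrightarrow> \<ominus>\<^bsub>K\<^esub> x = \<ominus> x"
  using K.minus_equality[of "\<ominus> x" x] by (simp add: l_neg)

lemma minus_K: "x \<in> carrier F \<Longrightarrow> y \<in> carrier F \<Longrightarrow> x \<ominus>\<^bsub>K\<^esub> y = x \<ominus> y"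
  by (simp add: a_minus_def uminus_K)

section \<open>The coupling\<close>

definition \<phi> :: "'a \<Rightarrow> 'a \<Rightarrow> 'a" where
  "\<phi> c x = (x \<otimes> c) \<star> I c"

lemma \<phi>_closed [simp]: "c \<in> carrier F \<Longrightarrow> x \<in> carrier F \<Longrightarrow> \<phi> c x \<in> carrier F"
  by (simp add: \<phi>_def)

lemma \<phi>_star_self: "c \<in> carrier F \<Longrightarrow> c \<noteq> \<zero> \<Longrightarrow> x \<in> carrier F \<Longrightarrow> \<phi> c x \<star> c = x \<otimes> c"
  by (simp add: \<phi>_def star_assoc star_I_left)

lemma \<phi>_one: "c \<in> carrier F \<Longrightarrow> c \<noteq> \<zero> \<Longrightarrow> \<phi> c \<one> = \<one>"
  by (simp add: \<phi>_def star_I)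

text \<open>\<open>Q_mult\<close> brings \<open>J (I c)\<close> into the third argument of P, where
  \<open>mult_Q\<close> evaluates it.\<close>

lemma mult_star_mult:
  assumes c: "c \<in> carrier F" "c \<noteq> \<zero>" and x: "x \<in> carrier F" and y: "y \<in> carrier F"
  shows "(x \<otimes> c) \<star> (y \<otimes> c) = (x \<star> y \<star> J (I c)) \<otimes> c"
proof -
  define t where "t = J (I c)"
  have t: "t \<in> carrier F" using c by (simp add: t_def)
  have "P (x \<otimes> c) (y \<otimes> c) \<one> = P x y t \<otimes> c"
    using x y c by (simp add: P_def minus_right_distrib m_assoc t_def Q_mult flip: right_distrib)
  also have "P x y t = x \<star> (y \<star> t) \<oplus> x \<star> (y \<star> t)"
    using x y t star_left_commute[of y x t] by (simp add: P_def mult_Q star_distrib ag_simps)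
  also have "x \<star> (y \<star> t) = x \<star> y \<star> t" using x y t by (simp add: star_assoc)
  finally show ?thesis using x y c t by (simp add: star_def[of "x \<otimes> c"] right_distrib t_def)
qed

text \<open>\<open>mult_star_mult\<close> gives the same element for the pairs (x, y) and (x \<star>
  y, 1). Hence (xc) \<star> (yc) = ((x \<star> y) c) \<star> c, and c can be cancelled twice in the
  field.\<close>

lemma \<phi>_star:
  assumes c: "c \<in> carrier F" "c \<noteq> \<zero>" and x: "x \<in> carrier F" and y: "y \<in> carrier F"
  shows "\<phi> c (x \<star> y) = \<phi> c x \<star> \<phi> c y"
proof -
  have "(x \<otimes> c) \<star> (y \<otimes> c) = ((x \<star> y) \<otimes> c) \<star> c"
    using mult_star_mult[OF c x y] mult_star_mult[OF c, of "x \<star> y" \<one>] x y c by simp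
  then have "(\<phi> c x \<star> c) \<star> (\<phi> c y \<star> c) = (\<phi> c (x \<star> y) \<star> c) \<star> c"
    using c x y by (simp add: \<phi>_star_self)
  then have "c \<star> (c \<star> (\<phi> c x \<star> \<phi> c y)) = c \<star> (c \<star> \<phi> c (x \<star> y))"
    using c x y by (simp add: K.m_ac)
  then show ?thesis using c x y by (simp add: star_left_cancel)
qed

lemma \<phi>_add: "c \<in> carrier F \<Longrightarrow> x \<in> carrier F \<Longrightarrow> y \<in> carrier F \<Longrightarrow> \<phi> c (x \<oplus> y) = \<phi> c x \<oplus> \<phi> c y"
  by (simp add: \<phi>_def right_distrib star_distrib)

lemma \<phi>_iso:
  assumes c: "c \<in> carrier F" "c \<noteq> \<zero>"
  shows "\<phi> c \<in> ring_iso K K"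
proof (rule ring_iso_memI)
  show "bij_betw (\<phi> c) (carrier K) (carrier K)"
  proof (rule bij_betw_byWitness[where f' = "\<lambda>y. (y \<star> c) \<otimes> J c"])
    show "\<forall>y\<in>carrier K. \<phi> c ((y \<star> c) \<otimes> J c) = y"
      using c by (simp add: \<phi>_def m_assoc J_l star_assoc star_I)
    show "\<forall>x\<in>carrier K. (\<phi> c x \<star> c) \<otimes> J c = x"
      using c by (simp add: \<phi>_star_self m_assoc J_r)
  qed (use c in auto)
qed (use c in \<open>auto simp: \<phi>_add \<phi>_star \<phi>_one\<close>)

text \<open>Since ab is \<open>\<phi> b a \<star> b\<close> and \<open>\<phi> b\<close> respects
  field inverses, \<open>I (a \<otimes> b)\<close> is \<open>I b \<star> \<phi> b (I a)\<close>; the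
  rest is the definition of \<phi>.\<close>

lemma \<phi>_mult:
  assumes a: "a \<in> carrier F" "a \<noteq> \<zero>" and b: "b \<in> carrier F" "b \<noteq> \<zero>" and x: "x \<in> carrier F"
  shows "\<phi> (a \<otimes> b) x = \<phi> b (\<phi> a x)"
proof -
  have "(a \<otimes> b) \<star> (I b \<star> \<phi> b (I a)) = \<phi> b a \<star> \<phi> b (I a)"
    using a b by (simp add: \<phi>_def[of b a] star_assoc)
  also have "\<dots> = \<one>" using a b by (simp add: star_I \<phi>_one flip: \<phi>_star)
  also have "\<dots> = (a \<otimes> b) \<star> I (a \<otimes> b)" using a b by (simp add: star_I)
  finally have "I (a \<otimes> b) = I b \<star> \<phi> b (I a)" using a b by (simp add: star_left_cancel)
  then have "\<phi> (a \<otimes> b) x = ((x \<otimes> a) \<otimes> b) \<star> I b \<star> \<phi> b (I a)"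
    using a b x by (simp add: \<phi>_def[of "a \<otimes> b"] m_assoc star_assoc)
  also have "\<dots> = \<phi> b (x \<otimes> a) \<star> \<phi> b (I a)" by (simp add: \<phi>_def[of b "x \<otimes> a"])
  also have "\<dots> = \<phi> b (\<phi> a x)" using a b x by (simp add: \<phi>_def[of a x] \<phi>_star)
  finally show ?thesis .
qed

lemma coupling_\<phi>: "coupling K \<phi>"
  by (auto simp: coupling_def \<phi>_iso \<phi>_mult \<phi>_star_self)

lemma same_structure_dickson: "same_structure F (dickson K \<phi>)"
  by (auto simp: same_structure_def dickson_def \<phi>_star_self)

end

section \<open>Semilinear maps of the projective line\<close>

context field begin

abbreviation pts :: "'a option set" where "pts \<equiv> proj_points R"

lemma ring_iso_facts:
  assumes "\<alpha> \<in> ring_iso R R"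
  shows "x \<in> carrier R \<Longrightarrow> \<alpha> x \<in> carrier R"
    and "x \<in> carrier R \<Longrightarrow> y \<in> carrier R \<Longrightarrow> \<alpha> (x \<otimes> y) = \<alpha> x \<otimes> \<alpha> y"
    and "x \<in> carrier R \<Longrightarrow> y \<in> carrier R \<Longrightarrow> \<alpha> (x \<oplus> y) = \<alpha> x \<oplus> \<alpha> y"
    and "x \<in> carrier R \<Longrightarrow> y \<in> carrier R \<Longrightarrow> \<alpha> (x \<ominus> y) = \<alpha> x \<ominus> \<alpha> y"
    and "x \<in> carrier R \<Longrightarrow> \<alpha> (\<ominus> x) = \<ominus> \<alpha> x"
    and "\<alpha> \<one> = \<one>" and "\<alpha> \<zero> = \<zero>"
    and "x \<in> carrier R \<Longrightarrow> \<alpha> x = \<zero> \<longleftrightarrow> x = \<zero>"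
proof -
  interpret h: ring_hom_cring R R \<alpha>
    using assms by (intro ring_hom_cringI ring_hom_ringI2) (auto simp: ring_iso_def is_ring is_cring)
  show "x \<in> carrier R \<Longrightarrow> \<alpha> x \<in> carrier R" by simp
  show "x \<in> carrier R \<Longrightarrow> y \<in> carrier R \<Longrightarrow> \<alpha> (x \<otimes> y) = \<alpha> x \<otimes> \<alpha> y" by simp
  show "x \<in> carrier R \<Longrightarrow> y \<in> carrier R \<Longrightarrow> \<alpha> (x \<oplus> y) = \<alpha> x \<oplus> \<alpha> y" by simp
  show "x \<in> carrier R \<Longrightarrow> y \<in> carrier R \<Longrightarrow> \<alpha> (x \<ominus> y) = \<alpha> x \<ominus> \<alpha> y" by (simp add: a_minus_def)
  show "x \<in> carrier R \<Longrightarrow> \<alpha> (\<ominus> x) = \<ominus> \<alpha> x" by simp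
  show "\<alpha> \<one> = \<one>" "\<alpha> \<zero> = \<zero>" by simp_all
  have "inj_on \<alpha> (carrier R)" using assms by (auto simp: ring_iso_def bij_betw_def)
  then show "x \<in> carrier R \<Longrightarrow> \<alpha> x = \<zero> \<longleftrightarrow> x = \<zero>"
    using inj_onD[of \<alpha> "carrier R" x \<zero>] by auto
qed

lemma inv_nonzero: "x \<in> carrier R \<Longrightarrow> x \<noteq> \<zero> \<Longrightarrow> inv x \<in> carrier R \<and> x \<otimes> inv x = \<one> \<and> inv x \<otimes> x = \<one>"
  by (simp add: field_Units)

lemma proj_point_scale:
  assumes "l \<in> carrier R" "l \<noteq> \<zero>" "x \<in> carrier R" "y \<in> carrier R"
  shows "proj_point R (l \<otimes> x) (l \<otimes> y) = proj_point R x y"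
proof (cases "y = \<zero>")
  case False
  have "l \<otimes> y \<in> Units R" using assms False by (simp add: field_Units integral_iff)
  then have "inv (l \<otimes> y) = inv l \<otimes> inv y"
    using assms False inv_nonzero[of l] inv_nonzero[of y]
    by (intro comm_inv_char) (simp_all add: m_ac)
  moreover have "(l \<otimes> x) \<otimes> (u \<otimes> v) = (l \<otimes> u) \<otimes> (x \<otimes> v)" if "u \<in> carrier R" "v \<in> carrier R" for u v
    using that assms by (simp add: m_ac)
  ultimately have "(l \<otimes> x) \<otimes> inv (l \<otimes> y) = (l \<otimes> inv l) \<otimes> (x \<otimes> inv y)"
    using inv_nonzero[OF assms(1,2)] inv_nonzero[OF assms(4) False] by simp
  then show ?thesis using assms False inv_nonzero[of l] inv_nonzero[of y] by (simp add: proj_point_def integral_iff)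
qed (use assms in \<open>simp add: proj_point_def\<close>)

lemma proj_point_closed: "x \<in> carrier R \<Longrightarrow> y \<in> carrier R \<Longrightarrow> proj_point R x y \<in> pts"
  using inv_nonzero[of y] by (simp add: proj_point_def proj_points_def)

text \<open>A scalar factor l of the coordinates reappears as \<alpha>(l) in the image, where
  \<open>proj_point_scale\<close> removes it. This is needed because composition produces
  coordinates that are not normalised.\<close>

lemma semilinear_induced_proj_point:
  assumes \<alpha>: "\<alpha> \<in> ring_iso R R" and m: "{a, b, c, d} \<subseteq> carrier R"
    and x: "x \<in> carrier R" and y: "y \<in> carrier R" and n: "x \<noteq> \<zero> \<or> y \<noteq> \<zero>"
  shows "semilinear_induced R \<alpha> a b c d (proj_point R x y)
    = proj_point R (a \<otimes> \<alpha> x \<oplus> b \<otimes> \<alpha> y) (c \<otimes> \<alpha> x \<oplus> d \<otimes> \<alpha> y)"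
proof -
  note \<alpha>' = ring_iso_facts[OF \<alpha>]
  have p: "proj_point R x y \<in> pts" using x y by (rule proj_point_closed)
  show ?thesis
  proof (cases "y = \<zero>")
    case True
    then have "semilinear_induced R \<alpha> a b c d (proj_point R x y) = proj_point R a c"
      by (simp add: semilinear_induced_def proj_point_def proj_points_def)
    also have "\<dots> = proj_point R (\<alpha> x \<otimes> a) (\<alpha> x \<otimes> c)"
      using proj_point_scale[of "\<alpha> x" a c] x n m True by (simp add: \<alpha>')
    finally show ?thesis using x m True by (simp add: \<alpha>' m_comm)
  next
    case False
    define u where "u = x \<otimes> inv y"
    have u: "u \<in> carrier R" "u \<otimes> y = x" using x y False inv_nonzero[of y] by (simp_all add: u_def m_assoc)
    have ux: "\<alpha> x = \<alpha> u \<otimes> \<alpha> y" using u y by (simp flip: u(2) add: \<alpha>')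
    have "semilinear_induced R \<alpha> a b c d (proj_point R x y) = proj_point R (a \<otimes> \<alpha> u \<oplus> b) (c \<otimes> \<alpha> u \<oplus> d)"
      using p False by (simp add: semilinear_induced_def proj_point_def u_def)
    also have "\<dots> = proj_point R (\<alpha> y \<otimes> (a \<otimes> \<alpha> u \<oplus> b)) (\<alpha> y \<otimes> (c \<otimes> \<alpha> u \<oplus> d))"
      using proj_point_scale[of "\<alpha> y" "a \<otimes> \<alpha> u \<oplus> b" "c \<otimes> \<alpha> u \<oplus> d"] u y False m by (simp add: \<alpha>')
    also have "\<alpha> y \<otimes> (a \<otimes> \<alpha> u \<oplus> b) = a \<otimes> \<alpha> x \<oplus> b \<otimes> \<alpha> y"
      unfolding ux using u y m by (simp add: \<alpha>' r_distr m_ac)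
    also have "\<alpha> y \<otimes> (c \<otimes> \<alpha> u \<oplus> d) = c \<otimes> \<alpha> x \<oplus> d \<otimes> \<alpha> y"
      unfolding ux using u y m by (simp add: \<alpha>' r_distr m_ac)
    finally show ?thesis .
  qed
qed

text \<open>Multiplication by the adjugate recovers the vector up to the determinant.\<close>

lemma mat_vec_nonzero:
  assumes m: "{a, b, c, d} \<subseteq> carrier R" and det: "a \<otimes> d \<ominus> b \<otimes> c \<noteq> \<zero>"
    and x: "x \<in> carrier R" and y: "y \<in> carrier R" and n: "x \<noteq> \<zero> \<or> y \<noteq> \<zero>"
  shows "a \<otimes> x \<oplus> b \<otimes> y \<noteq> \<zero> \<or> c \<otimes> x \<oplus> d \<otimes> y \<noteq> \<zero>"
proof (rule ccontr)
  assume "\<not> ?thesis"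
  then have z: "a \<otimes> x \<oplus> b \<otimes> y = \<zero>" "c \<otimes> x \<oplus> d \<otimes> y = \<zero>" by auto
  have "(a \<otimes> d \<ominus> b \<otimes> c) \<otimes> x = d \<otimes> (a \<otimes> x \<oplus> b \<otimes> y) \<ominus> b \<otimes> (c \<otimes> x \<oplus> d \<otimes> y)"
    using m x y by auto algebra
  then have 1: "x = \<zero>" using z m x det by (simp add: integral_iff minus_eq)
  have "(a \<otimes> d \<ominus> b \<otimes> c) \<otimes> y = a \<otimes> (c \<otimes> x \<oplus> d \<otimes> y) \<ominus> c \<otimes> (a \<otimes> x \<oplus> b \<otimes> y)"
    using m x y by auto algebra
  then have "y = \<zero>" using z m y det by (simp add: integral_iff minus_eq)
  then show False using 1 n by simp
qed

text \<open>\<gamma> has to agree with \<alpha> \<circ> \<beta> on the carrier only, so that the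
  identity can be used for it as well. The determinant of the inner matrix keeps the intermediate
  coordinates from both being zero.\<close>

lemma semilinear_induced_compose:
  assumes \<alpha>: "\<alpha> \<in> ring_iso R R" and m: "{a, b, c, d} \<subseteq> carrier R"
    and \<beta>: "\<beta> \<in> ring_iso R R" and m': "{a', b', c', d'} \<subseteq> carrier R" and det: "a' \<otimes> d' \<ominus> b' \<otimes> c' \<noteq> \<zero>"
    and \<gamma>: "\<And>x. x \<in> carrier R \<Longrightarrow> \<gamma> x = \<alpha> (\<beta> x)"
  shows "compose pts (semilinear_induced R \<alpha> a b c d) (semilinear_induced R \<beta> a' b' c' d')
    = semilinear_induced R \<gamma> (a \<otimes> \<alpha> a' \<oplus> b \<otimes> \<alpha> c') (a \<otimes> \<alpha> b' \<oplus> b \<otimes> \<alpha> d')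
        (c \<otimes> \<alpha> a' \<oplus> d \<otimes> \<alpha> c') (c \<otimes> \<alpha> b' \<oplus> d \<otimes> \<alpha> d')" (is "?l = ?r")
proof
  fix p
  show "?l p = ?r p"
  proof (cases "p \<in> pts")
    case False
    then show ?thesis by (simp add: compose_def semilinear_induced_def)
  next
    case True
    note \<alpha>' = ring_iso_facts[OF \<alpha>] and \<beta>' = ring_iso_facts[OF \<beta>]
    have comp: "semilinear_induced R \<alpha> a b c d (proj_point R (a' \<otimes> x \<oplus> b' \<otimes> y) (c' \<otimes> x \<oplus> d' \<otimes> y))
        = proj_point R ((a \<otimes> \<alpha> a' \<oplus> b \<otimes> \<alpha> c') \<otimes> \<alpha> x \<oplus> (a \<otimes> \<alpha> b' \<oplus> b \<otimes> \<alpha> d') \<otimes> \<alpha> y)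
           ((c \<otimes> \<alpha> a' \<oplus> d \<otimes> \<alpha> c') \<otimes> \<alpha> x \<oplus> (c \<otimes> \<alpha> b' \<oplus> d \<otimes> \<alpha> d') \<otimes> \<alpha> y)"
      if "x \<in> carrier R" "y \<in> carrier R" "x \<noteq> \<zero> \<or> y \<noteq> \<zero>" for x y
    proof -
      have "semilinear_induced R \<alpha> a b c d (proj_point R (a' \<otimes> x \<oplus> b' \<otimes> y) (c' \<otimes> x \<oplus> d' \<otimes> y))
        = proj_point R (a \<otimes> \<alpha> (a' \<otimes> x \<oplus> b' \<otimes> y) \<oplus> b \<otimes> \<alpha> (c' \<otimes> x \<oplus> d' \<otimes> y))
            (c \<otimes> \<alpha> (a' \<otimes> x \<oplus> b' \<otimes> y) \<oplus> d \<otimes> \<alpha> (c' \<otimes> x \<oplus> d' \<otimes> y))"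
        by (rule semilinear_induced_proj_point[OF \<alpha> m]) (use mat_vec_nonzero[OF m' det] that m' in auto)
      then show ?thesis using that m m' by (simp add: \<alpha>' r_distr l_distr m_assoc a_ac)
    qed
    show ?thesis
    proof (cases p)
      case None
      then show ?thesis using True comp[of \<one> \<zero>] m m'
        by (simp add: compose_def semilinear_induced_def[of R \<beta>] semilinear_induced_def[of R \<gamma>] \<alpha>')
    next
      case (Some x)
      then have "x \<in> carrier R" using True by (auto simp: proj_points_def)
      then show ?thesis using True Some comp[of "\<beta> x" \<one>] m m'
        by (simp add: compose_def semilinear_induced_def[of R \<beta>] semilinear_induced_def[of R \<gamma>] \<alpha>' \<beta>' \<gamma>)
    qed
  qed
qed

lemma semilinear_induced_scalar:
  assumes l: "l \<in> carrier R" "l \<noteq> \<zero>" and \<alpha>: "\<And>x. x \<in> carrier R \<Longrightarrow> \<alpha> x = x"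
  shows "semilinear_induced R \<alpha> l \<zero> \<zero> l = (\<lambda>p\<in>pts. p)"
proof
  fix p
  have "proj_point R (l \<otimes> x) l = Some x" if "x \<in> carrier R" for x
    using proj_point_scale[of l x \<one>] l that by (simp add: proj_point_def)
  then show "semilinear_induced R \<alpha> l \<zero> \<zero> l p = (\<lambda>p\<in>pts. p) p"
    using l \<alpha> by (cases p) (auto simp: semilinear_induced_def proj_points_def proj_point_def[of _ l \<zero>])
qed

text \<open>The inverse is the adjugate with entries transported by \<beta>. The product is the
  scalar matrix with entry \<beta>(det), which induces the identity.\<close>

lemma semilinear_induced_left_inverse:
  assumes \<alpha>: "\<alpha> \<in> ring_iso R R" and m: "{a, b, c, d} \<subseteq> carrier R" and det: "a \<otimes> d \<ominus> b \<otimes> c \<noteq> \<zero>"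
    and \<beta>: "\<beta> \<in> ring_iso R R" and inv: "\<And>x. x \<in> carrier R \<Longrightarrow> \<beta> (\<alpha> x) = x"
  shows "compose pts (semilinear_induced R \<beta> (\<beta> d) (\<ominus> \<beta> b) (\<ominus> \<beta> c) (\<beta> a)) (semilinear_induced R \<alpha> a b c d)
    = (\<lambda>p\<in>pts. p)"
proof -
  note \<beta>' = ring_iso_facts[OF \<beta>]
  define l where "l = \<beta> (a \<otimes> d \<ominus> b \<otimes> c)"
  have l: "l \<in> carrier R" using m by (simp add: l_def \<beta>')
  have l0: "l \<noteq> \<zero>" unfolding l_def using \<beta>'(8)[of "a \<otimes> d \<ominus> b \<otimes> c"] m det by blast
  have l_eq: "l = \<beta> a \<otimes> \<beta> d \<ominus> \<beta> b \<otimes> \<beta> c" using m by (simp add: l_def \<beta>')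
  have cl: "\<beta> a \<in> carrier R" "\<beta> b \<in> carrier R" "\<beta> c \<in> carrier R" "\<beta> d \<in> carrier R"
    using m by (simp_all add: \<beta>')
  have "compose pts (semilinear_induced R \<beta> (\<beta> d) (\<ominus> \<beta> b) (\<ominus> \<beta> c) (\<beta> a)) (semilinear_induced R \<alpha> a b c d)
    = semilinear_induced R (\<beta> \<circ> \<alpha>) (\<beta> d \<otimes> \<beta> a \<oplus> (\<ominus> \<beta> b) \<otimes> \<beta> c) (\<beta> d \<otimes> \<beta> b \<oplus> (\<ominus> \<beta> b) \<otimes> \<beta> d)
        ((\<ominus> \<beta> c) \<otimes> \<beta> a \<oplus> \<beta> a \<otimes> \<beta> c) ((\<ominus> \<beta> c) \<otimes> \<beta> b \<oplus> \<beta> a \<otimes> \<beta> d)"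
    by (rule semilinear_induced_compose[OF \<beta> _ \<alpha> m det]) (use cl in auto)
  also have "\<beta> d \<otimes> \<beta> a \<oplus> (\<ominus> \<beta> b) \<otimes> \<beta> c = l" unfolding l_eq using cl by algebra
  also have "\<beta> d \<otimes> \<beta> b \<oplus> (\<ominus> \<beta> b) \<otimes> \<beta> d = \<zero>" using cl by algebra
  also have "(\<ominus> \<beta> c) \<otimes> \<beta> a \<oplus> \<beta> a \<otimes> \<beta> c = \<zero>" using cl by algebra
  also have "(\<ominus> \<beta> c) \<otimes> \<beta> b \<oplus> \<beta> a \<otimes> \<beta> d = l" unfolding l_eq using cl by algebra
  also have "semilinear_induced R (\<beta> \<circ> \<alpha>) l \<zero> \<zero> l = (\<lambda>p\<in>pts. p)"
    by (rule semilinear_induced_scalar) (use l l0 inv in auto)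
  finally show ?thesis .
qed

lemma semilinear_induced_closed:
  assumes "\<alpha> \<in> ring_iso R R" "{a, b, c, d} \<subseteq> carrier R" "p \<in> pts"
  shows "semilinear_induced R \<alpha> a b c d p \<in> pts"
proof (cases p)
  case None
  then show ?thesis using assms by (simp add: semilinear_induced_def proj_point_closed)
next
  case (Some x)
  then have "x \<in> carrier R" using assms(3) by (auto simp: proj_points_def)
  then show ?thesis
    using Some assms ring_iso_facts(1)[OF assms(1)] by (simp add: semilinear_induced_def proj_point_closed)
qed

lemma ring_iso_inverse:
  assumes \<alpha>: "\<alpha> \<in> ring_iso R R"
  obtains \<beta> where "\<beta> \<in> ring_iso R R" "\<And>x. x \<in> carrier R \<Longrightarrow> \<beta> (\<alpha> x) = x" "\<And>x. x \<in> carrier R \<Longrightarrow> \<alpha> (\<beta> x) = x"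
proof
  have bij: "bij_betw \<alpha> (carrier R) (carrier R)" using \<alpha> by (simp add: ring_iso_def)
  show "inv_into (carrier R) \<alpha> \<in> ring_iso R R" using \<alpha> ring_iso_set_sym[OF is_ring] by blast
  show "inv_into (carrier R) \<alpha> (\<alpha> x) = x" if "x \<in> carrier R" for x
    using bij that by (simp add: bij_betw_inv_into_left)
  show "\<alpha> (inv_into (carrier R) \<alpha> x) = x" if "x \<in> carrier R" for x
    using bij that by (simp add: bij_betw_inv_into_right)
qed

lemma semilinear_induced_Bij:
  assumes \<alpha>: "\<alpha> \<in> ring_iso R R" and m: "{a, b, c, d} \<subseteq> carrier R" and det: "a \<otimes> d \<ominus> b \<otimes> c \<noteq> \<zero>"
  shows "semilinear_induced R \<alpha> a b c d \<in> Bij pts"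
proof -
  obtain \<beta> where \<beta>: "\<beta> \<in> ring_iso R R" and inv: "\<And>x. x \<in> carrier R \<Longrightarrow> \<beta> (\<alpha> x) = x" "\<And>x. x \<in> carrier R \<Longrightarrow> \<alpha> (\<beta> x) = x"
    using ring_iso_inverse[OF \<alpha>] by blast
  note \<alpha>' = ring_iso_facts[OF \<alpha>] and \<beta>' = ring_iso_facts[OF \<beta>]
  let ?g = "semilinear_induced R \<alpha> a b c d"
  let ?h = "semilinear_induced R \<beta> (\<beta> d) (\<ominus> \<beta> b) (\<ominus> \<beta> c) (\<beta> a)"
  have m': "{\<beta> d, \<ominus> \<beta> b, \<ominus> \<beta> c, \<beta> a} \<subseteq> carrier R" using m by (simp add: \<beta>')
  have "\<beta> d \<otimes> \<beta> a \<ominus> (\<ominus> \<beta> b) \<otimes> (\<ominus> \<beta> c) = \<beta> (a \<otimes> d \<ominus> b \<otimes> c)"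
    using m by (simp add: \<beta>' l_minus r_minus m_comm)
  then have det': "\<beta> d \<otimes> \<beta> a \<ominus> (\<ominus> \<beta> b) \<otimes> (\<ominus> \<beta> c) \<noteq> \<zero>" using \<beta>'(8)[of "a \<otimes> d \<ominus> b \<otimes> c"] m det by simp
  have hg: "compose pts ?h ?g = (\<lambda>p\<in>pts. p)"
    by (rule semilinear_induced_left_inverse[OF \<alpha> m det \<beta> inv(1)])
  have gh: "compose pts ?g ?h = (\<lambda>p\<in>pts. p)"
    using semilinear_induced_left_inverse[OF \<beta> m' det' \<alpha> inv(2)] m by (simp add: \<alpha>' \<beta>' inv)
  have "bij_betw ?g pts pts"
  proof (rule bij_betw_byWitness[where f' = ?h])
    show "\<forall>p\<in>pts. ?h (?g p) = p" using fun_cong[OF hg] by (metis compose_eq restrict_apply')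
    show "\<forall>p\<in>pts. ?g (?h p) = p" using fun_cong[OF gh] by (metis compose_eq restrict_apply')
  qed (use semilinear_induced_closed[OF \<alpha> m] semilinear_induced_closed[OF \<beta> m'] in auto)
  then show ?thesis by (simp add: Bij_def semilinear_induced_def)
qed

lemma det_mult:
  assumes "{a, b, c, d} \<subseteq> carrier R" "{a', b', c', d'} \<subseteq> carrier R"
  shows "(a \<otimes> a' \<oplus> b \<otimes> c') \<otimes> (c \<otimes> b' \<oplus> d \<otimes> d') \<ominus> (a \<otimes> b' \<oplus> b \<otimes> d') \<otimes> (c \<otimes> a' \<oplus> d \<otimes> c')
    = (a \<otimes> d \<ominus> b \<otimes> c) \<otimes> (a' \<otimes> d' \<ominus> b' \<otimes> c')"
proof -
  have "a \<in> carrier R" "b \<in> carrier R" "c \<in> carrier R" "d \<in> carrier R"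
    "a' \<in> carrier R" "b' \<in> carrier R" "c' \<in> carrier R" "d' \<in> carrier R" using assms by auto
  then show ?thesis by algebra
qed

lemma subgroup_semilinear:
  assumes A: "A \<subseteq> ring_iso R R" and id: "(\<lambda>x. x) \<in> A"
    and comp: "\<And>\<alpha> \<beta>. \<alpha> \<in> A \<Longrightarrow> \<beta> \<in> A \<Longrightarrow> \<alpha> \<circ> \<beta> \<in> A"
    and inv: "\<And>\<alpha>. \<alpha> \<in> A \<Longrightarrow> \<exists>\<beta>\<in>A. \<forall>x\<in>carrier R. \<beta> (\<alpha> x) = x"
    and D: "\<zero> \<notin> D" "D \<subseteq> carrier R" "\<one> \<in> D"
    and D_mult: "\<And>x y \<alpha>. \<alpha> \<in> A \<Longrightarrow> x \<in> D \<Longrightarrow> y \<in> D \<Longrightarrow> x \<otimes> \<alpha> y \<in> D"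
  shows "subgroup {semilinear_induced R \<alpha> a b c d | \<alpha> a b c d.
      \<alpha> \<in> A \<and> {a, b, c, d} \<subseteq> carrier R \<and> a \<otimes> d \<ominus> b \<otimes> c \<in> D} (BijGroup pts)"
    (is "subgroup ?set _")
proof -
  define S where "S = ?set"
  have S_I: "semilinear_induced R \<alpha> a b c d \<in> S"
    if "\<alpha> \<in> A" "{a, b, c, d} \<subseteq> carrier R" "a \<otimes> d \<ominus> b \<otimes> c \<in> D" for \<alpha> a b c d
    unfolding S_def using that by (intro CollectI exI conjI) (rule refl)
  have D0: "x \<noteq> \<zero>" if "x \<in> D" for x using that D(1) by blast
  interpret B: group "BijGroup pts" by (rule group_BijGroup)
  have Bij: "g \<in> Bij pts" if "g \<in> S" for g
    using that A D(1) semilinear_induced_Bij unfolding S_def by (smt (verit) mem_Collect_eq subsetD)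
  have mult: "g \<otimes>\<^bsub>BijGroup pts\<^esub> h = compose pts g h" if "g \<in> S" "h \<in> S" for g h
    using that[THEN Bij] by (simp add: BijGroup_def)
  have "subgroup S (BijGroup pts)"
  proof (rule B.subgroupI)
    have "carrier (BijGroup pts) = Bij pts" by (simp add: BijGroup_def)
    then show "S \<subseteq> carrier (BijGroup pts)" using Bij by blast
    have "semilinear_induced R (\<lambda>x. x) \<one> \<zero> \<zero> \<one> \<in> S"
      by (rule S_I) (use id D in \<open>auto simp: minus_eq\<close>)
    then show "S \<noteq> {}" by blast
    show "g \<otimes>\<^bsub>BijGroup pts\<^esub> h \<in> S" if g: "g \<in> S" and h: "h \<in> S" for g h
    proof -
      obtain \<alpha> a b c d where \<alpha>: "g = semilinear_induced R \<alpha> a b c d" "\<alpha> \<in> A"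
        and m: "{a, b, c, d} \<subseteq> carrier R" "a \<otimes> d \<ominus> b \<otimes> c \<in> D" using g unfolding S_def by blast
      obtain \<beta> a' b' c' d' where \<beta>: "h = semilinear_induced R \<beta> a' b' c' d'" "\<beta> \<in> A"
        and m': "{a', b', c', d'} \<subseteq> carrier R" "a' \<otimes> d' \<ominus> b' \<otimes> c' \<in> D" using h unfolding S_def by blast
      have \<alpha>_iso: "\<alpha> \<in> ring_iso R R" and \<beta>_iso: "\<beta> \<in> ring_iso R R" using \<alpha> \<beta> A by auto
      note \<alpha>' = ring_iso_facts[OF \<alpha>_iso]
      have cl: "{\<alpha> a', \<alpha> b', \<alpha> c', \<alpha> d'} \<subseteq> carrier R" using m' by (simp add: \<alpha>')
      have "a' \<otimes> d' \<ominus> b' \<otimes> c' \<noteq> \<zero>" by (rule D0[OF m'(2)])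
      then have "g \<otimes>\<^bsub>BijGroup pts\<^esub> h = semilinear_induced R (\<alpha> \<circ> \<beta>) (a \<otimes> \<alpha> a' \<oplus> b \<otimes> \<alpha> c') (a \<otimes> \<alpha> b' \<oplus> b \<otimes> \<alpha> d')
        (c \<otimes> \<alpha> a' \<oplus> d \<otimes> \<alpha> c') (c \<otimes> \<alpha> b' \<oplus> d \<otimes> \<alpha> d')"
        unfolding mult[OF g h] unfolding \<alpha>(1) \<beta>(1)
        by (intro semilinear_induced_compose[OF \<alpha>_iso m(1) \<beta>_iso m'(1)]) simp_all
      moreover have "(a \<otimes> \<alpha> a' \<oplus> b \<otimes> \<alpha> c') \<otimes> (c \<otimes> \<alpha> b' \<oplus> d \<otimes> \<alpha> d') \<ominus> (a \<otimes> \<alpha> b' \<oplus> b \<otimes> \<alpha> d') \<otimes> (c \<otimes> \<alpha> a' \<oplus> d \<otimes> \<alpha> c') \<in> D"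
      proof -
        have "\<alpha> (a' \<otimes> d' \<ominus> b' \<otimes> c') = \<alpha> a' \<otimes> \<alpha> d' \<ominus> \<alpha> b' \<otimes> \<alpha> c'" using m' by (simp add: \<alpha>')
        then show ?thesis unfolding det_mult[OF m(1) cl] using D_mult[OF \<alpha>(2) m(2) m'(2)] by simp
      qed
      moreover have "{a \<otimes> \<alpha> a' \<oplus> b \<otimes> \<alpha> c', a \<otimes> \<alpha> b' \<oplus> b \<otimes> \<alpha> d', c \<otimes> \<alpha> a' \<oplus> d \<otimes> \<alpha> c', c \<otimes> \<alpha> b' \<oplus> d \<otimes> \<alpha> d'} \<subseteq> carrier R"
        using m(1) cl by simp
      ultimately show ?thesis using S_I comp[OF \<alpha>(2) \<beta>(2)] by simp
    qed
    show "inv\<^bsub>BijGroup pts\<^esub> g \<in> S" if g: "g \<in> S" for g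
    proof -
      obtain \<alpha> a b c d where \<alpha>: "g = semilinear_induced R \<alpha> a b c d" "\<alpha> \<in> A"
        and m: "{a, b, c, d} \<subseteq> carrier R" "a \<otimes> d \<ominus> b \<otimes> c \<in> D" using g unfolding S_def by blast
      obtain \<beta> where \<beta>: "\<beta> \<in> A" "\<And>x. x \<in> carrier R \<Longrightarrow> \<beta> (\<alpha> x) = x" using inv[OF \<alpha>(2)] by blast
      have \<alpha>_iso: "\<alpha> \<in> ring_iso R R" and \<beta>_iso: "\<beta> \<in> ring_iso R R" using \<alpha> \<beta> A by auto
      note \<beta>' = ring_iso_facts[OF \<beta>_iso]
      define h where "h = semilinear_induced R \<beta> (\<beta> d) (\<ominus> \<beta> b) (\<ominus> \<beta> c) (\<beta> a)"
      \<comment> \<open>\<open>D_mult\<close> with first factor 1.\<close>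
      have "\<beta> (a \<otimes> d \<ominus> b \<otimes> c) \<in> D" using D_mult[OF \<beta>(1) D(3) m(2)] m \<beta>'(1) by simp
      also have "\<beta> (a \<otimes> d \<ominus> b \<otimes> c) = \<beta> d \<otimes> \<beta> a \<ominus> (\<ominus> \<beta> b) \<otimes> (\<ominus> \<beta> c)"
        using m by (simp add: \<beta>' l_minus r_minus m_comm)
      finally have "\<beta> d \<otimes> \<beta> a \<ominus> (\<ominus> \<beta> b) \<otimes> (\<ominus> \<beta> c) \<in> D" .
      moreover have "{\<beta> d, \<ominus> \<beta> b, \<ominus> \<beta> c, \<beta> a} \<subseteq> carrier R" using m by (simp add: \<beta>')
      ultimately have h: "h \<in> S" unfolding h_def using S_I \<beta>(1) by blast
      have "compose pts h g = (\<lambda>p\<in>pts. p)"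
        unfolding h_def \<alpha>(1) by (rule semilinear_induced_left_inverse[OF \<alpha>_iso m(1) D0[OF m(2)] \<beta>_iso \<beta>(2)])
      then have "h \<otimes>\<^bsub>BijGroup pts\<^esub> g = \<one>\<^bsub>BijGroup pts\<^esub>" using mult[OF h g] by (simp add: BijGroup_def)
      then have "inv\<^bsub>BijGroup pts\<^esub> g = h"
        using Bij[OF g] Bij[OF h] by (intro B.inv_equality) (simp_all add: BijGroup_def)
      then show ?thesis using h by simp
    qed
  qed
  then show ?thesis unfolding S_def .
qed

lemma id_ring_iso: "(\<lambda>x. x) \<in> ring_iso R R"
  by (rule ring_iso_memI) (auto simp: bij_betw_def)

lemma subgroup_PGammaL2: "subgroup (PGammaL2 R) (BijGroup pts)"
proof -
  have "PGammaL2 R = {semilinear_induced R \<alpha> a b c d | \<alpha> a b c d. \<alpha> \<in> ring_iso R R \<and>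
     {a, b, c, d} \<subseteq> carrier R \<and> a \<otimes> d \<ominus> b \<otimes> c \<in> carrier R - {\<zero>}}"
    unfolding PGammaL2_def by (intro Collect_cong ex_cong1) auto
  also have "subgroup \<dots> (BijGroup pts)"
  proof (rule subgroup_semilinear)
    show "\<alpha> \<circ> \<beta> \<in> ring_iso R R" if "\<alpha> \<in> ring_iso R R" "\<beta> \<in> ring_iso R R" for \<alpha> \<beta>
      using ring_iso_set_trans that by blast
    show "\<exists>\<beta>\<in>ring_iso R R. \<forall>x\<in>carrier R. \<beta> (\<alpha> x) = x" if "\<alpha> \<in> ring_iso R R" for \<alpha>
      using ring_iso_inverse[OF that] by metis
    show "x \<otimes> \<alpha> y \<in> carrier R - {\<zero>}"
      if "\<alpha> \<in> ring_iso R R" "x \<in> carrier R - {\<zero>}" "y \<in> carrier R - {\<zero>}" for x y \<alpha>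
      using that ring_iso_facts(1,8)[OF that(1), of y] by (simp add: integral_iff)
  qed (auto simp: id_ring_iso)
  finally show ?thesis .
qed

lemma subgroup_PSL2: "subgroup (PSL2 R) (BijGroup pts)"
proof -
  have "PSL2 R = {semilinear_induced R \<alpha> a b c d | \<alpha> a b c d. \<alpha> \<in> {\<lambda>x. x} \<and>
     {a, b, c, d} \<subseteq> carrier R \<and> a \<otimes> d \<ominus> b \<otimes> c \<in> {\<one>}}"
    by (auto simp: PSL2_def)
  also have "subgroup \<dots> (BijGroup pts)"
    by (rule subgroup_semilinear) (auto simp: id_ring_iso)
  finally show ?thesis .
qed
end

section \<open>The group \<open>T\<^sub>3(F)\<close>\<close>

context finite_dim_KT_nearfield begin

lemma proj_points_K: "proj_points K = proj_points F"
  by (simp add: proj_points_def)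

text \<open>Right multiplication by a is x |-> \<open>a \<star> \<phi> a x\<close>, so the map is
  semilinear with companion \<open>\<phi> a\<close>.\<close>

lemma affine_map_eq:
  assumes a: "a \<in> carrier F" "a \<noteq> \<zero>" and b: "b \<in> carrier F"
  shows "affine_map F a b = semilinear_induced K (\<phi> a) a b \<zero> \<one>"
proof
  fix p
  show "affine_map F a b p = semilinear_induced K (\<phi> a) a b \<zero> \<one> p"
    using a b star_comm[of a "\<phi> a _"]
    by (auto simp: affine_map_def semilinear_induced_def proj_points_K proj_point_def inv_K \<phi>_star_self
        proj_points_def split: option.split)
qed

lemma tau_eq: "tau F \<sigma> = semilinear_induced K (\<lambda>x. x) \<zero> (\<ominus> \<one>) \<one> \<zero>"
proof
  fix p
  show "tau F \<sigma> p = semilinear_induced K (\<lambda>x. x) \<zero> (\<ominus> \<one>) \<one> \<zero> p"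
    by (auto simp: tau_def semilinear_induced_def proj_points_K proj_point_def inv_K star_uminus
        proj_points_def I_def sigma_closed split: option.split)
qed

lemma PGammaL2_I:
  assumes "\<alpha> \<in> ring_iso K K" "{a, b, c, d} \<subseteq> carrier F" "a \<star> d \<ominus> b \<star> c \<noteq> \<zero>"
  shows "semilinear_induced K \<alpha> a b c d \<in> PGammaL2 K"
proof -
  have "a \<otimes>\<^bsub>K\<^esub> d \<ominus>\<^bsub>K\<^esub> b \<otimes>\<^bsub>K\<^esub> c \<noteq> \<zero>\<^bsub>K\<^esub>" using assms by (simp add: minus_K)
  moreover have "{a, b, c, d} \<subseteq> carrier K" using assms by simp
  ultimately show ?thesis unfolding PGammaL2_def using assms(1) by blast
qed

lemma affine_map_PGammaL2: "a \<in> carrier F \<Longrightarrow> a \<noteq> \<zero> \<Longrightarrow> b \<in> carrier F \<Longrightarrow> affine_map F a b \<in> PGammaL2 K"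
  by (simp add: affine_map_eq PGammaL2_I \<phi>_iso ag_simps)

lemma tau_PGammaL2: "tau F \<sigma> \<in> PGammaL2 K"
  by (simp add: tau_eq PGammaL2_I K.id_ring_iso ag_simps)

lemma subgroup_PGammaL2_K: "subgroup (PGammaL2 K) (BijGroup (proj_points F))"
  using K.subgroup_PGammaL2 by (simp add: proj_points_K)

lemma generators_PGammaL2: "insert (tau F \<sigma>) (Aff F) \<subseteq> PGammaL2 K"
  using affine_map_PGammaL2 tau_PGammaL2 by (auto simp: Aff_def)

lemma T3_subset: "T3 F \<sigma> \<subseteq> PGammaL2 K"
  unfolding T3_def
  by (rule group.generate_subgroup_incl[OF group_BijGroup generators_PGammaL2 subgroup_PGammaL2_K])

lemma subgroup_T3: "subgroup (T3 F \<sigma>) (BijGroup (proj_points F))"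
  unfolding T3_def
  by (rule group.generate_is_subgroup[OF group_BijGroup])
    (use generators_PGammaL2 subgroup.subset[OF subgroup_PGammaL2_K] in blast)

section \<open>\<open>T3 F \<sigma>\<close> contains \<open>PSL2 K\<close>\<close>

lemma affine_map_T3: "a \<in> carrier F \<Longrightarrow> a \<noteq> \<zero> \<Longrightarrow> b \<in> carrier F \<Longrightarrow> affine_map F a b \<in> T3 F \<sigma>"
  unfolding T3_def by (rule generate.incl) (auto simp: Aff_def)

lemma tau_T3: "tau F \<sigma> \<in> T3 F \<sigma>"
  unfolding T3_def by (rule generate.incl) simp

lemma T3_compose:
  assumes "g \<in> T3 F \<sigma>" "h \<in> T3 F \<sigma>"
  shows "compose (proj_points F) g h \<in> T3 F \<sigma>"
proof -
  have "g \<in> Bij (proj_points F)" "h \<in> Bij (proj_points F)"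
    using assms subgroup.subset[OF subgroup_T3] by (auto simp: BijGroup_def)
  then have "g \<otimes>\<^bsub>BijGroup (proj_points F)\<^esub> h = compose (proj_points F) g h" by (simp add: BijGroup_def)
  then show ?thesis using subgroup.m_closed[OF subgroup_T3 assms] by simp
qed

text \<open>In the field, (ax + b) / a^-1 = a^2 x + ab, and by \<open>mult_Q\<close> multiplication
  by a^2 is right multiplication by \<open>Q a\<close> in F. So this affine map of F is linear over
  K.\<close>

lemma triangular_T3:
  assumes a: "a \<in> carrier F" "a \<noteq> \<zero>" and b: "b \<in> carrier F"
  shows "semilinear_induced K (\<lambda>x. x) a b \<zero> (I a) \<in> T3 F \<sigma>"
proof -
  have "semilinear_induced K (\<lambda>x. x) a b \<zero> (I a) = affine_map F (Q a) (a \<star> b)"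
  proof
    fix p
    show "semilinear_induced K (\<lambda>x. x) a b \<zero> (I a) p = affine_map F (Q a) (a \<star> b) p"
      using a b
      by (auto simp: affine_map_def semilinear_induced_def proj_points_K proj_point_def inv_K
          proj_points_def mult_Q star_distrib star_comm[of _ a] split: option.split)
  qed
  then show ?thesis using a b by (simp add: affine_map_T3)
qed

text \<open>Bruhat decomposition: a matrix with c \<noteq> 0 is a product of an upper unitriangular
  matrix, the matrix of \<tau> and an upper triangular one.\<close>

lemma PSL2_subset: "PSL2 K \<subseteq> T3 F \<sigma>"
proof
  fix g assume "g \<in> PSL2 K"
  then obtain a b c d where g: "g = semilinear_induced K (\<lambda>x. x) a b c d"
    and m: "a \<in> carrier F" "b \<in> carrier F" "c \<in> carrier F" "d \<in> carrier F"
    and det: "a \<star> d \<ominus> b \<star> c = \<one>"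
    by (auto simp: PSL2_def minus_K)
  show "g \<in> T3 F \<sigma>"
  proof (cases "c = \<zero>")
    case True
    then have ad: "a \<star> d = \<one>" using det m by (simp add: ag_simps)
    then have a: "a \<noteq> \<zero>" using m by auto
    then have "d = I a" using star_left_cancel[of a d "I a"] m ad by (simp add: star_I)
    then show ?thesis using triangular_T3[of a b] a m True by (simp add: g)
  next
    case False
    \<comment> \<open>g maps \<infinity> to a / c, whereas \<open>S2\<close> fixes \<infinity> and
      \<tau> sends it to 0; so \<open>S1\<close> must be the translation by a / c.\<close>
    define S1 where "S1 = semilinear_induced K (\<lambda>x. x) \<one> (a \<star> I c) \<zero> \<one>"
    define S2 where "S2 = semilinear_induced K (\<lambda>x. x) c d \<zero> (I c)"
    have S1: "S1 \<in> T3 F \<sigma>" using triangular_T3[of \<one> "a \<star> I c"] m by (simp add: S1_def)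
    have S2: "S2 \<in> T3 F \<sigma>" using triangular_T3[of c d] m False by (simp add: S2_def)
    have one: "\<one> \<ominus> \<zero> = \<one>" by (simp add: ag_simps)
    have tS2: "compose (proj_points F) (tau F \<sigma>) S2 = semilinear_induced K (\<lambda>x. x) \<zero> (\<ominus> I c) c d"
      unfolding tau_eq S2_def
      using K.semilinear_induced_compose[OF K.id_ring_iso _ K.id_ring_iso,
          of \<zero> "\<ominus> \<one>" \<one> \<zero> c d \<zero> "I c" "\<lambda>x. x"] m False
      by (simp add: proj_points_K minus_K star_I star_uminus one)
    have "b \<star> c = a \<star> d \<ominus> \<one>" using det m by (simp add: ag_simps)
    then have "b \<star> c \<star> I c = (a \<star> d \<ominus> \<one>) \<star> I c" by simp
    then have b: "b = a \<star> I c \<star> d \<ominus> I c"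
      using m False by (simp add: a_minus_def star_distrib star_uminus star_assoc star_I star_comm[of d "I c"])
    have "compose (proj_points F) S1 (compose (proj_points F) (tau F \<sigma>) S2) = g"
      unfolding tS2 S1_def g
      using K.semilinear_induced_compose[OF K.id_ring_iso _ K.id_ring_iso,
          of \<one> "a \<star> I c" \<zero> \<one> \<zero> "\<ominus> I c" c d "\<lambda>x. x"] m False b
      by (simp add: proj_points_K minus_K star_I_left star_uminus star_assoc a_comm a_minus_def)
    then show ?thesis using T3_compose[OF S1 T3_compose[OF tau_T3 S2]] by simp
  qed
qed

lemma sandwich:
  "field K \<and> coupling K \<phi> \<and> same_structure F (dickson K \<phi>) \<and>
   perm_subgroup_of F (PSL2 K) (T3 F \<sigma>) \<and> perm_subgroup_of F (T3 F \<sigma>) (PGammaL2 K)"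
  using K.subgroup_PSL2 subgroup_T3 subgroup_PGammaL2_K
  by (simp add: field_K coupling_\<phi> same_structure_dickson perm_subgroup_of_def PSL2_subset T3_subset proj_points_K)

end

lemma (in nearfield) one_add_one_if_char:
  assumes "nearfield_char F \<noteq> 2"
  shows "\<one> \<oplus> \<one> \<noteq> \<zero>"
proof
  assume two: "\<one> \<oplus> \<one> = \<zero>"
  interpret A: group "add_monoid F" by (rule add_group)
  have one: "\<one> \<in> carrier F" using group.is_monoid[OF mult_group] monoid.one_closed by fastforce
  have pow: "\<one> [^]\<^bsub>add_monoid F\<^esub> (2::nat) = \<zero>"
    using two one A.l_one[of \<one>] by (simp add: numeral_2_eq_2 A.nat_pow_Suc)
  then have "A.ord \<one> dvd 2" using A.pow_eq_id[of \<one> 2] one by simp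
  then have "A.ord \<one> = 1 \<or> A.ord \<one> = 2"
    by (metis two_is_prime_nat prime_nat_iff)
  moreover have "A.ord \<one> \<noteq> 1"
    using A.ord_eq_1[of \<one>] one zero_not_one by auto
  ultimately show False using assms by (simp add: nearfield_char_def)
qed

theorem theorem2:
  fixes F :: "('a, 'm) ring_scheme" and \<sigma> :: "'a \<Rightarrow> 'a"
  assumes "KT_nearfield F \<sigma>"
    and "nearfield_char F \<noteq> 2"
    and "finite_dim_over_kernel F"
  shows "\<exists>(K :: 'a ring) \<phi>.
           field K \<and> coupling K \<phi> \<and> same_structure F (dickson K \<phi>) \<and>
           perm_subgroup_of F (PSL2 K) (T3 F \<sigma>) \<and>
           perm_subgroup_of F (T3 F \<sigma>) (PGammaL2 K)"
proof -
  interpret KT_nearfield F \<sigma> by fact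
  interpret finite_dim_KT_nearfield F \<sigma>
    by unfold_locales (fact one_add_one_if_char[OF assms(2)], fact assms(3))
  show ?thesis using sandwich by blast
qed

end
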